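(* Let $k$ be an algebraically closed field of characteristic $0$ and let $A$ be a finitely generated $k$-algebra that is a domain with Gelfand-Kirillov dimension in $[2,3)$. If $A$ has a nonzero locally nilpotent derivation, then $A$ has Gelfand-Kirillov dimension $2$.
   Context: Algebras are associative and unital, not necessarily commutative. A derivation of a $k$-algebra $A$ is a $k$-linear map $\delta:A\to A$ with $\delta(ab)=a\delta(b)+\delta(a)b$ for all $a,b\in A$; it is locally nilpotent if for each $a\in A$ there is a natural number $n$ with $\delta^n(a)=0$. For a finitely generated $k$-algebra $A$, the Gelfand-Kirillov dimension (GK dimension) is $\mathrm{GKdim}(A)=\limsup_{n\to\infty}\frac{\log \dim_k(V^n)}{\log n}$, where $V$ is any finite-dimensional $k$-vector subspace of $A$ that contains $1$ and generates $A$ as a $k$-algebra (the value does not depend on $V$). *)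

theory Defs
  imports "HOL-Analysis.Extended_Real_Limits" "HOL-Computational_Algebra.Polynomial"
begin

definition locally_nilpotent :: "('a::zero \<Rightarrow> 'a) \<Rightarrow> bool" where
  "locally_nilpotent \<delta> \<longleftrightarrow> (\<forall>a. \<exists>n. (\<delta> ^^ n) a = 0)"

locale k_algebra = vector_space scale
  for scale :: "'k::field \<Rightarrow> 'a::ring_1 \<Rightarrow> 'a" (infixr \<open>\<odot>\<close> 75) +
  assumes scale_mult_left: "(c \<odot> a) * b = c \<odot> (a * b)"
    and scale_mult_right: "a * (c \<odot> b) = c \<odot> (a * b)"
begin

definition subalgebra :: "'a set \<Rightarrow> bool" where
  "subalgebra S \<longleftrightarrow> subspace S \<and> 1 \<in> S \<and> (\<forall>a\<in>S. \<forall>b\<in>S. a * b \<in> S)"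

definition generates :: "'a set \<Rightarrow> bool" where
  "generates X \<longleftrightarrow> subalgebra hull X = UNIV"

definition finitely_generated :: bool where
  "finitely_generated \<longleftrightarrow> (\<exists>X. finite X \<and> generates X)"

definition fin_dim :: "'a set \<Rightarrow> bool" where
  "fin_dim V \<longleftrightarrow> (\<exists>B. finite B \<and> V = span B)"

definition generating_space :: "'a set \<Rightarrow> bool" where
  "generating_space V \<longleftrightarrow> fin_dim V \<and> 1 \<in> V \<and> generates V"

primrec space_power :: "'a set \<Rightarrow> nat \<Rightarrow> 'a set" where
  "space_power V 0 = span {1}"
| "space_power V (Suc n) = span {a * b | a b. a \<in> space_power V n \<and> b \<in> V}"

definition growth_exponent :: "'a set \<Rightarrow> ereal" where
  "growth_exponent V = limsup (\<lambda>n. ereal (ln (real (dim (space_power V n))) / ln (real n)))"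

text \<open>
  The choice of the generating space is immaterial, see \<open>GKdim_eq\<close> below. The value is
  only meaningful for finitely generated algebras, where a generating space exists.
\<close>

definition GKdim :: ereal where
  "GKdim = growth_exponent (SOME V. generating_space V)"

definition derivation :: "('a \<Rightarrow> 'a) \<Rightarrow> bool" where
  "derivation \<delta> \<longleftrightarrow>
     Vector_Spaces.linear scale scale \<delta> \<and> (\<forall>a b. \<delta> (a * b) = a * \<delta> b + \<delta> a * b)"

lemma subspace_space_power: "subspace (space_power V n)"
  by (cases n) auto

lemma span_mult_span:
  assumes "a \<in> span A" "b \<in> span B"
  shows "a * b \<in> span {x * y | x y. x \<in> A \<and> y \<in> B}"
proof -
  let ?S = "span {x * y | x y. x \<in> A \<and> y \<in> B}"
  have 1: "x * b \<in> ?S" if "x \<in> A" for x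
    using assms(2)
  proof (induction rule: span_induct_alt)
    case base
    then show ?case by (simp add: span_zero)
  next
    case (step c y z)
    have "x * y \<in> ?S" using that step by (intro span_base) blast
    then show ?case using step
      by (simp add: distrib_left scale_mult_right span_add span_scale)
  qed
  show ?thesis using assms(1)
  proof (induction rule: span_induct_alt)
    case base
    then show ?case by (simp add: span_zero)
  next
    case (step c y z)
    then show ?case using 1[of y]
      by (simp add: distrib_right scale_mult_left span_add span_scale)
  qed
qed

lemma space_power_mult:
  "a \<in> space_power V m \<Longrightarrow> b \<in> space_power V n \<Longrightarrow> a * b \<in> space_power V (m + n)"
proof (induction n arbitrary: b)
  case 0
  then obtain c where "b = c \<odot> 1" by (auto simp: span_singleton)
  then show ?case using 0 subspace_space_power[of V m]
    by (simp add: scale_mult_right subspace_scale)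
next
  case (Suc n)
  have b: "b \<in> span {x * y | x y. x \<in> space_power V n \<and> y \<in> V}" using Suc.prems by simp
  have "a * b \<in> space_power V (m + Suc n)"
    using b
  proof (induction rule: span_induct_alt)
    case base
    then show ?case by (metis mult_zero_right subspace_0 subspace_space_power)
  next
    case (step c z w)
    then obtain x y where z: "z = x * y" "x \<in> space_power V n" "y \<in> V" by auto
    have "a * x \<in> space_power V (m + n)" using Suc z by blast
    hence "(a * x) * y \<in> space_power V (m + Suc n)" using z
      by (auto intro!: span_base)
    hence "a * z \<in> space_power V (m + Suc n)" using z by (simp add: mult.assoc)
    thus ?case using step subspace_space_power[of V "m + Suc n"]
      by (simp only: distrib_left scale_mult_right) (intro subspace_add subspace_scale; assumption)
  qed
  thus ?case .
qed

lemma space_power_mono: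
  assumes "1 \<in> V" "m \<le> n" shows "space_power V m \<subseteq> space_power V n"
  using assms(2)
proof (induction rule: dec_induct)
  case (step n)
  have "space_power V n \<subseteq> space_power V (Suc n)"
    using assms(1) by (force intro!: span_base)
  with step show ?case by blast
qed auto

lemma space_power_base: "b \<in> V \<Longrightarrow> b \<in> space_power V (Suc 0)"
  using span_base[of 1 "{1}"] by (force intro!: span_base)

lemma fin_dim_space_power:
  assumes "fin_dim V" shows "fin_dim (space_power V n)"
proof (induction n)
  case 0
  show ?case unfolding fin_dim_def by (intro exI[of _ "{1}"]) simp
next
  case (Suc n)
  obtain B where B: "finite B" "V = span B" using assms by (auto simp: fin_dim_def)
  obtain C where C: "finite C" "space_power V n = span C" using Suc by (auto simp: fin_dim_def)
  let ?D = "{x * y | x y. x \<in> C \<and> y \<in> B}"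
  have fin: "finite ?D" using B(1) C(1) by (intro finite_image_set2) simp_all
  have "span {a * b | a b. a \<in> span C \<and> b \<in> span B} \<subseteq> span ?D"
    by (intro span_minimal) (auto intro: span_mult_span)
  moreover have "span ?D \<subseteq> span {a * b | a b. a \<in> span C \<and> b \<in> span B}"
    by (intro span_mono) (auto intro: span_base)
  ultimately have "space_power V (Suc n) = span ?D" using B C by auto
  with fin show ?case unfolding fin_dim_def by blast
qed

lemma dim_mono_fin_dim:
  assumes "fin_dim W" "V \<subseteq> W" shows "dim V \<le> dim W"
proof -
  obtain B where B: "finite B" "W = span B" using assms by (auto simp: fin_dim_def)
  obtain C where C: "C \<subseteq> W" "independent C" "W \<subseteq> span C" "card C = dim W"
    by (rule basis_exists)
  have "finite C" using independent_span_bound[OF B(1) C(2)] C(1) B(2) by auto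
  thus ?thesis using dim_le_card[of V C] C assms(2) by auto
qed

lemma dim_space_power_pos:
  assumes "fin_dim V" "1 \<in> V" shows "dim (space_power V n) \<ge> 1"
proof -
  have "independent {1 :: 'a}" by (simp add: dependent_single)
  hence "dim (space_power V 0) = 1" using dim_eq_card_independent[of "{1}"] by simp
  thus ?thesis
    using dim_mono_fin_dim[OF fin_dim_space_power[OF assms(1)] space_power_mono[OF assms(2), of 0 n]]
    by simp
qed

lemma UN_space_power:
  assumes "generating_space V" shows "(\<Union>n. space_power V n) = UNIV"
proof -
  have 1: "1 \<in> V" and gen: "subalgebra hull V = UNIV"
    using assms by (auto simp: generating_space_def generates_def)
  let ?U = "\<Union>n. space_power V n"
  have "subalgebra ?U"
    unfolding subalgebra_def
  proof (intro conjI ballI)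
    show "subspace ?U"
      unfolding subspace_def
    proof (intro conjI ballI allI)
      show "0 \<in> ?U" by (rule UN_I[OF UNIV_I], rule subspace_0[OF subspace_space_power])
    next
      fix x y assume "x \<in> ?U" "y \<in> ?U"
      then obtain i j where "x \<in> space_power V i" "y \<in> space_power V j" by auto
      hence "x \<in> space_power V (max i j)" "y \<in> space_power V (max i j)"
        using space_power_mono[OF 1] by (meson max.cobounded1 max.cobounded2 subsetD)+
      thus "x + y \<in> ?U" by (intro UN_I[OF UNIV_I] subspace_add[OF subspace_space_power])
    next
      fix c x assume "x \<in> ?U"
      then obtain i where "x \<in> space_power V i" by auto
      thus "c \<odot> x \<in> ?U" by (intro UN_I[OF UNIV_I] subspace_scale[OF subspace_space_power])
    qed
    show "1 \<in> ?U" by (rule UN_I[OF UNIV_I], rule space_power_base[OF 1])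
    show "a * b \<in> ?U" if ab: "a \<in> ?U" "b \<in> ?U" for a b
    proof -
      obtain i j where "a \<in> space_power V i" "b \<in> space_power V j" using ab by auto
      hence "a * b \<in> space_power V (i + j)" by (rule space_power_mult)
      thus ?thesis by (rule UN_I[OF UNIV_I])
    qed
  qed
  moreover have "V \<subseteq> ?U" by (rule subsetI, rule UN_I[OF UNIV_I], rule space_power_base)
  ultimately have "subalgebra hull V \<subseteq> ?U" by (intro hull_minimal)
  thus ?thesis using gen by auto
qed

lemma fin_dim_subset_space_power:
  assumes "generating_space V" "fin_dim W"
  obtains m where "m > 0" "W \<subseteq> space_power V m"
proof -
  have 1: "1 \<in> V" using assms by (auto simp: generating_space_def)
  obtain B where B: "finite B" "W = span B" using assms by (auto simp: fin_dim_def)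
  have "\<exists>n. b \<in> space_power V n" for b using UN_space_power[OF assms(1)] by blast
  then obtain f where f: "\<And>b. b \<in> space_power V (f b)" by metis
  define m where "m = Suc (\<Sum>b\<in>B. f b)"
  have "b \<in> space_power V m" if "b \<in> B" for b
  proof -
    have "f b \<le> m" unfolding m_def using member_le_sum[of b B f] that B(1) by auto
    thus ?thesis using f[of b] space_power_mono[OF 1] by blast
  qed
  hence "W \<subseteq> space_power V m" unfolding B(2) by (intro span_minimal subspace_space_power) blast
  moreover have "m > 0" by (simp add: m_def)
  ultimately show ?thesis using that by blast
qed

lemma space_power_subset_power:
  assumes "W \<subseteq> space_power V m" shows "space_power W n \<subseteq> space_power V (m * n)"
proof (induction n)
  case (Suc n)
  have "a * b \<in> space_power V (m * Suc n)" if "a \<in> space_power W n" "b \<in> W" for a b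
    using space_power_mult[of a V "m * n" b m] that assms Suc by (auto simp: algebra_simps)
  thus ?case unfolding space_power.simps(2)
    by (intro span_minimal subspace_space_power) blast
qed simp

lemma growth_exponent_le:
  assumes V: "generating_space V" and W: "generating_space W"
  shows "growth_exponent W \<le> growth_exponent V"
proof -
  have fd: "fin_dim V" "fin_dim W" "1 \<in> V" "1 \<in> W"
    using V W by (auto simp: generating_space_def)
  obtain m where m: "m > 0" "W \<subseteq> space_power V m"
    using fin_dim_subset_space_power[OF V fd(2)] .
  define v where "v n = ln (real (dim (space_power V n)))" for n
  define w where "w n = ln (real (dim (space_power W n)))" for n
  have wv: "w n \<le> v (m * n)" for n
    unfolding v_def w_def
    using dim_mono_fin_dim[OF fin_dim_space_power[OF fd(1)] space_power_subset_power[OF m(2), of n]]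
      dim_space_power_pos[OF fd(2,4), of n] by simp
  have "limsup (\<lambda>n. ereal (w n / ln (real n))) \<le> limsup (\<lambda>n. ereal (v n / ln (real n)))"
    (is "_ \<le> ?L")
    unfolding Limsup_le_iff
  proof (intro allI impI)
    fix y assume y: "?L < y"
    obtain r' where r': "?L < ereal r'" "ereal r' < y" using ereal_dense2[OF y] by blast
    obtain r where r: "?L < ereal r" "ereal r < ereal r'" using ereal_dense2[OF r'(1)] by blast
    have "eventually (\<lambda>n. ereal (v n / ln (real n)) < ereal r) sequentially"
      using r(1) by (rule Limsup_lessD)
    moreover have "filterlim (\<lambda>n. m * n) at_top sequentially"
      using m(1) by (intro filterlim_subseq) (auto simp: strict_mono_def)
    ultimately have 1: "eventually (\<lambda>n. v (m * n) / ln (real (m * n)) < r) sequentially"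
      by (auto dest: eventually_compose_filterlim simp del: of_nat_mult)
    have ln_lim: "filterlim (\<lambda>n. ln (real n)) at_top sequentially"
      by (rule filterlim_compose[OF ln_at_top filterlim_real_sequentially])
    have "(\<lambda>n. r * (ln (real m) / ln (real n))) \<longlonglongrightarrow> r * 0"
      by (intro tendsto_mult tendsto_const tendsto_divide_0[OF tendsto_const])
         (rule filterlim_at_top_imp_at_infinity[OF ln_lim])
    hence 2: "eventually (\<lambda>n. r * (ln (real m) / ln (real n)) < r' - r) sequentially"
      using r(2) by (intro order_tendstoD) auto
    show "eventually (\<lambda>n. ereal (w n / ln (real n)) < y) sequentially"
      using 1 2 eventually_gt_at_top[of 1]
    proof eventually_elim
      case (elim n)
      have l: "ln (real n) > 0" "real m \<ge> 1" using elim(3) m(1) by auto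
      have lm: "ln (real (m * n)) = ln (real m) + ln (real n)"
        using m(1) elim(3) by (simp add: ln_mult)
      have pos: "ln (real (m * n)) > 0" unfolding lm using l by (simp add: add_nonneg_pos)
      have "w n \<le> v (m * n)" by (rule wv)
      also have "\<dots> \<le> r * ln (real (m * n))" using elim(1) pos by (simp add: field_simps)
      finally have "w n \<le> r * ln (real m) + r * ln (real n)" by (simp only: lm distrib_left)
      hence "w n / ln (real n) \<le> r * (ln (real m) / ln (real n)) + r"
        using l by (simp add: field_simps)
      also have "\<dots> < r'" using elim(2) by simp
      finally have "ereal (w n / ln (real n)) < ereal r'" by simp
      thus ?case using r'(2) by (rule less_trans)
    qed
  qed
  thus ?thesis by (simp add: growth_exponent_def v_def w_def)
qed

lemma ex_generating_space:
  assumes finitely_generated shows "\<exists>V. generating_space V"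
proof -
  obtain X where X: "finite X" "subalgebra hull X = UNIV"
    using assms by (auto simp: finitely_generated_def generates_def)
  have "X \<subseteq> span (insert 1 X)" by (auto intro: span_base)
  hence "subalgebra hull X \<subseteq> subalgebra hull (span (insert 1 X))" by (rule hull_mono)
  hence "generating_space (span (insert 1 X))"
    using X unfolding generating_space_def generates_def fin_dim_def
    by (auto intro: span_base exI[of _ "insert 1 X"])
  thus ?thesis by blast
qed

lemma GKdim_eq:
  assumes "generating_space V" shows "GKdim = growth_exponent V"
  unfolding GKdim_def
  using growth_exponent_le someI[of generating_space V] assms by (metis order_antisym)

end

end

theory Submission
  imports Defs "HOL-Library.Function_Algebras" "Jordan_Normal_Form.Determinant"
    "HOL-Real_Asymp.Real_Asymp"
begin

text \<open>
  Let \<open>B\<close> be the kernel of the derivation \<open>\<delta>\<close> and choose \<open>x\<close> with \<open>\<delta> x = c \<noteq> 0\<close> and \<open>\<delta> c = 0\<close>.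
  The powers of \<open>x\<close> are left independent over \<open>B\<close>, so GK dimension below 3 forces the finitely
  generated subalgebras of \<open>B\<close> to grow subquadratically. Such a subalgebra has finite rank over
  every \<open>k[t]\<close>, hence linear growth.

  \<open>B\<close> is commutative, by a noncommutative form of Tsen's theorem: if \<open>V\<close> is a power of the generating
  space of a noncommutative finitely generated subalgebra, choose \<open>dim V - 1\<close> many simple modules of
  finite dimension at least 2. The determinants of the action of \<open>a \<in> V\<close> on them are homogeneous
  polynomials, fewer than the number of variables, hence vanish at some \<open>a \<noteq> 0\<close>. The right
  ideal of \<open>a\<close> then has codimension at least \<open>2 (dim V - 1)\<close>, about twice what linear growth allows.

  Finally, if \<open>z \<in> B\<close> is transcendental, then \<open>b \<mapsto> x b - b x\<close> is a derivation of \<open>B\<close>, and finitely many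
  elements of \<open>B\<close>, which are algebraic over \<open>k(z)\<close>, generate an algebra that is stable under it up to
  a denominator in \<open>k[z]\<close>. Bounding denominators, degrees in \<open>z\<close> and degrees in \<open>x\<close>
  of words of length \<open>n\<close> linearly in \<open>n\<close> yields quadratic growth.
\<close>

section \<open>Independence modulo a subspace\<close>

text \<open>Finite rank is a count: n + 1 words of length at most n that are left independent over
  k[t] give (n + 1)^2 independent elements of length at most 2 n, so a bound below (n + 1)^2 stops
  the search for a basis. In the noncommutative case everything hangs on the factor 2. Left
  multiplication by \<open>a\<close> is injective, so the right ideal of \<open>a\<close> contains
  copies of all powers of the generating space, and its codimension is a lower bound for the growth
  over m steps, m being the exponent of V. Modules of dimension 1 would return only the rate already
  known; dimension 2 nearly doubles it, and repetition exceeds every linear bound. Modules of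
  dimension at least 2 abound because a module of dimension 1 is killed by p q - q p. The common
  zero of the determinants comes from the projective dimension theorem, obtained from Hilbert
  functions. Quotient division rings are never formed: fractions are handled by denominators in
  k[t], so that each estimate compares dimensions of subspaces of the algebra. If the kernel
  consists of scalars there is no z; then A is spanned by the powers of x.\<close>

context k_algebra
begin

lemma fin_dim_span: "finite B \<Longrightarrow> fin_dim (span B)"
  unfolding fin_dim_def by blast

lemma indep_card_le_dim:
  assumes "fin_dim W" "B \<subseteq> W" "independent B"
  shows "finite B" "card B \<le> dim W"
proof -
  obtain C where C: "finite C" "W = span C" using assms(1) by (auto simp: fin_dim_def)
  show "finite B" using independent_span_bound[OF C(1) assms(3)] assms(2) C(2) by auto
  show "card B \<le> dim W"
    using dim_mono_fin_dim[OF assms(1,2)] dim_eq_card_independent[OF assms(3)] by simp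
qed

text \<open>Linear independence of the images in the quotient by \<open>J\<close>, phrased without
  forming the quotient. For a family, unlike a set, two members that agree modulo \<open>J\<close>
  already violate it.\<close>

definition indep_mod :: "'a set \<Rightarrow> 'i set \<Rightarrow> ('i \<Rightarrow> 'a) \<Rightarrow> bool" where
  "indep_mod J I f \<longleftrightarrow> (\<forall>c. (\<Sum>i\<in>I. c i \<odot> f i) \<in> J \<longrightarrow> (\<forall>i\<in>I. c i = 0))"

lemma indep_modD: "indep_mod J I f \<Longrightarrow> (\<Sum>i\<in>I. c i \<odot> f i) \<in> J \<Longrightarrow> i \<in> I \<Longrightarrow> c i = 0"
  unfolding indep_mod_def by blast

lemma indep_mod_mono: "indep_mod J I f \<Longrightarrow> J' \<subseteq> J \<Longrightarrow> indep_mod J' I f"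
  unfolding indep_mod_def by blast

text \<open>The values of \<open>f\<close> and a basis of \<open>J\<close> together form an
  independent subset of \<open>W\<close>. Testing the hypothesis on the coefficients 1, -1 and on a
  single 1 shows that \<open>f\<close> is injective and avoids \<open>J\<close>.\<close>

lemma indep_mod_card_le:
  assumes W: "fin_dim W" and J: "subspace J" "J \<subseteq> W" and I: "finite I" "\<And>i. i \<in> I \<Longrightarrow> f i \<in> W"
    and f: "indep_mod J I f"
  shows "card I + dim J \<le> dim W"
proof -
  obtain C where C: "C \<subseteq> J" "independent C" "J \<subseteq> span C" "card C = dim J"
    by (rule basis_exists)
  have finC: "finite C" using indep_card_le_dim(1)[OF W _ C(2)] C(1) J(2) by blast
  have inj: "inj_on f I"
  proof (rule inj_onI, rule ccontr)
    fix i j assume ij: "i \<in> I" "j \<in> I" "f i = f j" "i \<noteq> j"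
    let ?c = "\<lambda>l. if l = i then 1 else if l = j then - 1 else (0::'k)"
    have "(\<Sum>l\<in>I. ?c l \<odot> f l) = (\<Sum>l\<in>{i,j}. ?c l \<odot> f l)"
      using I(1) ij by (intro sum.mono_neutral_right) auto
    also have "\<dots> = 0" using ij by simp
    finally have "(\<Sum>l\<in>I. ?c l \<odot> f l) \<in> J" using subspace_0[OF J(1)] by simp
    from indep_modD[OF f this ij(1)] show False by simp
  qed
  have sub: "f ` I \<union> C \<subseteq> W" using I(2) C(1) J(2) by blast
  have disj: "f ` I \<inter> C = {}"
  proof (rule ccontr)
    assume "f ` I \<inter> C \<noteq> {}"
    then obtain i where i: "i \<in> I" "f i \<in> C" by blast
    let ?c = "\<lambda>l. if l = i then 1 else (0::'k)"
    have "(\<Sum>l\<in>I. ?c l \<odot> f l) = f i"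
      using I(1) i(1) by (subst sum.remove[of _ i]) (auto intro!: sum.neutral)
    then have "(\<Sum>l\<in>I. ?c l \<odot> f l) \<in> J" using i(2) C(1) by auto
    from indep_modD[OF f this i(1)] show False by simp
  qed
  have "independent (f ` I \<union> C)"
  proof (rule independent_if_scalars_zero)
    show "finite (f ` I \<union> C)" using I(1) finC by simp
    fix g x assume g: "(\<Sum>x\<in>f ` I \<union> C. g x \<odot> x) = 0" and x: "x \<in> f ` I \<union> C"
    have "(\<Sum>x\<in>f ` I \<union> C. g x \<odot> x) = (\<Sum>i\<in>I. g (f i) \<odot> f i) + (\<Sum>x\<in>C. g x \<odot> x)"
      using I(1) finC disj inj by (simp add: sum.union_disjoint sum.reindex)
    with g have e: "(\<Sum>i\<in>I. g (f i) \<odot> f i) = - (\<Sum>x\<in>C. g x \<odot> x)"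
      by (simp add: eq_neg_iff_add_eq_0)
    have "(\<Sum>x\<in>C. g x \<odot> x) \<in> J"
      using C(1) J(1) by (intro subspace_sum subspace_scale) auto
    then have "(\<Sum>i\<in>I. g (f i) \<odot> f i) \<in> J" unfolding e by (rule subspace_neg[OF J(1)])
    then have z: "g (f i) = 0" if "i \<in> I" for i
      using indep_modD[OF f, of "\<lambda>i. g (f i)" i] that by simp
    then have "(\<Sum>x\<in>C. g x \<odot> x) = 0" using e by simp
    then have "g x = 0" if "x \<in> C" for x
      using independentD[OF C(2) finC subset_refl _ that] by blast
    with z x show "g x = 0" by blast
  qed
  from indep_card_le_dim(2)[OF W sub this] show ?thesis
    using I(1) finC disj inj C(4) by (simp add: card_Un_disjoint card_image)
qed

lemma indep_card_le:
  assumes "fin_dim W" "subspace W" "finite I" "\<And>i. i \<in> I \<Longrightarrow> f i \<in> W" "indep_mod {0} I f"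
  shows "card I \<le> dim W"
  using indep_mod_card_le[of W "{0}" I f] assms subspace_0[of W] by auto

lemma complement_exists:
  assumes W: "fin_dim W" and J: "J \<subseteq> W"
  obtains X where "finite X" "X \<subseteq> W" "card X = dim W - dim J" "W \<subseteq> span (J \<union> X)"
proof -
  obtain C where C: "C \<subseteq> J" "independent C" "J \<subseteq> span C" "card C = dim J"
    by (rule basis_exists)
  obtain D where D: "C \<subseteq> D" "D \<subseteq> W" "independent D" "W \<subseteq> span D"
    using maximal_independent_subset_extend[OF _ C(2), of W] C(1) J by blast
  have finD: "finite D" using indep_card_le_dim(1)[OF W D(2,3)] .
  have "card (D - C) = dim W - dim J"
    using basis_card_eq_dim[OF D(2,4,3)] C(4) D(1) finD by (simp add: card_Diff_subset finite_subset)
  moreover have "span D \<subseteq> span (J \<union> (D - C))" using C(1) by (intro span_mono) blast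
  ultimately show ?thesis using that[of "D - C"] finD D by blast
qed

lemma dim_le_add_card:
  assumes "fin_dim J" "finite X" "W \<subseteq> span (J \<union> X)"
  shows "dim W \<le> dim J + card X"
proof -
  obtain C where C: "C \<subseteq> J" "independent C" "J \<subseteq> span C" "card C = dim J"
    by (rule basis_exists)
  have finC: "finite C" using indep_card_le_dim(1)[OF assms(1) C(1,2)] .
  have "J \<union> X \<subseteq> span (C \<union> X)" using C(3) span_mono[of C "C \<union> X"] span_superset[of "C \<union> X"] by blast
  then have "span (J \<union> X) \<subseteq> span (C \<union> X)" by (intro span_minimal) auto
  then have "dim W \<le> card (C \<union> X)" using assms(2,3) finC by (intro dim_le_card) auto
  also have "\<dots> \<le> dim J + card X" using card_Un_le[of C X] C(4) by simp
  finally show ?thesis .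
qed

lemma fin_dim_subspace:
  assumes "fin_dim W" "J \<subseteq> W" "subspace J" shows "fin_dim J"
proof -
  obtain C where C: "C \<subseteq> J" "independent C" "J \<subseteq> span C" "card C = dim J"
    by (rule basis_exists)
  have "finite C" using indep_card_le_dim(1)[OF assms(1) _ C(2)] C(1) assms(2) by blast
  moreover have "J = span C" using C(1,3) span_minimal[OF C(1) assms(3)] by blast
  ultimately show ?thesis unfolding fin_dim_def by blast
qed

lemma subspace_eq_if_dim_le:
  assumes "fin_dim W" "subspace J" "J \<subseteq> W" "dim W \<le> dim J"
  shows "J = W"
proof (rule ccontr)
  assume "J \<noteq> W"
  then obtain w where w: "w \<in> W" "w \<notin> J" using assms(3) by blast
  have "indep_mod J {()} (\<lambda>_. w)"
    unfolding indep_mod_def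
  proof (intro allI impI ballI)
    fix c :: "unit \<Rightarrow> 'k" and i assume "(\<Sum>i\<in>{()}. c i \<odot> w) \<in> J" "i \<in> {()}"
    then have h: "c () \<odot> w \<in> J" by simp
    show "c i = 0"
    proof (rule ccontr)
      assume "c i \<noteq> 0"
      then have "inverse (c ()) \<odot> (c () \<odot> w) = w" by simp
      then show False using subspace_scale[OF assms(2) h, of "inverse (c ())"] w(2) by simp
    qed
  qed
  from indep_mod_card_le[OF assms(1,2,3) _ _ this] w assms(4) show False by simp
qed

end

section \<open>Common zeros of homogeneous polynomials\<close>

locale comm_algebra = k_algebra scale
  for scale :: "'k::alg_closed_field \<Rightarrow> 'a::comm_ring_1 \<Rightarrow> 'a" (infixr \<open>\<odot>\<close> 75) +
  fixes V :: "'a set"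
  assumes V: "subspace V" "fin_dim V"
begin

abbreviation S where "S \<equiv> space_power V"

text \<open>The pieces are kept apart as a family because the sum of the \<open>S t\<close> need not
  be direct in the algebra. The graded quotient ring appears only through its pieces
  \<open>S t\<close> modulo \<open>I t\<close>.\<close>

definition graded_ideal :: "(nat \<Rightarrow> 'a set) \<Rightarrow> bool" where
  "graded_ideal I \<longleftrightarrow> (\<forall>t. subspace (I t) \<and> I t \<subseteq> S t) \<and>
     (\<forall>t u a b. a \<in> I t \<longrightarrow> b \<in> S u \<longrightarrow> a * b \<in> I (t + u))"

text \<open>The ideal generated by \<open>I\<close> and the form \<open>snd F\<close>. Its degree is
  stored because an element may lie in several \<open>S t\<close>. Degrees below
  \<open>fst F\<close> are separate since truncated subtraction would allow multiples of
  \<open>snd F\<close> there.\<close>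

definition add_form :: "nat \<times> 'a \<Rightarrow> (nat \<Rightarrow> 'a set) \<Rightarrow> nat \<Rightarrow> 'a set" where
  "add_form F I t = (if t < fst F then I t else {a + snd F * g | a g. a \<in> I t \<and> g \<in> S (t - fst F)})"

text \<open>By \<open>graded_ideal_full\<close> an ideal that fills one degree fills all higher
  ones, so this says that no power of the irrelevant ideal is contained in \<open>I\<close>.\<close>

definition relevant :: "(nat \<Rightarrow> 'a set) \<Rightarrow> bool" where
  "relevant I \<longleftrightarrow> (\<forall>t. I t \<noteq> S t)"

definition hilbert_le :: "(nat \<Rightarrow> 'a set) \<Rightarrow> nat \<Rightarrow> bool" where
  "hilbert_le I j \<longleftrightarrow> (\<exists>C. \<forall>t. dim (S t) - dim (I t) \<le> C * (t + 1) ^ j)"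

lemma fin_dim_S: "fin_dim (S t)"
  by (rule fin_dim_space_power[OF V(2)])

lemma S_0: "0 \<in> S t"
  by (rule subspace_0[OF subspace_space_power])

lemma one_in_S: "1 \<in> S 0"
  by (simp add: span_base)

lemma V_eq: "V = S 1"
proof -
  have "{a * b |a b. a \<in> span {1} \<and> b \<in> V} \<subseteq> V"
    using V(1) by (auto simp: span_singleton scale_mult_left subspace_scale)
  then have "S 1 \<subseteq> V" using span_minimal[OF _ V(1)] by simp
  then show ?thesis using space_power_base by auto
qed

lemma graded_idealD:
  assumes "graded_ideal I"
  shows "subspace (I t)" "I t \<subseteq> S t" "a \<in> I t \<Longrightarrow> b \<in> S u \<Longrightarrow> a * b \<in> I (t + u)"
  using assms unfolding graded_ideal_def by blast+

lemma graded_ideal_mult_left: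
  assumes "graded_ideal I" "b \<in> S u" "a \<in> I t" shows "b * a \<in> I (u + t)"
  using graded_idealD(3)[OF assms(1,3,2)] by (simp add: mult.commute add.commute)

lemma fin_dim_I: "graded_ideal I \<Longrightarrow> fin_dim (I t)"
  using fin_dim_subspace[OF fin_dim_S] graded_idealD(1,2) by blast

lemma dim_I_le: "graded_ideal I \<Longrightarrow> dim (I t) \<le> dim (S t)"
  by (rule dim_mono_fin_dim[OF fin_dim_S graded_idealD(2)])

lemma graded_ideal_zero: "graded_ideal (\<lambda>_. {0})"
  unfolding graded_ideal_def using S_0 by auto

lemma graded_ideal_full:
  assumes "graded_ideal I" "I t = S t" "t \<le> u" shows "I u = S u"
  using assms(3)
proof (induction rule: dec_induct)
  case (step u)
  have "{a * b |a b. a \<in> S u \<and> b \<in> V} \<subseteq> I (Suc u)"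
    using graded_idealD(3)[OF assms(1), of _ u _ 1] step(3) V_eq by auto
  then have "S (Suc u) \<subseteq> I (Suc u)" using span_minimal graded_idealD(1)[OF assms(1)] by simp
  then show ?case using graded_idealD(2)[OF assms(1)] by blast
qed (rule assms(2))

lemma add_formI:
  "fst F \<le> t \<Longrightarrow> a \<in> I t \<Longrightarrow> g \<in> S (t - fst F) \<Longrightarrow> x = a + snd F * g \<Longrightarrow> x \<in> add_form F I t"
  unfolding add_form_def by auto

lemma add_form_superset: "I t \<subseteq> add_form F I t"
proof
  fix a assume "a \<in> I t"
  then show "a \<in> add_form F I t"
    using add_formI[of F t a I 0 a] S_0 by (cases "t < fst F") (auto simp: add_form_def)
qed

lemma add_form_contains:
  assumes "graded_ideal I" shows "snd F \<in> add_form F I (fst F)"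
  using subspace_0[OF graded_idealD(1)[OF assms]] one_in_S by (intro add_formI[of _ _ 0 _ 1]) auto

lemma graded_ideal_add_form:
  assumes I: "graded_ideal I" and F: "snd F \<in> S (fst F)"
  shows "graded_ideal (add_form F I)"
  unfolding graded_ideal_def
proof (intro conjI allI impI)
  fix t
  note sI = graded_idealD(1)[OF I]
  show "subspace (add_form F I t)"
  proof (cases "t < fst F")
    case True
    then show ?thesis using sI by (simp add: add_form_def)
  next
    case False
    show ?thesis
      unfolding subspace_def
    proof (intro conjI ballI allI)
      show "0 \<in> add_form F I t" using add_form_superset subspace_0[OF sI] by blast
    next
      fix x y assume "x \<in> add_form F I t" "y \<in> add_form F I t"
      then obtain a g a' g' where "a \<in> I t" "a' \<in> I t" "g \<in> S (t - fst F)" "g' \<in> S (t - fst F)"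
        "x = a + snd F * g" "y = a' + snd F * g'" using False by (auto simp: add_form_def)
      then show "x + y \<in> add_form F I t" using False
        by (intro add_formI[of _ _ "a + a'" _ "g + g'"] subspace_add[OF sI]
            subspace_add[OF subspace_space_power]) (auto simp: algebra_simps)
    next
      fix c x assume "x \<in> add_form F I t"
      then obtain a g where "a \<in> I t" "g \<in> S (t - fst F)"
        "x = a + snd F * g" using False by (auto simp: add_form_def)
      then show "c \<odot> x \<in> add_form F I t" using False
        by (intro add_formI[of _ _ "c \<odot> a" _ "c \<odot> g"] subspace_scale[OF sI]
            subspace_scale[OF subspace_space_power]) (auto simp: scale_right_distrib scale_mult_right)
    qed
  qed
  show "add_form F I t \<subseteq> S t"
  proof (cases "t < fst F")
    case True
    then show ?thesis using graded_idealD(2)[OF I] by (auto simp: add_form_def)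
  next
    case False
    have "a + snd F * g \<in> S t" if "a \<in> I t" "g \<in> S (t - fst F)" for a g
    proof (rule subspace_add[OF subspace_space_power])
      show "a \<in> S t" using graded_idealD(2)[OF I] that(1) by blast
      show "snd F * g \<in> S t" using space_power_mult[OF F that(2)] False by simp
    qed
    then show ?thesis using False by (auto simp: add_form_def)
  qed
  fix u a b assume a: "a \<in> add_form F I t" and b: "b \<in> S u"
  show "a * b \<in> add_form F I (t + u)"
  proof (cases "t < fst F")
    case True
    then have "a \<in> I t" using a by (simp add: add_form_def)
    then have "a * b \<in> I (t + u)" by (rule graded_idealD(3)[OF I _ b])
    then show ?thesis using add_form_superset by blast
  next
    case False
    then obtain a' g where ag: "a' \<in> I t" "g \<in> S (t - fst F)" "a = a' + snd F * g"
      using a by (auto simp: add_form_def)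
    have "a' * b \<in> I (t + u)" by (rule graded_idealD(3)[OF I ag(1) b])
    moreover have "g * b \<in> S (t + u - fst F)"
      using space_power_mult[OF ag(2) b] False by simp
    moreover have "a * b = a' * b + snd F * (g * b)" by (simp add: ag(3) algebra_simps)
    ultimately show ?thesis using False by (intro add_formI[of _ _ "a' * b" _ "g * b"]) auto
  qed
qed

text \<open>Multiplication by \<open>snd F\<close> maps \<open>S (t - fst F)\<close> modulo
  \<open>K\<close> onto the degree \<open>t\<close> piece of the enlarged ideal modulo
  \<open>I t\<close>. The choice \<open>K = I (t - fst F)\<close> gives \<open>hilbert_step\<close>;
  a larger \<open>K\<close> detects a failure of injectivity in
  \<open>eventually_injective\<close>.\<close>

lemma dim_add_form_le:
  assumes I: "graded_ideal I" and F: "snd F \<in> S (fst F)" "fst F \<le> t"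
    and K: "I (t - fst F) \<subseteq> K" "K \<subseteq> S (t - fst F)" "\<And>g. g \<in> K \<Longrightarrow> snd F * g \<in> I t"
  shows "dim (add_form F I t) + dim K \<le> dim (I t) + dim (S (t - fst F))"
proof -
  obtain X where X: "finite X" "X \<subseteq> S (t - fst F)" "card X = dim (S (t - fst F)) - dim K"
     "S (t - fst F) \<subseteq> span (K \<union> X)"
    using complement_exists[OF fin_dim_S K(2)] .
  let ?U = "span (I t \<union> (\<lambda>g. snd F * g) ` X)"
  have 1: "snd F * g \<in> ?U" if "g \<in> span (K \<union> X)" for g
    using that
  proof (induction rule: span_induct_alt)
    case base
    then show ?case by (simp add: span_zero)
  next
    case (step c x y)
    have "snd F * x \<in> ?U" using step(1) K(3) by (auto intro: span_base)
    then show ?case using step(2)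
      by (simp add: distrib_left scale_mult_right span_add span_scale)
  qed
  have "add_form F I t \<subseteq> ?U"
  proof
    fix x assume "x \<in> add_form F I t"
    then obtain a g where "a \<in> I t" "g \<in> S (t - fst F)" "x = a + snd F * g"
      using F(2) by (auto simp: add_form_def)
    then show "x \<in> ?U" using 1 X(4) by (auto intro!: span_add intro: span_base)
  qed
  from dim_le_add_card[OF fin_dim_I[OF I] _ this]
  have "dim (add_form F I t) \<le> dim (I t) + card ((\<lambda>g. snd F * g) ` X)" using X(1) by simp
  also have "\<dots> \<le> dim (I t) + card X" using card_image_le[OF X(1)] by simp
  finally show ?thesis
    using X(3) dim_mono_fin_dim[OF fin_dim_S K(2)] by simp
qed

lemma hilbert_step:
  assumes I: "graded_ideal I" and F: "snd F \<in> S (fst F)" "fst F \<le> t"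
  shows "dim (S t) - dim (I t) \<le> (dim (S t) - dim (add_form F I t)) +
     (dim (S (t - fst F)) - dim (I (t - fst F)))"
proof -
  have "snd F * g \<in> I t" if "g \<in> I (t - fst F)" for g
    using graded_ideal_mult_left[OF I F(1) that] F(2) by simp
  from dim_add_form_le[OF I F subset_refl graded_idealD(2)[OF I] this]
  show ?thesis using dim_I_le[OF I, of "t - fst F"] dim_I_le[OF I, of t]
    dim_I_le[OF graded_ideal_add_form[OF I F(1)], of t] by linarith
qed

text \<open>Descending from \<open>t\<close> in steps of \<open>fst F\<close>,
  \<open>hilbert_step\<close> collects at most t + 1 terms of order (t + 1)^j. Adding one form thus
  lowers the degree of growth by at most one.\<close>

lemma hilbert_le_Suc:
  assumes I: "graded_ideal I" and F: "snd F \<in> S (fst F)" "fst F > 0"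
    and h: "hilbert_le (add_form F I) j"
  shows "hilbert_le I (Suc j)"
proof -
  obtain C where C: "\<And>t. dim (S t) - dim (add_form F I t) \<le> C * (t + 1) ^ j"
    using h by (auto simp: hilbert_le_def)
  have "dim (S t) - dim (I t) \<le> C * (t + 1) ^ Suc j" for t
  proof (induction t rule: less_induct)
    case (less t)
    show ?case
    proof (cases "t < fst F")
      case True
      then have "dim (S t) - dim (I t) \<le> C * (t + 1) ^ j" using C[of t] by (simp add: add_form_def)
      also have "\<dots> \<le> C * (t + 1) ^ Suc j" by simp
      finally show ?thesis .
    next
      case False
      have "dim (S t) - dim (I t) \<le> C * (t + 1) ^ j + C * (t - fst F + 1) ^ Suc j"
        using hilbert_step[OF I F(1), of t] C[of t] less.IH[of "t - fst F"] False F(2) by simp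
      also have "(t - fst F + 1) ^ Suc j \<le> t * (t + 1) ^ j"
        unfolding power_Suc using False F(2) by (intro mult_mono power_mono) auto
      finally show ?thesis by (simp add: algebra_simps)
    qed
  qed
  then show ?thesis unfolding hilbert_le_def by blast
qed

text \<open>Where the enlarged ideal is full, \<open>hilbert_step\<close> bounds the Hilbert
  function by its value \<open>fst F\<close> degrees earlier. The finitely many values below the
  threshold therefore bound all others, and their sum is a convenient majorant.\<close>

lemma hilbert_le_0:
  assumes I: "graded_ideal I" and F: "snd F \<in> S (fst F)" "fst F > 0"
    and h: "\<not> relevant (add_form F I)"
  shows "hilbert_le I 0"
proof -
  obtain T where T: "add_form F I T = S T" using h by (auto simp: relevant_def)
  have full: "add_form F I t = S t" if "t \<ge> T" for t
    using graded_ideal_full[OF graded_ideal_add_form[OF I F(1)] T that] .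
  define C where "C = (\<Sum>u < max T (fst F). dim (S u) - dim (I u))"
  have "dim (S t) - dim (I t) \<le> C" for t
  proof (induction t rule: less_induct)
    case (less t)
    show ?case
    proof (cases "t < max T (fst F)")
      case True
      then show ?thesis unfolding C_def
        by (intro member_le_sum[of t _ "\<lambda>u. dim (S u) - dim (I u)"]) auto
    next
      case False
      then have "dim (S t) - dim (I t) \<le> dim (S (t - fst F)) - dim (I (t - fst F))"
        using hilbert_step[OF I F(1), of t] full[of t] by simp
      also have "\<dots> \<le> C" using False F(2) by (intro less.IH) auto
      finally show ?thesis .
    qed
  qed
  then show ?thesis unfolding hilbert_le_def by auto
qed

lemma graded_ideal_foldr:
  assumes "graded_ideal I" "\<forall>F\<in>set Fs. snd F \<in> S (fst F)"
  shows "graded_ideal (foldr add_form Fs I)"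
  using assms by (induction Fs) (auto intro: graded_ideal_add_form)

lemma foldr_contains:
  assumes "graded_ideal I" "\<forall>F\<in>set Fs. snd F \<in> S (fst F)" "F \<in> set Fs"
  shows "snd F \<in> foldr add_form Fs I (fst F)"
  using assms(2,3)
proof (induction Fs)
  case (Cons G Fs)
  show ?case
  proof (cases "F = G")
    case True
    then show ?thesis
      using add_form_contains[OF graded_ideal_foldr[OF assms(1)], of Fs G] Cons.prems by simp
  next
    case False
    then show ?thesis using Cons add_form_superset[of "foldr add_form Fs I" "fst F" G] by auto
  qed
qed simp

text \<open>Each form accounts for one degree of growth. The list is split at its end because
  \<open>foldr\<close> adds the last form first.\<close>

lemma hilbert_le_foldr:
  assumes "graded_ideal I" "\<forall>F\<in>set Fs. snd F \<in> S (fst F) \<and> fst F > 0"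
    and "\<not> relevant (foldr add_form Fs I)" "length Fs = Suc n"
  shows "hilbert_le I n"
  using assms
proof (induction n arbitrary: Fs I)
  case 0
  then obtain F where "Fs = [F]" by (auto simp: length_Suc_conv)
  then show ?case using 0 hilbert_le_0[of I F] by simp
next
  case (Suc n)
  obtain Gs F where Fs: "Fs = Gs @ [F]" using Suc.prems(4) by (cases Fs rule: rev_cases) auto
  have "hilbert_le (add_form F I) n"
    using Suc.prems Fs by (intro Suc.IH[of _ Gs]) (auto intro: graded_ideal_add_form)
  then show ?case using Suc.prems Fs by (intro hilbert_le_Suc[of I F]) auto
qed

text \<open>Once multiplication by \<open>h\<close> is surjective between consecutive graded pieces of the quotient,
  their dimensions decrease, hence are eventually constant, and then it is injective as well.\<close>

lemma eventually_injective:
  assumes I: "graded_ideal I" "relevant I" and h: "h \<in> S 1" and r: "\<not> relevant (add_form (1, h) I)"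
  obtains T where "\<And>t g. t \<ge> T \<Longrightarrow> g \<in> S t \<Longrightarrow> h * g \<in> I (Suc t) \<Longrightarrow> g \<in> I t"
proof -
  have F: "snd (1::nat, h) \<in> S (fst (1::nat, h))" using h by simp
  let ?J = "add_form (1, h) I"
  obtain T0 where T: "?J T0 = S T0" using r by (auto simp: relevant_def)
  have full: "?J t = S t" if "t \<ge> T0" for t
    using graded_ideal_full[OF graded_ideal_add_form[OF I(1) F] T that] .
  define H where "H t = dim (S t) - dim (I t)" for t
  obtain T where T': "T0 \<le> T" "\<And>u. T0 \<le> u \<Longrightarrow> H T \<le> H u"
    using ex_has_least_nat[of "\<lambda>t. T0 \<le> t" T0 H] by blast
  have desc: "H (Suc t) + dim K \<le> dim (S t)"
    if "t \<ge> T0" "I t \<subseteq> K" "K \<subseteq> S t" "\<And>g. g \<in> K \<Longrightarrow> h * g \<in> I (Suc t)" for t K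
    using dim_add_form_le[OF I(1) F, of "Suc t" K] that full[of "Suc t"] dim_I_le[OF I(1), of "Suc t"]
    unfolding H_def by simp
  have dec: "H (Suc t) \<le> H t" if "t \<ge> T0" for t
    using desc[OF that subset_refl graded_idealD(2)[OF I(1)]] graded_ideal_mult_left[OF I(1) h]
    unfolding H_def by (simp del: space_power.simps)
  have const: "H t = H T" if "t \<ge> T" for t
    using that
  proof (induction rule: dec_induct)
    case (step n)
    then show ?case using T'(1) T'(2)[of "Suc n"] dec[of n] by simp
  qed simp
  show ?thesis
  proof (rule that)
    fix t g assume t: "t \<ge> T" and g: "g \<in> S t" "h * g \<in> I (Suc t)"
    show "g \<in> I t"
    proof (rule ccontr)
      assume gn: "g \<notin> I t"
      let ?K = "span (insert g (I t))"
      have K: "?K \<subseteq> S t"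
        using g(1) graded_idealD(2)[OF I(1)] by (intro span_minimal subspace_space_power) auto
      have "h * y \<in> I (Suc t)" if "y \<in> ?K" for y
        using that
      proof (induction rule: span_induct_alt)
        case base
        then show ?case using subspace_0[OF graded_idealD(1)[OF I(1)]] by simp
      next
        case (step c x y)
        have "h * x \<in> I (Suc t)"
          using step(1) g(2) graded_ideal_mult_left[OF I(1) h, of x t] by (auto simp del: space_power.simps)
        then show ?case using step(2) subspace_add subspace_scale graded_idealD(1)[OF I(1)]
          by (simp add: distrib_left scale_mult_right)
      qed
      then have "H (Suc t) + dim ?K \<le> dim (S t)"
        using t T'(1) K by (intro desc) (auto intro: span_base)
      moreover have "dim (I t) < dim ?K"
      proof (rule ccontr)
        assume "\<not> dim (I t) < dim ?K"
        then have "I t = ?K"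
          using fin_dim_subspace[OF fin_dim_S K subspace_span] graded_idealD(1)[OF I(1)]
          by (intro subspace_eq_if_dim_le) (auto intro: span_base)
        then show False using gn span_base[of g "insert g (I t)"] by simp
      qed
      moreover have "H (Suc t) = H t" using const[of t] const[of "Suc t"] t by simp
      ultimately show False unfolding H_def using dim_I_le[OF I(1), of t] by simp
    qed
  qed
qed

section \<open>Maximal relevant ideals are ideals of points\<close>

definition homog :: "'a \<Rightarrow> 'a \<Rightarrow> nat \<Rightarrow> 'k poly \<Rightarrow> 'a" where
  "homog h h' n p = (\<Sum>j\<le>n. coeff p j \<odot> (h' ^ j * h ^ (n - j)))"

lemma power_in_S: "h \<in> S 1 \<Longrightarrow> h ^ n \<in> S n"
proof (induction n)
  case (Suc n)
  then show ?case using space_power_mult[of h V 1 "h ^ n" n] by simp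
qed (use one_in_S in simp)

lemma homog_in_S: "h \<in> S 1 \<Longrightarrow> h' \<in> S 1 \<Longrightarrow> homog h h' n p \<in> S n"
  unfolding homog_def
proof (intro subspace_sum subspace_scale subspace_space_power)
  fix j assume "h \<in> S 1" "h' \<in> S 1" "j \<in> {..n}"
  then show "h' ^ j * h ^ (n - j) \<in> S n"
    using space_power_mult[OF power_in_S[of h' j] power_in_S[of h "n - j"]] by simp
qed

lemma homog_Suc_le:
  assumes "degree p \<le> n" shows "homog h h' (Suc n) p = h * homog h h' n p"
proof -
  have "homog h h' (Suc n) p = (\<Sum>j\<le>n. coeff p j \<odot> (h' ^ j * h ^ (Suc n - j)))"
    using assms by (simp add: homog_def coeff_eq_0)
  also have "\<dots> = h * homog h h' n p"
    unfolding homog_def sum_distrib_left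
    by (intro sum.cong) (auto simp: Suc_diff_le scale_mult_right mult_ac)
  finally show ?thesis .
qed

lemma homog_linear_factor:
  assumes "degree q \<le> n"
  shows "homog h h' (Suc n) ([:- c, 1:] * q) = (h' - c \<odot> h) * homog h h' n q"
proof -
  have "homog h h' (Suc n) ([:- c, 1:] * q) = homog h h' (Suc n) (pCons 0 q) - c \<odot> homog h h' (Suc n) q"
    unfolding homog_def scale_sum_right
    by (subst sum_subtractf[symmetric], rule sum.cong) (auto simp: scale_left_diff_distrib algebra_simps)
  also have "homog h h' (Suc n) (pCons 0 q) = h' * homog h h' n q"
    unfolding homog_def sum.atMost_Suc_shift sum_distrib_left
    by (simp add: scale_mult_right mult_ac)
  finally show ?thesis
    using homog_Suc_le[OF assms] by (simp add: algebra_simps scale_mult_left scale_mult_right)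
qed

text \<open>\<open>homog h h' n p\<close> is \<open>p\<close> homogenised in degree
  \<open>n\<close>: if the degree of \<open>p\<close> is below \<open>n\<close>, a factor
  \<open>h\<close> splits off, otherwise a factor h' - c h does, as the field is algebraically
  closed. Such factors are stripped from a product that kills the class of \<open>g\<close>.
  Multiplication by \<open>h\<close> is injective and a nonzero constant does not kill
  \<open>g\<close>, so some linear factor must kill a nonzero class.\<close>

lemma homog_eigenvalue:
  assumes I: "graded_ideal I" and h: "h \<in> S 1" "h' \<in> S 1"
    and inj: "\<And>t g. t \<ge> T \<Longrightarrow> g \<in> S t \<Longrightarrow> h * g \<in> I (Suc t) \<Longrightarrow> g \<in> I t"
    and t: "t \<ge> T" and g: "g \<in> S t" "g \<notin> I t"
    and p: "p \<noteq> 0" "degree p \<le> n" "homog h h' n p * g \<in> I (n + t)"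
  shows "\<exists>c u g'. u \<ge> T \<and> g' \<in> S u \<and> g' \<notin> I u \<and> (h' - c \<odot> h) * g' \<in> I (Suc u)"
  using p
proof (induction n arbitrary: p)
  case 0
  then obtain c where c: "p = [:c:]" "c \<noteq> 0" by (metis degree_eq_zeroE le_zero_eq pCons_0_0)
  then have "c \<odot> g \<in> I t" using 0 by (simp add: homog_def scale_mult_left)
  from subspace_scale[OF graded_idealD(1)[OF I] this, of "inverse c"] have "g \<in> I t" using c(2) by simp
  then show ?case using g(2) by simp
next
  case (Suc n)
  show ?case
  proof (cases "degree p \<le> n")
    case True
    have "homog h h' n p * g \<in> I (n + t)"
    proof (rule inj)
      show "h * (homog h h' n p * g) \<in> I (Suc (n + t))"
        using Suc.prems(3) by (simp add: homog_Suc_le[OF True] mult.assoc)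
    qed (use t space_power_mult[OF homog_in_S[OF h] g(1), of n p] in auto)
    then show ?thesis using Suc.IH[OF Suc.prems(1) True] by blast
  next
    case False
    then obtain c where "poly p c = 0" using alg_closed_imp_poly_has_root[of p] by auto
    then obtain q where q: "p = [:- c, 1:] * q" by (auto simp: poly_eq_0_iff_dvd elim!: dvdE)
    have q0: "q \<noteq> 0" using Suc.prems(1) q by auto
    have dq: "degree q \<le> n"
      using Suc.prems(2) q0 unfolding q by (subst (asm) degree_mult_eq) auto
    show ?thesis
    proof (cases "homog h h' n q * g \<in> I (n + t)")
      case True
      then show ?thesis using Suc.IH[OF q0 dq] by blast
    next
      case False
      have "(h' - c \<odot> h) * (homog h h' n q * g) \<in> I (Suc (n + t))"
        using Suc.prems(3) unfolding q homog_linear_factor[OF dq] by (simp only: mult.assoc add_Suc)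
      then show ?thesis
        using False t space_power_mult[OF homog_in_S[OF h] g(1), of n q]
        by (intro exI[of _ c] exI[of _ "n + t"]) auto
    qed
  qed
qed

text \<open>The pieces of the quotient have bounded dimension, so h' acts on them, relative to
  \<open>h\<close>, with an eigenvalue: some h' - c h kills a nonzero class of high degree. By
  maximality a linear form outside \<open>I 1\<close> would be injective in all high degrees. So
  \<open>h\<close> spans the degree 1 piece of the quotient.\<close>

lemma eigenvalue_exists:
  assumes I: "graded_ideal I" "relevant I"
    and max: "\<And>h. h \<in> S 1 \<Longrightarrow> h \<notin> I 1 \<Longrightarrow> \<not> relevant (add_form (1, h) I)"
    and h: "h \<in> S 1" "h \<notin> I 1" and h': "h' \<in> S 1"
  shows "\<exists>c. h' - c \<odot> h \<in> I 1"
proof -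
  obtain T where T: "\<And>t g. t \<ge> T \<Longrightarrow> g \<in> S t \<Longrightarrow> h * g \<in> I (Suc t) \<Longrightarrow> g \<in> I t"
    using eventually_injective[OF I h(1) max[OF h]] by blast
  obtain g where g: "g \<in> S T" "g \<notin> I T"
    using I(2) graded_idealD(2)[OF I(1), of T] unfolding relevant_def by blast
  have "hilbert_le I 0" using hilbert_le_0[OF I(1) _ _ max[OF h]] h(1) by simp
  then obtain n where n: "\<And>t. dim (S t) - dim (I t) \<le> n" by (auto simp: hilbert_le_def)
  \<comment> \<open>These are n + 1 elements of a quotient of dimension at most n; a dependence
    among them is a polynomial whose homogenisation kills \<open>g\<close>.\<close>
  let ?f = "\<lambda>j. h' ^ j * h ^ (n - j) * g"
  have "\<not> indep_mod (I (n + T)) {..n} ?f"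
  proof
    assume ind: "indep_mod (I (n + T)) {..n} ?f"
    have "?f j \<in> S (n + T)" if "j \<in> {..n}" for j
      using space_power_mult[OF space_power_mult[OF power_in_S[OF h', of j] power_in_S[OF h(1), of "n - j"]] g(1)]
        that by simp
    from indep_mod_card_le[OF fin_dim_S graded_idealD(1)[OF I(1)] graded_idealD(2)[OF I(1)] _ this ind]
    show False using n[of "n + T"] by simp
  qed
  then obtain c j where c: "(\<Sum>j\<le>n. c j \<odot> ?f j) \<in> I (n + T)" "j \<le> n" "c j \<noteq> 0"
    unfolding indep_mod_def by auto
  define p where "p = (\<Sum>j\<le>n. monom (c j) j)"
  have cp: "coeff p j = (if j \<le> n then c j else 0)" for j
    by (simp add: p_def coeff_sum)
  have "p \<noteq> 0" using c(2,3) cp[of j] by auto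
  moreover have "degree p \<le> n" using cp by (intro degree_le) auto
  moreover have "homog h h' n p * g \<in> I (n + T)"
    using c(1) by (simp add: homog_def cp sum_distrib_right scale_mult_left)
  ultimately obtain d u g' where u: "u \<ge> T" "g' \<in> S u" "g' \<notin> I u" "(h' - d \<odot> h) * g' \<in> I (Suc u)"
    using homog_eigenvalue[OF I(1) h(1) h' T order_refl g] by blast
  have hd: "h' - d \<odot> h \<in> S 1"
    using h h' by (intro subspace_diff subspace_scale subspace_space_power)
  have "h' - d \<odot> h \<in> I 1"
  proof (rule ccontr)
    assume "h' - d \<odot> h \<notin> I 1"
    then obtain T' where T': "\<And>t g. t \<ge> T' \<Longrightarrow> g \<in> S t \<Longrightarrow> (h' - d \<odot> h) * g \<in> I (Suc t) \<Longrightarrow> g \<in> I t"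
      using eventually_injective[OF I hd max[OF hd]] by blast
    \<comment> \<open>Injectivity of \<open>h\<close> carries the nonzero class of g' to degrees
      beyond T', where h' - d h is supposed to be injective.\<close>
    have "h ^ v * g' \<in> S (v + u) \<and> h ^ v * g' \<notin> I (v + u)" for v
    proof (induction v)
      case (Suc v)
      then have "h * (h ^ v * g') \<notin> I (Suc (v + u))" using T[of "v + u"] u(1) by auto
      moreover have "h ^ Suc v * g' \<in> S (Suc v + u)"
        using space_power_mult[OF power_in_S[OF h(1), of "Suc v"] u(2)] .
      ultimately show ?case by (simp add: mult.assoc)
    qed (use u in auto)
    note hv = this[of T']
    have "h ^ T' * ((h' - d \<odot> h) * g') \<in> I (T' + Suc u)"
      by (rule graded_ideal_mult_left[OF I(1) power_in_S[OF h(1)] u(4)])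
    then have "(h' - d \<odot> h) * (h ^ T' * g') \<in> I (Suc (T' + u))"
      by (simp add: mult_ac)
    then show False using T'[of "T' + u" "h ^ T' * g'"] hv by simp
  qed
  then show ?thesis by blast
qed

text \<open>Only maximality against adding linear forms is wanted, so maximising
  \<open>dim (J 1)\<close>, which is bounded by \<open>dim (S 1)\<close>, takes the place of Zorn's
  lemma.\<close>

lemma maximal_relevant:
  assumes "graded_ideal I" "relevant I"
  obtains J where "graded_ideal J" "relevant J" "\<And>t. I t \<subseteq> J t"
    "\<And>h. h \<in> S 1 \<Longrightarrow> h \<notin> J 1 \<Longrightarrow> \<not> relevant (add_form (1, h) J)"
proof -
  let ?P = "\<lambda>J. graded_ideal J \<and> relevant J \<and> (\<forall>t. I t \<subseteq> J t)"
  obtain J where J: "?P J" "\<And>J'. ?P J' \<Longrightarrow> dim (J' 1) \<le> dim (J 1)"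
  proof (rule exE[OF ex_has_greatest_nat[of ?P I "\<lambda>J. dim (J 1)" "Suc (dim (S 1))"]])
    show "?P I" using assms by blast
    show "\<forall>J. ?P J \<longrightarrow> dim (J 1) < Suc (dim (S 1))" using dim_I_le by (auto simp: less_Suc_eq_le simp del: space_power.simps)
  qed blast
  show ?thesis
  proof (rule that[of J])
    fix h assume h: "h \<in> S 1" "h \<notin> J 1"
    show "\<not> relevant (add_form (1, h) J)"
    proof
      assume r: "relevant (add_form (1, h) J)"
      have gr: "graded_ideal (add_form (1, h) J)" using graded_ideal_add_form[of J "(1, h)"] J(1) h(1) by simp
      have "?P (add_form (1, h) J)" using r gr J(1) add_form_superset by blast
      from J(2)[OF this] have "J 1 = add_form (1, h) J 1"
        using J(1) gr fin_dim_I graded_idealD(1)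
        by (intro subspace_eq_if_dim_le) (auto simp: add_form_superset)
      moreover have "h \<in> add_form (1, h) J 1" using add_form_contains[of J "(1, h)"] J(1) by simp
      ultimately show False using h(2) by simp
    qed
  qed (use J in auto)
qed

end

section \<open>Forms in several variables\<close>

interpretation fun_alg: k_algebra "\<lambda>(c::'k::field) (f::'b \<Rightarrow> 'k) u. c * f u"
  by unfold_locales (auto simp: fun_eq_iff algebra_simps)

text \<open>Homogeneous polynomials in \<open>L\<close> variables are represented by the functions they induce.\<close>

definition forms :: "nat \<Rightarrow> nat \<Rightarrow> ((nat \<Rightarrow> 'k::field) \<Rightarrow> 'k) set" where
  "forms L = fun_alg.space_power (fun_alg.span ((\<lambda>i u. u i) ` {..<L}))"

lemma forms_alg:
  "comm_algebra (\<lambda>(c::'k::alg_closed_field) (f::(nat \<Rightarrow> 'k) \<Rightarrow> 'k) u. c * f u)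
     (fun_alg.span ((\<lambda>i u. u i) ` {..<L}))"
  by (unfold_locales) (auto intro!: fun_alg.fin_dim_span)

lemma subspace_forms: "fun_alg.subspace (forms L s)"
  unfolding forms_def by (rule fun_alg.subspace_space_power)

lemma fin_dim_forms: "fun_alg.fin_dim (forms L s)"
  unfolding forms_def by (intro fun_alg.fin_dim_space_power fun_alg.fin_dim_span) simp

lemma forms_mult: "f \<in> forms L s \<Longrightarrow> g \<in> forms L t \<Longrightarrow> (\<lambda>u. f u * g u) \<in> forms L (s + t)"
  using fun_alg.space_power_mult[of f _ s g t] unfolding forms_def by (simp add: times_fun_def)

lemma forms_one: "(\<lambda>u. 1) \<in> forms L 0"
  unfolding forms_def by (simp add: one_fun_def fun_alg.span_base)

lemma forms_base: "b \<in> fun_alg.span ((\<lambda>i u. u i) ` {..<L}) \<Longrightarrow> b \<in> forms L 1"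
  unfolding forms_def One_nat_def by (rule fun_alg.space_power_base)

lemma forms_linear: "(\<lambda>u. \<Sum>i<L. c i * u i) \<in> forms L 1"
proof -
  have "(\<Sum>i<L. (\<lambda>u. c i * u i)) \<in> fun_alg.span ((\<lambda>i u. u i) ` {..<L})"
    by (intro fun_alg.span_sum fun_alg.span_scale fun_alg.span_base) auto
  moreover have "(\<Sum>i<n. (\<lambda>u. c i * u i)) = (\<lambda>u. \<Sum>i<n. c i * u i)" for n
    by (induction n) (auto simp: fun_eq_iff)
  ultimately show ?thesis by (intro forms_base) simp
qed

lemma forms_coord: "i < L \<Longrightarrow> (\<lambda>u. u i) \<in> forms L 1"
  by (intro forms_base fun_alg.span_base) auto

lemma forms_power: "f \<in> forms L s \<Longrightarrow> (\<lambda>u. f u ^ n) \<in> forms L (n * s)"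
  by (induction n) (auto simp: forms_one dest: forms_mult)

lemma forms_prod:
  "finite A \<Longrightarrow> (\<And>i. i \<in> A \<Longrightarrow> f i \<in> forms L (s i)) \<Longrightarrow> (\<lambda>u. \<Prod>i\<in>A. f i u) \<in> forms L (\<Sum>i\<in>A. s i)"
  by (induction A rule: finite_induct) (auto simp: forms_one forms_mult)

lemma forms_sum:
  "finite A \<Longrightarrow> (\<And>i. i \<in> A \<Longrightarrow> f i \<in> forms L s) \<Longrightarrow> (\<lambda>u. \<Sum>i\<in>A. c i * f i u) \<in> forms L s"
proof (induction A rule: finite_induct)
  case empty
  then show ?case using fun_alg.subspace_0[OF subspace_forms, of L s] by (simp add: zero_fun_def)
next
  case (insert x F)
  then have "(\<lambda>u. c x * f x u) + (\<lambda>u. \<Sum>i\<in>F. c i * f i u) \<in> forms L s"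
    by (intro fun_alg.subspace_add fun_alg.subspace_scale subspace_forms) auto
  then show ?case using insert by (simp add: plus_fun_def)
qed

text \<open>With the other variables fixed, the sum is a polynomial in the new variable that
  vanishes on an infinite field, so each of its coefficients vanishes. These coefficients are sums
  of the same kind in fewer variables.\<close>

lemma monomials_independent:
  fixes c :: "(nat \<Rightarrow> nat) \<Rightarrow> 'k::field_char_0"
  assumes "finite A" "\<And>u. (\<Sum>\<alpha>\<in>PiE A (\<lambda>_. {..D}). c \<alpha> * (\<Prod>i\<in>A. u i ^ \<alpha> i)) = 0"
  shows "\<forall>\<alpha>\<in>PiE A (\<lambda>_. {..D}). c \<alpha> = 0"
  using assms
proof (induction A arbitrary: c rule: finite_induct)
  case empty
  then show ?case by simp
next
  case (insert a A)
  let ?P = "PiE A (\<lambda>_. {..D})"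
  have "c (\<alpha>(a := k)) = 0" if k: "k \<le> D" and \<alpha>: "\<alpha> \<in> ?P" for k \<alpha>
  proof -
    have "(\<Sum>\<alpha>\<in>?P. c (\<alpha>(a := k)) * (\<Prod>i\<in>A. u i ^ \<alpha> i)) = 0" for u :: "nat \<Rightarrow> 'k"
    proof -
      define q where "q k = (\<Sum>\<alpha>\<in>?P. c (\<alpha>(a := k)) * (\<Prod>i\<in>A. u i ^ \<alpha> i))" for k
      define p where "p = (\<Sum>k\<le>D. monom (q k) k)"
      have "poly p x = 0" for x
      proof -
        let ?u = "u(a := x)"
        have inj: "inj_on (\<lambda>(k, \<alpha>). \<alpha>(a := k)) ({..D} \<times> ?P)"
          using inj_combinator[OF insert.hyps(2), of "\<lambda>_. {..D}"] by simp
        have "0 = (\<Sum>\<alpha>\<in>PiE (insert a A) (\<lambda>_. {..D}). c \<alpha> * (\<Prod>i\<in>insert a A. ?u i ^ \<alpha> i))"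
          using insert.prems by simp
        also have "PiE (insert a A) (\<lambda>_. {..D}) = (\<lambda>(k, \<alpha>). \<alpha>(a := k)) ` ({..D} \<times> ?P)"
          using PiE_insert_eq[of a A "\<lambda>_. {..D}"] by simp
        also have "(\<Sum>\<alpha>\<in>(\<lambda>(k, \<alpha>). \<alpha>(a := k)) ` ({..D} \<times> ?P). c \<alpha> * (\<Prod>i\<in>insert a A. ?u i ^ \<alpha> i)) =
            (\<Sum>(k, \<alpha>)\<in>{..D} \<times> ?P. c (\<alpha>(a := k)) * (\<Prod>i\<in>insert a A. ?u i ^ (\<alpha>(a := k)) i))"
          by (subst sum.reindex[OF inj]) (auto intro!: sum.cong)
        also have "\<dots> = (\<Sum>(k, \<alpha>)\<in>{..D} \<times> ?P. c (\<alpha>(a := k)) * (\<Prod>i\<in>A. u i ^ \<alpha> i) * x ^ k)"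
        proof (intro sum.cong refl, clarify)
          fix k \<alpha>
          have "(\<Prod>i\<in>A. ?u i ^ (\<alpha>(a := k)) i) = (\<Prod>i\<in>A. u i ^ \<alpha> i)"
            using insert.hyps(2) by (intro prod.cong) auto
          then show "c (\<alpha>(a := k)) * (\<Prod>i\<in>insert a A. ?u i ^ (\<alpha>(a := k)) i) =
              c (\<alpha>(a := k)) * (\<Prod>i\<in>A. u i ^ \<alpha> i) * x ^ k"
            using insert.hyps by (simp del: fun_upd_apply add: fun_upd_same)
        qed
        also have "\<dots> = (\<Sum>k\<le>D. q k * x ^ k)"
          by (simp add: sum.cartesian_product[symmetric] q_def sum_distrib_right)
        also have "\<dots> = poly p x" by (simp add: p_def poly_sum poly_monom)
        finally show ?thesis by simp
      qed
      then have "p = 0" using poly_all_0_iff_0 by blast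
      moreover have "coeff p k = q k" using k by (simp add: p_def coeff_sum)
      ultimately show ?thesis by (simp add: q_def)
    qed
    then show ?thesis using insert.IH[of "\<lambda>\<alpha>. c (\<alpha>(a := k))"] \<alpha> by blast
  qed
  then show ?case using PiE_insert_eq[of a A "\<lambda>_. {..D}"] by auto
qed

text \<open>Monomials in the variables 1 to \<open>N\<close> with each exponent at most
  \<open>D\<close> are padded to total degree \<open>N * D\<close> by a power of \<open>u 0\<close>;
  putting \<open>u 0\<close> to 1 reduces their independence to
  \<open>monomials_independent\<close>.\<close>

lemma dim_forms_ge:
  fixes N L D :: nat
  assumes "N < L"
  shows "(D + 1) ^ N \<le> fun_alg.dim (forms L (N * D) :: ((nat \<Rightarrow> 'k::field_char_0) \<Rightarrow> 'k) set)"
proof -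
  define A where "A = {1..N}"
  let ?P = "PiE A (\<lambda>_. {..D})"
  define f :: "(nat \<Rightarrow> nat) \<Rightarrow> (nat \<Rightarrow> 'k) \<Rightarrow> 'k"
    where "f \<alpha> u = u 0 ^ (N * D - (\<Sum>i\<in>A. \<alpha> i)) * (\<Prod>i\<in>A. u i ^ \<alpha> i)" for \<alpha> u
  have fin: "finite A" "finite ?P" by (auto simp: A_def intro!: finite_PiE)
  have mem: "f \<alpha> \<in> forms L (N * D)" if \<alpha>: "\<alpha> \<in> ?P" for \<alpha>
  proof -
    have "(\<Sum>i\<in>A. \<alpha> i) \<le> (\<Sum>i\<in>A. D)"
      using PiE_mem[OF \<alpha>] by (intro sum_mono) simp
    then have le: "(\<Sum>i\<in>A. \<alpha> i) \<le> N * D" by (simp add: A_def)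
    have "(\<lambda>u. u 0 ^ (N * D - (\<Sum>i\<in>A. \<alpha> i))) \<in> forms L ((N * D - (\<Sum>i\<in>A. \<alpha> i)) * 1)"
      using assms by (intro forms_power forms_coord) auto
    moreover have "(\<lambda>u. \<Prod>i\<in>A. u i ^ \<alpha> i) \<in> forms L (\<Sum>i\<in>A. \<alpha> i * 1)"
      using assms fin by (intro forms_prod forms_power forms_coord) (auto simp: A_def)
    ultimately have "f \<alpha> \<in> forms L ((N * D - (\<Sum>i\<in>A. \<alpha> i)) * 1 + (\<Sum>i\<in>A. \<alpha> i * 1))"
      unfolding f_def by (rule forms_mult)
    then show ?thesis using le by simp
  qed
  have "fun_alg.indep_mod {0} ?P f"
    unfolding fun_alg.indep_mod_def
  proof (intro allI impI)
    fix c assume "(\<Sum>\<alpha>\<in>?P. (\<lambda>u. c \<alpha> * f \<alpha> u)) \<in> {0}"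
    moreover have "(\<Sum>\<alpha>\<in>Q. (\<lambda>u. c \<alpha> * f \<alpha> u)) = (\<lambda>u. \<Sum>\<alpha>\<in>Q. c \<alpha> * f \<alpha> u)" if "finite Q" for Q
      using that by (induction Q rule: finite_induct) (auto simp: fun_eq_iff)
    ultimately have z: "(\<Sum>\<alpha>\<in>?P. c \<alpha> * f \<alpha> u) = 0" for u
      using fin(2) by (simp add: fun_eq_iff)
    show "\<forall>\<alpha>\<in>?P. c \<alpha> = 0"
    proof (rule monomials_independent[OF fin(1)])
      fix u :: "nat \<Rightarrow> 'k"
      have "(\<Prod>i\<in>A. (u(0 := 1)) i ^ \<alpha> i) = (\<Prod>i\<in>A. u i ^ \<alpha> i)" for \<alpha>
        by (intro prod.cong) (auto simp: A_def)
      then show "(\<Sum>\<alpha>\<in>?P. c \<alpha> * (\<Prod>i\<in>A. u i ^ \<alpha> i)) = 0"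
        using z[of "u(0 := 1)"] by (simp add: f_def)
    qed
  qed
  then have "card ?P \<le> fun_alg.dim (forms L (N * D) :: ((nat \<Rightarrow> 'k) \<Rightarrow> 'k) set)"
    by (intro fun_alg.indep_card_le[OF fin_dim_forms subspace_forms fin(2) mem])
  moreover have "card ?P = (D + 1) ^ N" using fin(1) by (simp add: card_PiE A_def)
  ultimately show ?thesis by simp
qed

text \<open>If the forms generated an irrelevant ideal, the Hilbert function of all forms would be
  of order t^(N - 1), against \<open>dim_forms_ge\<close>. So they lie in a maximal relevant ideal.
  Modulo that ideal every variable is a multiple of one linear form \<open>h\<close>, and the
  factors are the coordinates of the zero.\<close>

theorem forms_common_zero:
  fixes F :: "nat \<Rightarrow> (nat \<Rightarrow> 'k::{alg_closed_field, field_char_0}) \<Rightarrow> 'k"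
  assumes N: "0 < N" "N < L"
    and F: "\<And>j. j < N \<Longrightarrow> 0 < s j" "\<And>j. j < N \<Longrightarrow> F j \<in> forms L (s j)"
  shows "\<exists>u. (\<exists>i<L. u i \<noteq> 0) \<and> (\<forall>j<N. F j u = 0)"
proof -
  let ?V = "fun_alg.span ((\<lambda>i u. u i) ` {..<L}) :: ((nat \<Rightarrow> 'k) \<Rightarrow> 'k) set"
  interpret S: comm_algebra "\<lambda>(c::'k) (f::(nat \<Rightarrow> 'k) \<Rightarrow> 'k) u. c * f u" ?V
    by (rule forms_alg)
  have S_eq: "S.S = forms L" by (simp add: forms_def)
  note [simp del] = fun_alg.space_power.simps
  let ?Fs = "map (\<lambda>j. (s j, F j)) [0..<N]"
  have Fs: "\<forall>G\<in>set ?Fs. snd G \<in> S.S (fst G) \<and> fst G > 0" using F S_eq by auto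
  let ?I = "foldr S.add_form ?Fs (\<lambda>_. {0})"
  have grI: "S.graded_ideal ?I" using S.graded_ideal_foldr[OF S.graded_ideal_zero] Fs by blast
  have "S.relevant ?I"
  proof (rule ccontr)
    assume "\<not> S.relevant ?I"
    then have "S.hilbert_le (\<lambda>_. {0}) (N - 1)"
      using S.hilbert_le_foldr[OF S.graded_ideal_zero Fs] N by simp
    then obtain C where C: "\<And>t. fun_alg.dim (S.S t) \<le> C * (t + 1) ^ (N - 1)"
      using fun_alg.dim_le_card[of "{0 :: (nat \<Rightarrow> 'k) \<Rightarrow> 'k}" "{}"] by (auto simp: S.hilbert_le_def)
    \<comment> \<open>Makes \<open>C * (N * (D + 1)) ^ (N - 1)\<close> equal to
      \<open>D * (D + 1) ^ (N - 1)\<close>, just short of the \<open>(D + 1) ^ N\<close> independent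
      monomials.\<close>
    define D where "D = C * N ^ (N - 1)"
    have "(D + 1) ^ N \<le> C * (N * D + 1) ^ (N - 1)"
      using C[of "N * D"] dim_forms_ge[OF N(2), of D, where 'k='k] S_eq by simp
    also have "\<dots> \<le> C * (N * (D + 1)) ^ (N - 1)"
      using N by (intro mult_left_mono power_mono) (auto simp: algebra_simps)
    also have "\<dots> = D * (D + 1) ^ (N - 1)" by (simp only: D_def power_mult_distrib mult.assoc)
    also have "\<dots> < (D + 1) * (D + 1) ^ (N - 1)" by simp
    also have "\<dots> = (D + 1) ^ N" using N(1) by (metis Suc_diff_1 power_Suc)
    finally show False by simp
  qed
  then obtain J where J: "S.graded_ideal J" "S.relevant J" "\<And>t. ?I t \<subseteq> J t"
    "\<And>h. h \<in> S.S 1 \<Longrightarrow> h \<notin> J 1 \<Longrightarrow> \<not> S.relevant (S.add_form (1, h) J)"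
    using S.maximal_relevant[OF grI] by blast
  obtain h where h: "h \<in> S.S 1" "h \<notin> J 1"
    using J(2) S.graded_idealD(2)[OF J(1), of 1] unfolding S.relevant_def by blast
  note sJ = S.graded_idealD(1)[OF J(1)]
  have "\<exists>c. (\<lambda>u. u i) - (\<lambda>u. c * h u) \<in> J 1" if "i < L" for i
    using S.eigenvalue_exists[OF J(1,2,4) h] forms_coord[OF that] S_eq by metis
  then obtain a where a: "\<And>i. i < L \<Longrightarrow> (\<lambda>u. u i) - (\<lambda>u. a i * h u) \<in> J 1" by metis
  have lin: "b - (\<lambda>u. b a * h u) \<in> J 1" if "b \<in> ?V" for b
    using that
  proof (induction rule: fun_alg.span_induct_alt)
    case base
    then show ?case using fun_alg.subspace_0[OF sJ] by (simp add: zero_fun_def fun_diff_def)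
  next
    case (step c x y)
    then obtain i where i: "i < L" "x = (\<lambda>u. u i)" by auto
    have "(\<lambda>u. c * ((\<lambda>u. u i) - (\<lambda>u. a i * h u)) u) + (y - (\<lambda>u. y a * h u)) \<in> J 1"
      by (intro fun_alg.subspace_add[OF sJ] fun_alg.subspace_scale[OF sJ] step(2) a i(1))
    moreover have "(\<lambda>u. c * ((\<lambda>u. u i) - (\<lambda>u. a i * h u)) u) + (y - (\<lambda>u. y a * h u)) =
        ((\<lambda>u. c * x u) + y) - (\<lambda>u. ((\<lambda>u. c * x u) + y) a * h u)"
      by (simp add: i fun_eq_iff algebra_simps)
    ultimately show ?case by (simp only:)
  qed
  have hs: "h ^ t \<in> S.S t" for t using S.power_in_S[OF h(1)] .
  \<comment> \<open>Modulo \<open>J\<close>, reduction of a form of degree \<open>t\<close> is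
    evaluation at the point \<open>a\<close>, times h^t.\<close>
  have eval: "f - (\<lambda>u. f a * (h ^ t) u) \<in> J t" if "f \<in> S.S t" for f t
    using that
  proof (induction t arbitrary: f)
    case 0
    then obtain c where "f = (\<lambda>u. c * 1 u)"
      by (auto simp: fun_alg.space_power.simps fun_alg.span_singleton)
    then have "f - (\<lambda>u. f a * (h ^ 0) u) = 0" by (simp add: fun_eq_iff)
    then show ?case using fun_alg.subspace_0[OF sJ] by metis
  next
    case (Suc t)
    from Suc.prems have "f \<in> fun_alg.span {p * b |p b. p \<in> S.S t \<and> b \<in> ?V}"
      by (simp add: fun_alg.space_power.simps)
    then show ?case
    proof (induction rule: fun_alg.span_induct_alt)
      case base
      then show ?case using fun_alg.subspace_0[OF sJ] by (simp add: zero_fun_def fun_diff_def)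
    next
      case (step c x y)
      then obtain p b where pb: "p \<in> S.S t" "b \<in> ?V" "x = p * b" by auto
      have b1: "b \<in> S.S 1" using pb(2) S.V_eq by simp
      have 1: "(p - (\<lambda>u. p a * (h ^ t) u)) * b \<in> J (Suc t)"
        using S.graded_idealD(3)[OF J(1) Suc.IH[OF pb(1)] b1] by (simp only: Suc_eq_plus1)
      have 2: "h ^ t * (b - (\<lambda>u. b a * h u)) \<in> J (Suc t)"
        using S.graded_ideal_mult_left[OF J(1) hs lin[OF pb(2)], of t] by (simp only: Suc_eq_plus1)
      have "((\<lambda>u. c * ((p - (\<lambda>u. p a * (h ^ t) u)) * b) u) +
         (\<lambda>u. (c * p a) * (h ^ t * (b - (\<lambda>u. b a * h u))) u)) + (y - (\<lambda>u. y a * (h ^ Suc t) u)) \<in> J (Suc t)"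
        by (intro fun_alg.subspace_add[OF sJ] fun_alg.subspace_scale[OF sJ] step(2) 1 2)
      moreover have "((\<lambda>u. c * ((p - (\<lambda>u. p a * (h ^ t) u)) * b) u) +
         (\<lambda>u. (c * p a) * (h ^ t * (b - (\<lambda>u. b a * h u))) u)) + (y - (\<lambda>u. y a * (h ^ Suc t) u)) =
         ((\<lambda>u. c * x u) + y) - (\<lambda>u. ((\<lambda>u. c * x u) + y) a * (h ^ Suc t) u)"
        by (simp add: pb(3) fun_eq_iff algebra_simps)
      ultimately show ?case by (simp only:)
    qed
  qed
  have hn: "h ^ t \<notin> J t" for t
  proof
    assume ht: "h ^ t \<in> J t"
    have "f \<in> J t" if "f \<in> S.S t" for f
    proof -
      have "(f - (\<lambda>u. f a * (h ^ t) u)) + (\<lambda>u. f a * (h ^ t) u) \<in> J t"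
        by (intro fun_alg.subspace_add[OF sJ] fun_alg.subspace_scale[OF sJ] eval that ht)
      then show ?thesis by (simp only: diff_add_cancel)
    qed
    then show False using J(2) S.graded_idealD(2)[OF J(1), of t] unfolding S.relevant_def by blast
  qed
  have zero: "f a = 0" if "f \<in> J t" for f t
  proof (rule ccontr)
    assume fa: "f a \<noteq> 0"
    have "f - (f - (\<lambda>u. f a * (h ^ t) u)) \<in> J t"
      using S.graded_idealD(2)[OF J(1)] that by (intro fun_alg.subspace_diff[OF sJ] eval) auto
    then have "(\<lambda>u. inverse (f a) * (f - (f - (\<lambda>u. f a * (h ^ t) u))) u) \<in> J t"
      by (rule fun_alg.subspace_scale[OF sJ])
    moreover have "(\<lambda>u. inverse (f a) * (f - (f - (\<lambda>u. f a * (h ^ t) u))) u) = h ^ t"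
      using fa by (simp add: fun_eq_iff)
    ultimately show False using hn[of t] by simp
  qed
  \<comment> \<open>If all coordinates were 0, then \<open>h a\<close> would be 0, and
    \<open>eval\<close> in degree 1 would put \<open>h\<close> itself into
    \<open>J 1\<close>.\<close>
  have "\<exists>i<L. a i \<noteq> 0"
  proof (rule ccontr)
    assume "\<not> ?thesis"
    then have z: "a i = 0" if "i < L" for i using that by blast
    have "b a = 0" if "b \<in> ?V" for b
      using that
      by (induction rule: fun_alg.span_induct_alt) (auto simp: z)
    then have "h a = 0" using h(1) S.V_eq by simp
    then have "h - (\<lambda>u. h a * (h ^ 1) u) = h" by (simp add: fun_eq_iff)
    then show False using eval[OF h(1)] h(2) by (simp only: not_False_eq_True)
  qed
  moreover have "F j a = 0" if "j < N" for j
  proof -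
    have "F j \<in> ?I (s j)"
      using S.foldr_contains[OF S.graded_ideal_zero, of ?Fs "(s j, F j)"] Fs that by simp
    then show ?thesis using J(3) zero by blast
  qed
  ultimately show ?thesis by blast
qed

section \<open>Rank over a polynomial subalgebra\<close>

context k_algebra
begin

definition peval :: "'a \<Rightarrow> 'k poly \<Rightarrow> 'a" where
  "peval t p = (\<Sum>i\<le>degree p. coeff p i \<odot> t ^ i)"

lemma peval_altdef: "degree p \<le> n \<Longrightarrow> peval t p = (\<Sum>i\<le>n. coeff p i \<odot> t ^ i)"
  unfolding peval_def by (rule sum.mono_neutral_left) (auto simp: not_le coeff_eq_0)

lemma peval_0 [simp]: "peval t 0 = 0"
  by (simp add: peval_def)

lemma peval_pCons: "peval t (pCons c p) = c \<odot> 1 + t * peval t p"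
proof -
  have "peval t (pCons c p) = (\<Sum>i\<le>Suc (degree p). coeff (pCons c p) i \<odot> t ^ i)"
    by (rule peval_altdef) (simp add: degree_pCons_le)
  also have "\<dots> = c \<odot> 1 + t * peval t p"
    by (simp add: sum.atMost_Suc_shift peval_def sum_distrib_left scale_mult_right del: sum.atMost_Suc)
  finally show ?thesis .
qed

lemma peval_1 [simp]: "peval t 1 = 1"
  by (simp add: one_pCons peval_pCons)

lemma peval_add: "peval t (p + q) = peval t p + peval t q"
proof -
  define n where "n = max (degree p) (degree q)"
  have "degree (p + q) \<le> n" "degree p \<le> n" "degree q \<le> n"
    by (auto simp: n_def degree_add_le)
  then show ?thesis
    by (simp add: peval_altdef[of _ n] scale_left_distrib sum.distrib)
qed

lemma peval_smult: "peval t (Polynomial.smult c p) = c \<odot> peval t p"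
  by (simp add: peval_altdef[of _ "degree p"] degree_smult_le scale_sum_right)

lemma peval_minus: "peval t (- p) = - peval t p"
  using peval_smult[of t "- 1" p] by simp

lemma peval_diff: "peval t (p - q) = peval t p - peval t q"
  using peval_add[of t p "- q"] by (simp add: peval_minus)

lemma peval_sum: "peval t (\<Sum>i\<in>A. f i) = (\<Sum>i\<in>A. peval t (f i))"
  by (induction A rule: infinite_finite_induct) (auto simp: peval_add)

lemma peval_monom: "peval t (monom c n) = c \<odot> t ^ n"
  by (induction n) (auto simp: monom_0 monom_Suc peval_pCons scale_mult_right)

lemma peval_mult: "peval t (p * q) = peval t p * peval t q"
  by (induction p)
     (auto simp: peval_pCons peval_add peval_smult distrib_right scale_mult_left mult.assoc)

lemma peval_commute: "peval t p * peval t q = peval t q * peval t p"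
  by (metis peval_mult mult.commute)

lemma peval_power: "peval t (p ^ n) = peval t p ^ n"
  by (induction n) (auto simp: peval_mult)

text \<open>The coefficients from k[t] stand on the left, so that right multiplication by elements
  of the algebra is linear over k[t].\<close>

definition poly_free :: "'a \<Rightarrow> nat \<Rightarrow> (nat \<Rightarrow> 'a) \<Rightarrow> bool" where
  "poly_free t r e \<longleftrightarrow> (\<forall>p. (\<Sum>i<r. peval t (p i) * e i) = 0 \<longrightarrow> (\<forall>i<r. p i = 0))"

lemma poly_freeD:
  "poly_free t r e \<Longrightarrow> (\<Sum>i<r. peval t (p i) * e i) = 0 \<Longrightarrow> i < r \<Longrightarrow> p i = 0"
  unfolding poly_free_def by blast

definition poly_span :: "'a \<Rightarrow> nat \<Rightarrow> (nat \<Rightarrow> 'a) \<Rightarrow> nat \<Rightarrow> 'a set" where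
  "poly_span t r e d = {\<Sum>i<r. peval t (p i) * e i | p. \<forall>i<r. degree (p i) \<le> d}"

lemma poly_spanI:
  "(\<And>i. i < r \<Longrightarrow> degree (p i) \<le> d) \<Longrightarrow> (\<Sum>i<r. peval t (p i) * e i) \<in> poly_span t r e d"
  unfolding poly_span_def by blast

lemma poly_spanE:
  assumes "x \<in> poly_span t r e d"
  obtains p where "x = (\<Sum>i<r. peval t (p i) * e i)" "\<And>i. i < r \<Longrightarrow> degree (p i) \<le> d"
  using assms unfolding poly_span_def by blast

lemma subspace_poly_span: "subspace (poly_span t r e d)"
  unfolding subspace_def
proof (intro conjI ballI allI)
  show "0 \<in> poly_span t r e d" using poly_spanI[of r "\<lambda>_. 0" d t e] by simp
next
  fix x y assume x: "x \<in> poly_span t r e d" and y: "y \<in> poly_span t r e d"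
  obtain p where p: "x = (\<Sum>i<r. peval t (p i) * e i)" "\<And>i. i < r \<Longrightarrow> degree (p i) \<le> d"
    using x by (rule poly_spanE) blast
  obtain q where q: "y = (\<Sum>i<r. peval t (q i) * e i)" "\<And>i. i < r \<Longrightarrow> degree (q i) \<le> d"
    using y by (rule poly_spanE) blast
  show "x + y \<in> poly_span t r e d"
    using poly_spanI[of r "\<lambda>i. p i + q i" d t e] p q
    by (simp add: degree_add_le peval_add distrib_right sum.distrib)
next
  fix c x assume x: "x \<in> poly_span t r e d"
  obtain p where p: "x = (\<Sum>i<r. peval t (p i) * e i)" "\<And>i. i < r \<Longrightarrow> degree (p i) \<le> d"
    using x by (rule poly_spanE) blast
  show "c \<odot> x \<in> poly_span t r e d"
    using poly_spanI[of r "\<lambda>i. Polynomial.smult c (p i)" d t e] p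
    by (simp add: degree_smult_le[THEN order_trans] peval_smult scale_mult_left scale_sum_right)
qed

lemma poly_span_mono: "d \<le> d' \<Longrightarrow> poly_span t r e d \<subseteq> poly_span t r e d'"
  unfolding poly_span_def by (auto intro: le_trans)

lemma poly_span_mult:
  assumes "x \<in> poly_span t r e d" shows "peval t q * x \<in> poly_span t r e (degree q + d)"
proof -
  obtain p where p: "x = (\<Sum>i<r. peval t (p i) * e i)" "\<And>i. i < r \<Longrightarrow> degree (p i) \<le> d"
    using assms by (rule poly_spanE) blast
  show ?thesis
    using poly_spanI[of r "\<lambda>i. q * p i" "degree q + d" t e] p
    by (simp add: degree_mult_le[THEN order_trans] peval_mult sum_distrib_left mult.assoc)
qed

lemma poly_span_base: "i < r \<Longrightarrow> e i \<in> poly_span t r e d"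
proof -
  assume i: "i < r"
  have "(\<Sum>j<r. peval t (if j = i then 1 else 0) * e j) = e i"
    using i by (subst sum.remove[of _ i]) (auto intro!: sum.neutral)
  then show ?thesis using poly_spanI[of r "\<lambda>j. if j = i then 1 else 0" d t e] by simp
qed

lemma poly_span_right_mult:
  assumes "x \<in> poly_span t r e d" "\<And>i. i < r \<Longrightarrow> peval t q * (e i * v) \<in> poly_span t r e d'"
  shows "peval t q * (x * v) \<in> poly_span t r e (d + d')"
proof -
  obtain p where p: "x = (\<Sum>i<r. peval t (p i) * e i)" "\<And>i. i < r \<Longrightarrow> degree (p i) \<le> d"
    using assms(1) by (rule poly_spanE) blast
  have "peval t (p i) * (peval t q * (e i * v)) \<in> poly_span t r e (d + d')" if "i < r" for i
    using poly_span_mult[OF assms(2)[OF that], of "p i"] poly_span_mono[of _ "d + d'"] p(2)[OF that]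
    by (meson add_le_mono1 subsetD)
  then have "(\<Sum>i<r. peval t (p i) * (peval t q * (e i * v))) \<in> poly_span t r e (d + d')"
    by (intro subspace_sum subspace_poly_span) auto
  also have "(\<Sum>i<r. peval t (p i) * (peval t q * (e i * v))) = peval t q * (x * v)"
    unfolding p(1) sum_distrib_left sum_distrib_right
    by (intro sum.cong refl) (metis mult.assoc peval_commute)
  finally show ?thesis .
qed

lemma poly_span_subset_span:
  "poly_span t r e d \<subseteq> span ((\<lambda>(i, j). t ^ j * e i) ` ({..<r} \<times> {..d}))" (is "_ \<subseteq> ?S")
proof
  fix x assume "x \<in> poly_span t r e d"
  then obtain p where p: "x = (\<Sum>i<r. peval t (p i) * e i)" "\<And>i. i < r \<Longrightarrow> degree (p i) \<le> d"
    by (rule poly_spanE) blast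
  have "x = (\<Sum>i<r. \<Sum>j\<le>d. coeff (p i) j \<odot> (t ^ j * e i))"
    unfolding p(1) using p(2)
    by (intro sum.cong) (auto simp: peval_altdef[of _ d] sum_distrib_right scale_mult_left)
  also have "\<dots> \<in> ?S"
    by (intro span_sum span_scale span_base) force
  finally show "x \<in> ?S" .
qed

lemma fin_dim_poly_span: "fin_dim (poly_span t r e d)"
  by (rule fin_dim_subspace[OF fin_dim_span poly_span_subset_span subspace_poly_span]) simp

lemma dim_poly_span_le: "dim (poly_span t r e d) \<le> r * (d + 1)"
proof -
  have "dim (poly_span t r e d) \<le> card ((\<lambda>(i, j). t ^ j * e i) ` ({..<r} \<times> {..d}))"
    by (intro dim_le_card poly_span_subset_span) simp
  also have "\<dots> \<le> card ({..<r} \<times> {..d})" by (rule card_image_le) simp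
  finally show ?thesis by simp
qed

lemma power_in_space_power: "t \<in> V \<Longrightarrow> t ^ n \<in> space_power V n"
proof (induction n)
  case (Suc n)
  then show ?case using space_power_mult[OF space_power_base[OF Suc.prems] Suc.IH[OF Suc.prems]] by simp
qed (simp add: span_base)

text \<open>The products t^j e_i with j at most m are independent and have length at most n + m. For
  r = n + 1 and m = n this turns freeness into quadratic growth.\<close>

lemma poly_free_dim_le:
  assumes V: "fin_dim V" "t \<in> V" "1 \<in> V"
    and e: "poly_free t r e" "\<And>i. i < r \<Longrightarrow> e i \<in> space_power V n"
  shows "r * (m + 1) \<le> dim (space_power V (n + m))"
proof -
  let ?f = "\<lambda>(i, j). t ^ j * e i"
  have "indep_mod {0} ({..<r} \<times> {..m}) ?f"
    unfolding indep_mod_def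
  proof (intro allI impI)
    fix c :: "nat \<times> nat \<Rightarrow> 'k"
    assume "(\<Sum>x\<in>{..<r} \<times> {..m}. c x \<odot> ?f x) \<in> {0}"
    then have "0 = (\<Sum>x\<in>{..<r} \<times> {..m}. c x \<odot> ?f x)" by simp
    also have "\<dots> = (\<Sum>i<r. \<Sum>j\<le>m. c (i, j) \<odot> (t ^ j * e i))"
      by (simp add: sum.cartesian_product split_def)
    also have "\<dots> = (\<Sum>i<r. peval t (\<Sum>j\<le>m. monom (c (i, j)) j) * e i)"
      by (simp add: peval_sum peval_monom sum_distrib_right scale_mult_left)
    finally have s: "(\<Sum>i<r. peval t (\<Sum>j\<le>m. monom (c (i, j)) j) * e i) = 0" by simp
    have z: "(\<Sum>j\<le>m. monom (c (i, j)) j) = 0" if "i < r" for i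
      using poly_freeD[OF e(1) s that] .
    show "\<forall>x\<in>{..<r} \<times> {..m}. c x = 0"
    proof clarify
      fix i j assume "i < r" "j \<le> m"
      moreover have "coeff (\<Sum>j\<le>m. monom (c (i, j)) j) j = c (i, j)"
        using \<open>j \<le> m\<close> by (simp add: coeff_sum)
      ultimately show "c (i, j) = 0" using z by simp
    qed
  qed
  moreover have "?f x \<in> space_power V (n + m)" if xm: "x \<in> {..<r} \<times> {..m}" for x
  proof -
    obtain i j where x: "x = (i, j)" "i < r" "j \<le> m" using xm by auto
    have "t ^ j * e i \<in> space_power V (j + n)"
      by (rule space_power_mult[OF power_in_space_power[OF V(2)] e(2)[OF x(2)]])
    then show ?thesis using space_power_mono[OF V(3), of "j + n" "n + m"] x by auto
  qed
  ultimately have "card ({..<r} \<times> {..m}) \<le> dim (space_power V (n + m))"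
    using fin_dim_space_power[OF V(1)] subspace_space_power
    by (intro indep_card_le[of _ _ ?f]) auto
  then show ?thesis by simp
qed

definition scalars :: "'a set" where "scalars = range (\<lambda>c. c \<odot> 1)"

text \<open>For 1 in \<open>T\<close> this is the subalgebra generated by \<open>T\<close>. As a
  union of powers it provides each element with a word length, on which the later estimates
  depend.\<close>

definition generated :: "'a set \<Rightarrow> 'a set" where
  "generated T = (\<Union>n. space_power (span T) n)"

lemma generatedI: "x \<in> space_power (span T) n \<Longrightarrow> x \<in> generated T"
  unfolding generated_def by blast

lemma space_power_common:
  assumes "1 \<in> T" "x \<in> generated T" "y \<in> generated T"
  obtains n where "x \<in> space_power (span T) n" "y \<in> space_power (span T) n"
proof -
  obtain i j where "x \<in> space_power (span T) i" "y \<in> space_power (span T) j"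
    using assms(2,3) unfolding generated_def by blast
  moreover have "1 \<in> span T" using assms(1) by (rule span_base)
  ultimately show ?thesis using that[of "max i j"] space_power_mono
    by (meson max.cobounded1 max.cobounded2 subsetD)
qed

lemma subalgebra_generated:
  assumes "1 \<in> T" shows "subalgebra (generated T)"
  unfolding subalgebra_def
proof (intro conjI ballI)
  show "subspace (generated T)"
    unfolding subspace_def
  proof (intro conjI ballI allI)
    show "0 \<in> generated T" by (rule generatedI, rule subspace_0[OF subspace_space_power])
  next
    fix x y assume "x \<in> generated T" "y \<in> generated T"
    then obtain n where "x \<in> space_power (span T) n" "y \<in> space_power (span T) n"
      using space_power_common[OF assms] by blast
    then show "x + y \<in> generated T" by (intro generatedI subspace_add subspace_space_power)
  next
    fix c x assume "x \<in> generated T"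
    then show "c \<odot> x \<in> generated T"
      using subspace_scale[OF subspace_space_power] unfolding generated_def by blast
  qed
  show "1 \<in> generated T" by (rule generatedI[of _ _ 0]) (simp add: span_base)
  fix x y assume "x \<in> generated T" "y \<in> generated T"
  then show "x * y \<in> generated T"
    using space_power_mult unfolding generated_def by blast
qed

lemma generated_base: "x \<in> T \<Longrightarrow> x \<in> generated T"
  by (rule generatedI, rule space_power_base, rule span_base)

lemma generated_minimal:
  assumes "T \<subseteq> B" "subalgebra B" shows "generated T \<subseteq> B"
proof -
  have B: "subspace B" "1 \<in> B" "\<And>a b. a \<in> B \<Longrightarrow> b \<in> B \<Longrightarrow> a * b \<in> B"
    using assms(2) by (auto simp: subalgebra_def)
  have T: "span T \<subseteq> B" by (rule span_minimal[OF assms(1) B(1)])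
  have "space_power (span T) n \<subseteq> B" for n
  proof (induction n)
    case 0
    then show ?case using span_minimal[of "{1}" B] B by simp
  next
    case (Suc n)
    then show ?case using T B(3) unfolding space_power.simps(2) by (intro span_minimal B(1)) auto
  qed
  then show ?thesis unfolding generated_def by blast
qed

lemma power_in_subalgebra: "subalgebra B \<Longrightarrow> x \<in> B \<Longrightarrow> x ^ n \<in> B"
  by (induction n) (auto simp: subalgebra_def)

lemma peval_in_subalgebra: "subalgebra B \<Longrightarrow> t \<in> B \<Longrightarrow> peval t p \<in> B"
  unfolding peval_def using power_in_subalgebra
  by (intro subspace_sum subspace_scale) (auto simp: subalgebra_def)

end

locale domain_algebra = k_algebra scale
  for scale :: "'k::{alg_closed_field, field_char_0} \<Rightarrow> 'a::ring_1_no_zero_divisors \<Rightarrow> 'a"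
    (infixr \<open>\<odot>\<close> 75)
begin

text \<open>Over an algebraically closed field a polynomial splits into linear factors, and in a
  domain one of the t - c would have to vanish. Thus every nonscalar element is
  transcendental.\<close>

lemma peval_eq_0_iff:
  assumes "t \<notin> scalars" shows "peval t p = 0 \<longleftrightarrow> p = 0"
proof
  assume "peval t p = 0"
  then show "p = 0"
  proof (induction "degree p" arbitrary: p rule: less_induct)
    case less
    show ?case
    proof (cases "degree p = 0")
      case True
      then obtain c where "p = [:c:]" by (auto elim: degree_eq_zeroE)
      then show ?thesis using less.prems by (simp add: peval_pCons)
    next
      case False
      then obtain c where "poly p c = 0" using alg_closed_imp_poly_has_root[of p] by auto
      then obtain q where q: "p = [:- c, 1:] * q" by (auto simp: poly_eq_0_iff_dvd elim!: dvdE)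
      have q0: "q \<noteq> 0" using False q by auto
      have "(t - c \<odot> 1) * peval t q = 0"
        using less.prems unfolding q peval_mult by (simp add: peval_pCons)
      moreover have "t - c \<odot> 1 \<noteq> 0" using assms by (auto simp: scalars_def)
      ultimately have "peval t q = 0" by simp
      moreover have "degree q < degree p" unfolding q using q0 by (subst degree_mult_eq) auto
      ultimately show ?thesis using less.hyps q0 by blast
    qed
  qed
qed simp

text \<open>Left multiplication by a nonzero element of a domain is injective. In this way
  denominators are cleared without loss of dimension.\<close>

lemma dim_le_of_mult:
  assumes W: "fin_dim W" "fin_dim U" "subspace U" and g: "g \<noteq> 0" "\<And>x. x \<in> W \<Longrightarrow> g * x \<in> U"
  shows "dim W \<le> dim U"
proof -
  obtain C where C: "C \<subseteq> W" "independent C" "W \<subseteq> span C" "card C = dim W"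
    by (rule basis_exists)
  have fin: "finite C" using indep_card_le_dim(1)[OF W(1) C(1,2)] .
  have "indep_mod {0} C (\<lambda>x. g * x)"
    unfolding indep_mod_def
  proof (intro allI impI ballI)
    fix c x assume "(\<Sum>x\<in>C. c x \<odot> (g * x)) \<in> {0}" and x: "x \<in> C"
    then have "g * (\<Sum>x\<in>C. c x \<odot> x) = 0" by (simp add: sum_distrib_left scale_mult_right)
    then have "(\<Sum>x\<in>C. c x \<odot> x) = 0" using g(1) by simp
    then show "c x = 0" using independentD[OF C(2) fin subset_refl _ x] by blast
  qed
  then show ?thesis using indep_card_le[OF W(2,3) fin, of "\<lambda>x. g * x"] g(2) C(1,4) by auto
qed

section \<open>Finite rank over k[t]\<close>

definition poly_dep :: "'a \<Rightarrow> nat \<Rightarrow> (nat \<Rightarrow> 'a) \<Rightarrow> 'a \<Rightarrow> bool" where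
  "poly_dep t r e x \<longleftrightarrow> (\<exists>q d. q \<noteq> 0 \<and> peval t q * x \<in> poly_span t r e d)"

lemma poly_free_insert:
  assumes "poly_free t r e" "\<not> poly_dep t r e x"
  shows "poly_free t (Suc r) (e(r := x))"
  unfolding poly_free_def
proof (intro allI impI)
  fix p i assume "(\<Sum>i<Suc r. peval t (p i) * (e(r := x)) i) = 0" and i: "i < Suc r"
  then have s: "peval t (p r) * x = - (\<Sum>i<r. peval t (p i) * e i)"
    by (simp add: eq_neg_iff_add_eq_0 add.commute)
  have "(\<Sum>i<r. peval t (p i) * e i) \<in> poly_span t r e (Max (insert 0 ((degree \<circ> p) ` {..<r})))"
    by (intro poly_spanI) auto
  then have "peval t (p r) * x \<in> poly_span t r e (Max (insert 0 ((degree \<circ> p) ` {..<r})))"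
    unfolding s by (rule subspace_neg[OF subspace_poly_span])
  then have pr: "p r = 0" using assms(2) unfolding poly_dep_def by blast
  then have "\<forall>i<r. p i = 0" using s assms(1) unfolding poly_free_def by simp
  then show "p i = 0" using pr i by (auto simp: less_Suc_eq)
qed

lemma poly_dep_common:
  assumes "finite A" "\<And>a. a \<in> A \<Longrightarrow> poly_dep t r e (f a)"
  shows "\<exists>q d. q \<noteq> 0 \<and> (\<forall>a\<in>A. peval t q * f a \<in> poly_span t r e d)"
  using assms
proof (induction A rule: finite_induct)
  case empty
  then show ?case by (auto intro: exI[of _ 1])
next
  case (insert a A)
  then obtain q d where q: "q \<noteq> 0" "\<forall>a\<in>A. peval t q * f a \<in> poly_span t r e d" by auto
  obtain q' d' where q': "q' \<noteq> 0" "peval t q' * f a \<in> poly_span t r e d'"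
    using insert.prems[of a] unfolding poly_dep_def by auto
  define D where "D = degree q + degree q' + d + d'"
  have "peval t (q * q') * f b \<in> poly_span t r e D" if b: "b \<in> insert a A" for b
  proof (cases "b = a")
    case True
    have "peval t q * (peval t q' * f a) \<in> poly_span t r e D"
      using poly_span_mult[OF q'(2), of q] poly_span_mono[of "degree q + d'" D t r e] by (auto simp: D_def)
    then show ?thesis using True by (simp add: peval_mult mult.assoc)
  next
    case False
    then have "peval t q * f b \<in> poly_span t r e d" using q(2) b by blast
    then have "peval t q' * (peval t q * f b) \<in> poly_span t r e D"
      using poly_span_mult[of _ t r e d q'] poly_span_mono[of "degree q' + d" D t r e] by (auto simp: D_def)
    moreover have "peval t q' * (peval t q * f b) = peval t (q * q') * f b"
      by (metis peval_mult mult.assoc mult.commute)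
    ultimately show ?thesis by simp
  qed
  moreover have "q * q' \<noteq> 0" using q(1) q'(1) by simp
  ultimately show ?case by blast
qed

text \<open>Starting from 1, adjoin some product e_i v independent over k[t] as long as there is
  one. Stage \<open>j\<close> stays within words of length \<open>j\<close>, so stage
  \<open>n\<close> would give (n + 1)^2 independent elements of length 2 n. When the process stops,
  the span over k(t) is stable under right multiplication by \<open>T\<close>.\<close>

lemma poly_basis_exists:
  assumes T: "finite T" "1 \<in> T" "t \<in> T" and t: "t \<notin> scalars"
    and n: "dim (space_power (span T) (2 * n)) < (n + 1) ^ 2"
  obtains r e where "0 < r" "e 0 = 1" "poly_free t r e" "\<forall>i<r. e i \<in> generated T"
    "\<forall>i<r. \<forall>v\<in>T. poly_dep t r e (e i * v)"
proof (rule ccontr)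
  assume no: "\<not> thesis"
  let ?V = "span T"
  have V: "fin_dim ?V" "t \<in> ?V" "1 \<in> ?V" using T by (auto intro: fin_dim_span span_base)
  have "\<exists>e. e 0 = 1 \<and> poly_free t (Suc j) e \<and> (\<forall>i<Suc j. e i \<in> space_power ?V j)" for j
  proof (induction j)
    case 0
    have "poly_free t (Suc 0) (\<lambda>_. 1)"
      using peval_eq_0_iff[OF t] by (simp add: poly_free_def)
    then show ?case by (intro exI[of _ "\<lambda>_. 1"]) (simp add: span_base)
  next
    case (Suc j)
    then obtain e where e: "e 0 = 1" "poly_free t (Suc j) e" "\<forall>i<Suc j. e i \<in> space_power ?V j"
      by blast
    have "\<exists>i<Suc j. \<exists>v\<in>T. \<not> poly_dep t (Suc j) e (e i * v)"
      using that[of "Suc j" e] no e generatedI by blast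
    then obtain i v where iv: "i < Suc j" "v \<in> T" "\<not> poly_dep t (Suc j) e (e i * v)" by blast
    let ?e = "e(Suc j := e i * v)"
    have "poly_free t (Suc (Suc j)) ?e" by (rule poly_free_insert[OF e(2) iv(3)])
    moreover have "?e l \<in> space_power ?V (Suc j)" if "l < Suc (Suc j)" for l
    proof (cases "l = Suc j")
      case True
      then show ?thesis using e(3) iv(1,2) by (auto intro!: span_base intro: span_base)
    next
      case False
      then show ?thesis using e(3) that space_power_mono[OF V(3), of j "Suc j"] by auto
    qed
    moreover have "?e 0 = 1" using e(1) by simp
    ultimately show ?case by blast
  qed
  then obtain e where e: "poly_free t (Suc n) e" "\<forall>i<Suc n. e i \<in> space_power ?V n" by blast
  have "Suc n * (n + 1) \<le> dim (space_power ?V (n + n))"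
    using poly_free_dim_le[OF V e(1), of n n] e(2) by blast
  then show False using n by (simp add: power2_eq_square mult_2)
qed

text \<open>Right multiplication by the generators is given, in the basis \<open>e\<close>, by matrices over the field of
  rational functions in \<open>t\<close> with common denominator \<open>q\<close>.\<close>

lemma poly_basis:
  assumes T: "finite T" "1 \<in> T" "t \<in> T" and t: "t \<notin> scalars"
    and n: "dim (space_power (span T) (2 * n)) < (n + 1) ^ 2"
  obtains r e q C where "0 < r" "e 0 = 1" "poly_free t r e" "\<forall>i<r. e i \<in> generated T"
    "q \<noteq> 0" "\<forall>n. \<forall>x\<in>space_power (span T) n. peval t (q ^ n) * x \<in> poly_span t r e (C * n)"
proof -
  obtain r e where e: "0 < r" "e 0 = 1" "poly_free t r e" "\<forall>i<r. e i \<in> generated T"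
    "\<forall>i<r. \<forall>v\<in>T. poly_dep t r e (e i * v)"
    using poly_basis_exists[OF assms] .
  have "\<exists>q C. q \<noteq> 0 \<and> (\<forall>a\<in>{..<r} \<times> T. peval t q * (case a of (i, v) \<Rightarrow> e i * v) \<in> poly_span t r e C)"
    using T(1) e(5) by (intro poly_dep_common) auto
  then obtain q C where qC: "q \<noteq> 0"
    "\<forall>a\<in>{..<r} \<times> T. peval t q * (case a of (i, v) \<Rightarrow> e i * v) \<in> poly_span t r e C" by blast
  have q: "q \<noteq> 0" "\<And>i v. i < r \<Longrightarrow> v \<in> T \<Longrightarrow> peval t q * (e i * v) \<in> poly_span t r e C"
    using qC by auto
  have main: "peval t (q ^ n) * x \<in> poly_span t r e (C * n)" if "x \<in> space_power (span T) n" for n x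
    using that
  proof (induction n arbitrary: x)
    case 0
    then obtain c where "x = c \<odot> e 0" using e(2) by (auto simp: span_singleton)
    then show ?case using subspace_scale[OF subspace_poly_span poly_span_base[OF e(1)]] by simp
  next
    case (Suc n)
    let ?E = "poly_span t r e (C * Suc n)"
    have *: "peval t (q ^ Suc n) * (a * v) \<in> ?E" if a: "a \<in> space_power (span T) n" and v: "v \<in> T" for a v
    proof -
      have "peval t q * ((peval t (q ^ n) * a) * v) \<in> poly_span t r e (C * n + C)"
        by (rule poly_span_right_mult[OF Suc.IH[OF a] q(2)[OF _ v]])
      then show ?thesis by (simp add: peval_mult mult.assoc add.commute)
    qed
    have **: "peval t (q ^ Suc n) * (a * b) \<in> ?E" if a: "a \<in> space_power (span T) n" and b: "b \<in> span T" for a b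
      using b
    proof (induction rule: span_induct_alt)
      case base
      then show ?case using subspace_0[OF subspace_poly_span] by simp
    next
      case (step c v y)
      then show ?case using *[OF a, of v] subspace_add[OF subspace_poly_span] subspace_scale[OF subspace_poly_span]
        by (simp only: distrib_left scale_mult_right)
    qed
    have "x \<in> span {a * b |a b. a \<in> space_power (span T) n \<and> b \<in> span T}" using Suc.prems by simp
    then show ?case
    proof (induction rule: span_induct_alt)
      case base
      then show ?case using subspace_0[OF subspace_poly_span] by simp
    next
      case (step c v y)
      then show ?case using ** subspace_add[OF subspace_poly_span] subspace_scale[OF subspace_poly_span]
        by (auto simp only: distrib_left scale_mult_right)
    qed
  qed
  show ?thesis using that e(1-4) q(1) main by blast
qed

text \<open>Multiplication by q^n embeds the words of length n into combinations of \<open>r\<close>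
  elements with coefficients of degree at most \<open>C * n\<close>, a space of dimension linear in
  n.\<close>

lemma linear_growth:
  assumes T: "finite T" "1 \<in> T" "t \<in> T" and t: "t \<notin> scalars"
    and n: "dim (space_power (span T) (2 * n)) < (n + 1) ^ 2"
  shows "\<exists>C. \<forall>n. dim (space_power (span T) n) \<le> C * (n + 1)"
proof -
  obtain r e q C where e: "0 < r" "e 0 = 1" "poly_free t r e" "\<forall>i<r. e i \<in> generated T" and q: "q \<noteq> 0"
    "\<forall>n. \<forall>x\<in>space_power (span T) n. peval t (q ^ n) * x \<in> poly_span t r e (C * n)"
    using poly_basis[OF assms] .
  have "dim (space_power (span T) n) \<le> r * (C + 1) * (n + 1)" for n
  proof -
    have "dim (space_power (span T) n) \<le> dim (poly_span t r e (C * n))"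
      using q peval_eq_0_iff[OF t, of "q ^ n"] T(1)
      by (intro dim_le_of_mult[where g = "peval t (q ^ n)"] subspace_poly_span fin_dim_poly_span
          fin_dim_space_power fin_dim_span) auto
    also have "\<dots> \<le> r * (C * n + 1)" by (rule dim_poly_span_le)
    also have "\<dots> \<le> r * ((C + 1) * (n + 1))" by (intro mult_left_mono) (auto simp: algebra_simps)
    finally show ?thesis by (simp only: mult.assoc)
  qed
  then show ?thesis by blast
qed

text \<open>Elements of the generated algebra have only powers of \<open>q\<close> as denominators,
  so an inverse of t - c forces \<open>c\<close> to be a root of \<open>q\<close>. This will provide
  proper right ideals generated by t - c.\<close>

lemma no_inverse:
  assumes T: "finite T" "1 \<in> T" "t \<in> T" and t: "t \<notin> scalars"
    and n: "dim (space_power (span T) (2 * n)) < (n + 1) ^ 2"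
  obtains q :: "'k poly" where "q \<noteq> 0"
    "\<And>c u. poly q c \<noteq> 0 \<Longrightarrow> u \<in> generated T \<Longrightarrow> (t - c \<odot> 1) * u \<noteq> 1"
proof -
  obtain r e q C where e: "0 < r" "e 0 = 1" "poly_free t r e" "\<forall>i<r. e i \<in> generated T" and q: "q \<noteq> 0"
    "\<forall>n. \<forall>x\<in>space_power (span T) n. peval t (q ^ n) * x \<in> poly_span t r e (C * n)"
    using poly_basis[OF assms] .
  show ?thesis
  proof (rule that[OF q(1)], rule notI)
    fix c u assume c: "poly q c \<noteq> 0" and u: "u \<in> generated T" "(t - c \<odot> 1) * u = 1"
    obtain n where n: "u \<in> space_power (span T) n" using u(1) unfolding generated_def by blast
    obtain p where p: "peval t (q ^ n) * u = (\<Sum>i<r. peval t (p i) * e i)"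
      using poly_spanE[OF q(2)[rule_format, OF n]] by blast
    let ?l = "[:- c, 1:]"
    have l: "peval t ?l = t - c \<odot> 1" by (simp add: peval_pCons)
    \<comment> \<open>The coefficients of q^n ((t - c) u - 1), which is zero; the one at
      \<open>e 0\<close> = 1 says that q^n is divisible by the linear polynomial with root
      \<open>c\<close>.\<close>
    define p' where "p' i = ?l * p i - (if i = 0 then q ^ n else 0)" for i
    have "(\<Sum>i<r. peval t (p' i) * e i) = peval t ?l * (\<Sum>i<r. peval t (p i) * e i)
        - (\<Sum>i<r. peval t (if i = 0 then q ^ n else 0) * e i)"
      by (simp add: p'_def peval_diff peval_mult sum_distrib_left sum_subtractf left_diff_distrib mult.assoc
          del: mult_pCons_left)
    also have "(\<Sum>i<r. peval t (if i = 0 then q ^ n else 0) * e i) = peval t (q ^ n)"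
      using e(1,2) by (subst sum.remove[of _ 0]) (auto intro!: sum.neutral)
    also have "peval t ?l * (\<Sum>i<r. peval t (p i) * e i) = peval t (q ^ n) * (peval t ?l * u)"
      unfolding p[symmetric] mult.assoc[symmetric] peval_commute[of t "q ^ n" ?l] ..
    finally have "(\<Sum>i<r. peval t (p' i) * e i) = 0" using u(2) l by simp
    then have "p' 0 = 0" by (rule poly_freeD[OF e(3) _ e(1)])
    then have "q ^ n = ?l * p 0" by (simp add: p'_def)
    then have "poly (q ^ n) c = poly (?l * p 0) c" by (rule arg_cong)
    then show False using c by simp
  qed
qed

lemma poly_relation:
  assumes t: "t \<notin> scalars" and n: "dim (space_power (span {1, t, y}) (2 * n)) < (n + 1) ^ 2"
  shows "\<exists>n p. (\<Sum>i\<le>n. peval t (p i) * y ^ i) = 0 \<and> (\<exists>i\<le>n. p i \<noteq> 0)"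
proof (rule ccontr)
  assume no: "\<not> ?thesis"
  have "poly_free t (Suc n) (\<lambda>i. y ^ i)"
    using no unfolding poly_free_def lessThan_Suc_atMost less_Suc_eq_le by blast
  then have "Suc n * (n + 1) \<le> dim (space_power (span {1, t, y}) (n + n))"
  proof (rule poly_free_dim_le[rotated 3])
    fix i assume "i < Suc n"
    then show "y ^ i \<in> space_power (span {1, t, y}) n"
      using power_in_space_power[of y "span {1, t, y}" i] space_power_mono[of "span {1, t, y}" i n]
      by (auto intro: span_base)
  qed (auto intro: fin_dim_span span_base)
  then show False using n by (simp add: power2_eq_square mult_2)
qed

end

section \<open>Commutativity of domains of subquadratic growth\<close>

text \<open>In the Leibniz expansion every summand is a product of \<open>s\<close> linear forms.
  The index order \<open>A l k i\<close> puts the source vector \<open>k\<close> before the target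
  \<open>i\<close>, so that column \<open>k\<close> holds the image of the vector
  \<open>k\<close>.\<close>

lemma det_linear_form:
  "(\<lambda>u. det (mat s s (\<lambda>(i, k). \<Sum>l<L. A l k i * u l))) \<in> forms L s"
proof -
  have "(\<lambda>u. \<Prod>i\<in>{0..<s}. \<Sum>l<L. A l (\<pi> i) i * u l) \<in> forms L (\<Sum>i\<in>{0..<s}. 1)" for \<pi> :: "nat \<Rightarrow> nat"
    by (intro forms_prod forms_linear) auto
  then have "(\<lambda>u. \<Sum>\<pi>\<in>{\<pi>. \<pi> permutes {0..<s}}. signof \<pi> * (\<Prod>i\<in>{0..<s}. \<Sum>l<L. A l (\<pi> i) i * u l)) \<in> forms L s"
    by (intro forms_sum) (auto simp: finite_permutations)
  also have "(\<lambda>u. \<Sum>\<pi>\<in>{\<pi>. \<pi> permutes {0..<s}}. signof \<pi> * (\<Prod>i\<in>{0..<s}. \<Sum>l<L. A l (\<pi> i) i * u l)) =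
      (\<lambda>u. det (mat s s (\<lambda>(i, k). \<Sum>l<L. A l k i * u l)))"
  proof
    fix u
    have "\<pi> i < s" if "\<pi> permutes {0..<s}" "i < s" for \<pi> i
      using permutes_in_image[OF that(1), of i] that(2) by simp
    then show "(\<Sum>\<pi>\<in>{\<pi>. \<pi> permutes {0..<s}}. signof \<pi> * (\<Prod>i\<in>{0..<s}. \<Sum>l<L. A l (\<pi> i) i * u l)) =
        det (mat s s (\<lambda>(i, k). \<Sum>l<L. A l k i * u l))"
      by (subst det_def'[of _ s]) (auto intro!: sum.cong prod.cong)
  qed
  finally show ?thesis .
qed

text \<open>These are the assumptions of a counterexample, and the locale ends with a proof of
  \<open>False\<close>. The bound is required for every finite subset containing 1, and not only for
  \<open>T\<close>, because \<open>point_exists\<close> enlarges the generating set by an element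
  \<open>t\<close>.\<close>

locale noncommutative_subquadratic = domain_algebra scale
  for scale :: "'k::{alg_closed_field, field_char_0} \<Rightarrow> 'a::ring_1_no_zero_divisors \<Rightarrow> 'a"
    (infixr \<open>\<odot>\<close> 75) +
  fixes T :: "'a set" and p q :: 'a
  assumes T: "finite T" "1 \<in> T" "p \<in> T" "q \<in> T" and pq: "p * q \<noteq> q * p"
    and subquadratic: "\<And>X. finite X \<Longrightarrow> 1 \<in> X \<Longrightarrow> X \<subseteq> generated T \<Longrightarrow>
      \<exists>n. dim (space_power (span X) (2 * n)) < (n + 1) ^ 2"
begin

abbreviation B where "B \<equiv> generated T"
abbreviation P where "P \<equiv> space_power (span T)"

lemma B: "subspace B" "1 \<in> B" "a \<in> B \<Longrightarrow> b \<in> B \<Longrightarrow> a * b \<in> B" "p \<in> B" "q \<in> B"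
  using subalgebra_generated[OF T(2)] generated_base T by (auto simp: subalgebra_def)

lemma P_subset_B: "P n \<subseteq> B"
  using generatedI by blast

lemma fin_dim_P: "fin_dim (P n)"
  by (intro fin_dim_space_power fin_dim_span T)

lemma P_mono: "m \<le> n \<Longrightarrow> P m \<subseteq> P n"
  using T(2) by (intro space_power_mono) (auto intro: span_base)

lemma scalars_central: "x \<in> scalars \<Longrightarrow> x * y = y * x"
  by (auto simp: scalars_def scale_mult_left scale_mult_right)

lemma p_notin_scalars: "p \<notin> scalars"
  using pq scalars_central by blast

lemma linear_bound: obtains C where "\<forall>n. dim (P n) \<le> C * (n + 1)"
proof -
  obtain n where "dim (P (2 * n)) < (n + 1) ^ 2"
    using subquadratic[OF T(1,2)] generated_base by blast
  from linear_growth[OF T(1,2,3) p_notin_scalars this] show ?thesis using that by blast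
qed

section \<open>Right ideals and their finite dimensional quotients\<close>

definition right_ideal :: "'a set \<Rightarrow> bool" where
  "right_ideal J \<longleftrightarrow> subspace J \<and> J \<subseteq> B \<and> (\<forall>x\<in>J. \<forall>b\<in>B. x * b \<in> J)"

lemma right_idealD:
  assumes "right_ideal J"
  shows "subspace J" "J \<subseteq> B" "x \<in> J \<Longrightarrow> b \<in> B \<Longrightarrow> x * b \<in> J"
  using assms unfolding right_ideal_def by blast+

text \<open>The translate of \<open>P n\<close> by \<open>a\<close> has the dimension of
  \<open>P n\<close> and lies both in \<open>K\<close> and in \<open>P (n + m)\<close>. Elements
  independent modulo \<open>K\<close> add to it as soon as \<open>n\<close> is large enough for them
  to occur.\<close>

lemma dim_P_step:
  assumes K: "subspace K" and a: "a \<noteq> 0" "a \<in> P m" "\<And>b. b \<in> B \<Longrightarrow> a * b \<in> K"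
    and f: "finite I" "\<And>i. i \<in> I \<Longrightarrow> f i \<in> B" "indep_mod K I f"
  obtains n0 where "\<And>n. n \<ge> n0 \<Longrightarrow> card I + dim (P n) \<le> dim (P (n + m))"
proof -
  have "\<forall>i\<in>I. \<exists>n. f i \<in> P n" using f(2) by (auto simp: generated_def)
  then obtain h where h: "\<And>i. i \<in> I \<Longrightarrow> f i \<in> P (h i)" by metis
  define n0 where "n0 = Max (insert 0 (h ` I))"
  have fP: "f i \<in> P n0" if "i \<in> I" for i
  proof -
    have "h i \<le> n0" unfolding n0_def using f(1) that by (intro Max_ge) auto
    then show ?thesis using h[OF that] P_mono by blast
  qed
  show ?thesis
  proof (rule that[of n0])
    fix n assume n: "n \<ge> n0"
    define J where "J = (\<lambda>x. a * x) ` P n"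
    have J: "subspace J" unfolding subspace_def
    proof (intro conjI ballI allI)
      show "0 \<in> J" unfolding J_def by (rule image_eqI[of _ _ 0]) (auto intro: subspace_0[OF subspace_space_power])
    next
      fix x y assume "x \<in> J" "y \<in> J"
      then show "x + y \<in> J" unfolding J_def
        by (auto intro!: image_eqI[of _ _ "_ + _"] subspace_add[OF subspace_space_power] simp: distrib_left[symmetric])
    next
      fix c x assume "x \<in> J"
      then show "c \<odot> x \<in> J" unfolding J_def
        by (auto intro!: image_eqI[of _ _ "c \<odot> _"] subspace_scale[OF subspace_space_power] simp: scale_mult_right)
    qed
    have JP: "J \<subseteq> P (n + m)" unfolding J_def using space_power_mult[OF a(2)] by (auto simp: add.commute[of n m])
    have JK: "J \<subseteq> K" unfolding J_def using a(3) P_subset_B by blast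
    have fin: "fin_dim J" by (rule fin_dim_subspace[OF fin_dim_P JP J])
    have "dim (P n) \<le> dim J"
      by (rule dim_le_of_mult[OF fin_dim_P fin J a(1)]) (auto simp: J_def)
    moreover have "card I + dim J \<le> dim (P (n + m))"
    proof (rule indep_mod_card_le[OF fin_dim_P J JP f(1)])
      show "f i \<in> P (n + m)" if "i \<in> I" for i
        using fP[OF that] P_mono[of n0 "n + m"] n by auto
      show "indep_mod J I f" by (rule indep_mod_mono[OF f(3) JK])
    qed
    ultimately show "card I + dim (P n) \<le> dim (P (n + m))" by simp
  qed
qed

text \<open>By \<open>dim_P_step\<close>, \<open>k\<close> independent elements modulo
  \<open>K\<close> raise the growth function by \<open>k\<close> every \<open>m\<close> steps,
  whereas linear growth leaves room for at most \<open>C * m\<close>.\<close>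

lemma finite_codim:
  assumes K: "right_ideal K" "K \<noteq> {0}"
  obtains D where "\<And>k f. (\<And>i. i < k \<Longrightarrow> f i \<in> B) \<Longrightarrow> indep_mod K {..<k::nat} f \<Longrightarrow> k \<le> D"
proof -
  obtain a where a: "a \<in> K" "a \<noteq> 0" using K subspace_0[OF right_idealD(1)[OF K(1)]] by blast
  obtain m where m: "a \<in> P m" using a(1) right_idealD(2)[OF K(1)] by (auto simp: generated_def)
  obtain C where C: "\<forall>n. dim (P n) \<le> C * (n + 1)" by (rule linear_bound)
  show ?thesis
  proof (rule that[of "C * m"])
    fix k f assume f: "\<And>i. i < k \<Longrightarrow> f i \<in> B" "indep_mod K {..<k::nat} f"
    obtain n0 where n0: "\<And>n. n \<ge> n0 \<Longrightarrow> card {..<k} + dim (P n) \<le> dim (P (n + m))"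
      using dim_P_step[OF right_idealD(1)[OF K(1)] a(2) m right_idealD(3)[OF K(1) a(1)] _ _ f(2)] f(1)
      by auto
    have it: "k * j \<le> dim (P (n0 + j * m))" for j
    proof (induction j)
      case (Suc j)
      then show ?case using n0[of "n0 + j * m"] by (simp add: algebra_simps)
    qed simp
    show "k \<le> C * m"
    proof (rule ccontr)
      assume "\<not> k \<le> C * m"
      \<comment> \<open>Large enough to outweigh \<open>C * (n0 + 1)\<close>, the part of the bound
        that does not grow with \<open>j\<close>.\<close>
      define j where "j = C * (n0 + 1) + 1"
      have "k * j \<le> C * (n0 + j * m + 1)" using it[of j] C[rule_format, of "n0 + j * m"] by simp
      also have "\<dots> = C * (n0 + 1) + C * m * j" by (simp add: algebra_simps)
      also have "\<dots> < j + C * m * j" by (simp add: j_def)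
      also have "\<dots> = (C * m + 1) * j" by simp
      also have "\<dots> \<le> k * j" using \<open>\<not> k \<le> C * m\<close> by (intro mult_right_mono) auto
      finally show False by simp
    qed
  qed
qed

lemma indep_mod_Suc:
  assumes J: "subspace J" "subspace K" "J \<subseteq> K" and f: "indep_mod J {..<k} f"
    and fK: "\<And>i. i < k \<Longrightarrow> f i \<in> K" and x: "x \<notin> K"
  shows "indep_mod J {..<Suc k} (f(k := x))"
  unfolding indep_mod_def
proof (intro allI impI ballI)
  fix c i assume c: "(\<Sum>i<Suc k. c i \<odot> (f(k := x)) i) \<in> J" and i: "i \<in> {..<Suc k}"
  have eq: "(\<Sum>i<Suc k. c i \<odot> (f(k := x)) i) = (\<Sum>i<k. c i \<odot> f i) + c k \<odot> x" by simp
  have ck: "c k = 0"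
  proof (rule ccontr)
    assume "c k \<noteq> 0"
    have "(\<Sum>i<k. c i \<odot> f i) \<in> K" using fK by (intro subspace_sum subspace_scale J) auto
    then have "c k \<odot> x \<in> K"
      using subspace_diff[OF J(2), of "(\<Sum>i<k. c i \<odot> f i) + c k \<odot> x" "\<Sum>i<k. c i \<odot> f i"] c J(3)
      unfolding eq by auto
    from subspace_scale[OF J(2) this, of "inverse (c k)"] show False using x \<open>c k \<noteq> 0\<close> by simp
  qed
  then have "(\<Sum>i<k. c i \<odot> f i) \<in> J" using c eq by simp
  then show "c i = 0" using indep_modD[OF f] ck i by (cases "i = k") auto
qed

definition basis_mod :: "'a set \<Rightarrow> nat \<Rightarrow> (nat \<Rightarrow> 'a) \<Rightarrow> bool" where
  "basis_mod J s y \<longleftrightarrow> (\<forall>i<s. y i \<in> B) \<and> indep_mod J {..<s} y \<and>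
     (\<forall>b\<in>B. \<exists>c. b - (\<Sum>i<s. c i \<odot> y i) \<in> J)"

lemma basis_mod_exists:
  assumes J: "right_ideal J" "J \<noteq> {0}"
  obtains s y where "basis_mod J s y"
proof -
  note sJ = right_idealD(1)[OF J(1)]
  obtain D where D: "\<And>k f. (\<And>i. i < k \<Longrightarrow> f i \<in> B) \<Longrightarrow> indep_mod J {..<k::nat} f \<Longrightarrow> k \<le> D"
    using finite_codim[OF J] by blast
  let ?Q = "\<lambda>k::nat. \<exists>f. (\<forall>i<k. f i \<in> B) \<and> indep_mod J {..<k} f"
  have "?Q 0" by (auto simp: indep_mod_def)
  moreover have "\<forall>k. ?Q k \<longrightarrow> k \<le> D" using D by blast
  ultimately have "\<exists>k. ?Q k \<and> (\<forall>k'. ?Q k' \<longrightarrow> k' \<le> k)" by (rule Nat.ex_has_greatest_nat)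
  then obtain k where k: "?Q k" "\<And>k'. ?Q k' \<Longrightarrow> k' \<le> k" by blast
  then obtain f where f: "\<forall>i<k. f i \<in> B" "indep_mod J {..<k} f" by blast
  have "\<exists>c. b - (\<Sum>i<k. c i \<odot> f i) \<in> J" if b: "b \<in> B" for b
  proof -
    have "\<not> indep_mod J {..<Suc k} (f(k := b))"
    proof
      assume ind: "indep_mod J {..<Suc k} (f(k := b))"
      have "\<forall>i<Suc k. (f(k := b)) i \<in> B" using f(1) b by (auto simp: less_Suc_eq)
      then have "?Q (Suc k)" using ind by blast
      from k(2)[OF this] show False by simp
    qed
    then obtain c i where c: "(\<Sum>i<Suc k. c i \<odot> (f(k := b)) i) \<in> J" "i < Suc k" "c i \<noteq> 0"
      unfolding indep_mod_def by auto
    then have c1: "(\<Sum>i<k. c i \<odot> f i) + c k \<odot> b \<in> J" by simp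
    have ck: "c k \<noteq> 0"
    proof
      assume 0: "c k = 0"
      then have "i < k" using c(2,3) by (cases "i = k") auto
      moreover have "(\<Sum>i<k. c i \<odot> f i) \<in> J" using c1 0 by simp
      ultimately show False using indep_modD[OF f(2)] c(3) by auto
    qed
    have "b - (\<Sum>i<k. (- c i / c k) \<odot> f i) = inverse (c k) \<odot> ((\<Sum>i<k. c i \<odot> f i) + c k \<odot> b)"
      using ck by (simp add: scale_right_distrib scale_sum_right sum_negf divide_inverse mult.commute)
    also have "\<dots> \<in> J" by (rule subspace_scale[OF sJ c1])
    finally show ?thesis by (rule exI[of _ "\<lambda>i. - c i / c k"])
  qed
  then show ?thesis using f by (intro that[of k f]) (auto simp: basis_mod_def)
qed

text \<open>The last clause says that every nonzero class generates B modulo \<open>M\<close>, a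
  simple right module. As \<open>M\<close> is nonzero, \<open>finite_codim\<close> makes this module
  finite dimensional.\<close>

definition maximal_ideal :: "'a set \<Rightarrow> bool" where
  "maximal_ideal M \<longleftrightarrow> right_ideal M \<and> M \<noteq> {0} \<and> 1 \<notin> M \<and>
     (\<forall>b\<in>B. b \<notin> M \<longrightarrow> (\<exists>c\<in>B. 1 - b * c \<in> M))"

text \<open>Finite codimension replaces Zorn's lemma: among the proper right ideals above
  \<open>J\<close>, take one containing the largest number of elements independent modulo
  \<open>J\<close>. For \<open>b\<close> outside it, adding the right ideal of \<open>b\<close>
  would make room for one more.\<close>

lemma maximal_ideal_exists:
  assumes J: "right_ideal J" "J \<noteq> {0}" "1 \<notin> J"
  obtains M where "maximal_ideal M" "J \<subseteq> M"
proof -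
  obtain D where D: "\<And>k f. (\<And>i. i < k \<Longrightarrow> f i \<in> B) \<Longrightarrow> indep_mod J {..<k::nat} f \<Longrightarrow> k \<le> D"
    using finite_codim[OF J(1,2)] by blast
  let ?R = "\<lambda>(k::nat) M f. right_ideal M \<and> J \<subseteq> M \<and> 1 \<notin> M \<and> (\<forall>i<k. f i \<in> M) \<and> indep_mod J {..<k} f"
  let ?Q = "\<lambda>k. \<exists>M f. ?R k M f"
  have "?Q 0" using J by (intro exI[of _ J] exI[of _ "\<lambda>_. 0"]) (simp add: indep_mod_def)
  moreover have "\<forall>k. ?Q k \<longrightarrow> k \<le> D" using D right_idealD(2) by blast
  ultimately have "\<exists>k. ?Q k \<and> (\<forall>k'. ?Q k' \<longrightarrow> k' \<le> k)" by (rule Nat.ex_has_greatest_nat)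
  then obtain k M f where k: "\<And>k'. ?Q k' \<Longrightarrow> k' \<le> k" and R: "?R k M f" by blast
  have M: "right_ideal M" "J \<subseteq> M" "1 \<notin> M" and f: "\<forall>i<k. f i \<in> M" "indep_mod J {..<k} f"
    using R by auto
  note sM = right_idealD(1)[OF M(1)]
  have "\<exists>c\<in>B. 1 - b * c \<in> M" if b: "b \<in> B" "b \<notin> M" for b
  proof (rule ccontr)
    assume no: "\<not> ?thesis"
    define M' where "M' = {x + b * c | x c. x \<in> M \<and> c \<in> B}"
    have MM': "M \<subseteq> M'"
    proof
      fix x assume "x \<in> M"
      then show "x \<in> M'" unfolding M'_def using subspace_0[OF B(1)]
        by (intro CollectI exI[of _ x] exI[of _ 0]) auto
    qed
    have bM': "b \<in> M'" unfolding M'_def using subspace_0[OF sM] B(2)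
      by (intro CollectI exI[of _ 0] exI[of _ 1]) auto
    have "subspace M'" unfolding subspace_def
    proof (intro conjI ballI allI)
      show "0 \<in> M'" using MM' subspace_0[OF sM] by blast
    next
      fix x y assume "x \<in> M'" "y \<in> M'"
      then obtain u c v d where "u \<in> M" "v \<in> M" "c \<in> B" "d \<in> B" "x = u + b * c" "y = v + b * d"
        unfolding M'_def by blast
      then show "x + y \<in> M'" unfolding M'_def
        by (intro CollectI exI[of _ "u + v"] exI[of _ "c + d"])
           (auto simp: algebra_simps intro: subspace_add[OF sM] subspace_add[OF B(1)])
    next
      fix l x assume "x \<in> M'"
      then obtain u c where "u \<in> M" "c \<in> B" "x = u + b * c" unfolding M'_def by blast
      then show "l \<odot> x \<in> M'" unfolding M'_def
        by (intro CollectI exI[of _ "l \<odot> u"] exI[of _ "l \<odot> c"])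
           (auto simp: scale_right_distrib scale_mult_right intro: subspace_scale[OF sM] subspace_scale[OF B(1)])
    qed
    moreover have "M' \<subseteq> B"
      unfolding M'_def using right_idealD(2)[OF M(1)] B(3)[OF b(1)] by (auto intro!: subspace_add[OF B(1)])
    moreover have "x * d \<in> M'" if x: "x \<in> M'" and d: "d \<in> B" for x d
    proof -
      obtain u c where "u \<in> M" "c \<in> B" "x = u + b * c" using x unfolding M'_def by blast
      then show ?thesis unfolding M'_def using d
        by (intro CollectI exI[of _ "u * d"] exI[of _ "c * d"])
           (auto simp: distrib_right mult.assoc intro: right_idealD(3)[OF M(1)] B(3))
    qed
    ultimately have rM': "right_ideal M'" unfolding right_ideal_def by blast
    have "1 \<notin> M'"
    proof
      assume "1 \<in> M'"
      then obtain u c where "u \<in> M" "c \<in> B" "1 = u + b * c" unfolding M'_def by blast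
      then have "1 - b * c \<in> M" by (metis add_diff_cancel_right')
      then show False using no \<open>c \<in> B\<close> by blast
    qed
    moreover have "indep_mod J {..<Suc k} (f(k := b))"
      using f by (intro indep_mod_Suc[OF right_idealD(1)[OF J(1)] sM M(2)] b(2)) auto
    moreover have "\<forall>i<Suc k. (f(k := b)) i \<in> M'" using f(1) MM' bM' by (auto simp: less_Suc_eq)
    moreover have "J \<subseteq> M'" using M(2) MM' by blast
    ultimately have "?R (Suc k) M' (f(k := b))" using rM' by blast
    then have "?Q (Suc k)" by blast
    from k[OF this] show False by simp
  qed
  moreover have "M \<noteq> {0}" using J(1,2) M(2) subspace_0[OF right_idealD(1)[OF J(1)]] by blast
  ultimately show ?thesis using M by (intro that[of M]) (auto simp: maximal_ideal_def)
qed

lemma right_ore: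
  assumes J: "right_ideal J" "J \<noteq> {0}" and b: "b \<in> B"
  obtains x where "x \<in> B" "x \<noteq> 0" "b * x \<in> J"
proof -
  obtain D where D: "\<And>k f. (\<And>i. i < k \<Longrightarrow> f i \<in> B) \<Longrightarrow> indep_mod J {..<k::nat} f \<Longrightarrow> k \<le> D"
    using finite_codim[OF J] by blast
  have pB: "p ^ i \<in> B" for i by (rule power_in_subalgebra[OF subalgebra_generated[OF T(2)] B(4)])
  have "\<not> indep_mod J {..<Suc D} (\<lambda>i. b * p ^ i)"
    using D[of "Suc D" "\<lambda>i. b * p ^ i"] B(3)[OF b pB] by auto
  then obtain c i where c: "(\<Sum>i<Suc D. c i \<odot> (b * p ^ i)) \<in> J" "i < Suc D" "c i \<noteq> 0"
    unfolding indep_mod_def by auto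
  define r where "r = (\<Sum>i<Suc D. monom (c i) i)"
  have "coeff r i = c i" using c(2) by (simp add: r_def coeff_sum del: sum.lessThan_Suc)
  then have "r \<noteq> 0" using c(3) by auto
  then have "peval p r \<noteq> 0" using peval_eq_0_iff[OF p_notin_scalars] by blast
  moreover have "b * peval p r \<in> J"
    using c(1) by (simp add: r_def peval_sum peval_monom sum_distrib_left scale_mult_right del: sum.lessThan_Suc)
  moreover have "peval p r \<in> B" by (rule peval_in_subalgebra[OF subalgebra_generated[OF T(2)] B(4)])
  ultimately show ?thesis using that by blast
qed

definition annihilator :: "'a set \<Rightarrow> 'a set" where
  "annihilator M = {x \<in> B. \<forall>b\<in>B. b * x \<in> M}"

text \<open>The basis vectors of the quotient are treated one at a time: \<open>right_ore\<close>
  gives a right factor of \<open>x\<close> that sends the next vector into \<open>M\<close>, and the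
  earlier ones stay there because \<open>M\<close> is a right ideal.\<close>

lemma annihilator_nonzero:
  assumes M: "right_ideal M" "M \<noteq> {0}"
  obtains x where "x \<in> annihilator M" "x \<noteq> 0"
proof -
  note sM = right_idealD(1)[OF M(1)]
  obtain s y where y: "basis_mod M s y" using basis_mod_exists[OF M] .
  have "\<exists>x\<in>B. x \<noteq> 0 \<and> (\<forall>i<k. y i * x \<in> M)" if "k \<le> s" for k
    using that
  proof (induction k)
    case 0
    then show ?case using B(2) by (intro bexI[of _ 1]) auto
  next
    case (Suc k)
    then obtain x where x: "x \<in> B" "x \<noteq> 0" "\<forall>i<k. y i * x \<in> M" by auto
    have "y k * x \<in> B" using y Suc.prems x(1) by (auto simp: basis_mod_def intro: B(3))
    then obtain z where z: "z \<in> B" "z \<noteq> 0" "y k * x * z \<in> M" using right_ore[OF M] by blast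
    have "y i * (x * z) \<in> M" if "i < Suc k" for i
      using that x(3) z right_idealD(3)[OF M(1), of "y i * x" z] by (auto simp: less_Suc_eq mult.assoc)
    then show ?case using x z B(3) by (intro bexI[of _ "x * z"]) auto
  qed
  then obtain x where x: "x \<in> B" "x \<noteq> 0" "\<forall>i<s. y i * x \<in> M" by blast
  have "b * x \<in> M" if b: "b \<in> B" for b
  proof -
    obtain c where c: "b - (\<Sum>i<s. c i \<odot> y i) \<in> M" using y b unfolding basis_mod_def by blast
    have "(b - (\<Sum>i<s. c i \<odot> y i)) * x + (\<Sum>i<s. c i \<odot> (y i * x)) \<in> M"
      using x right_idealD(3)[OF M(1) c x(1)] by (intro subspace_add[OF sM] subspace_sum[OF sM] subspace_scale[OF sM]) auto
    moreover have "(b - (\<Sum>i<s. c i \<odot> y i)) * x + (\<Sum>i<s. c i \<odot> (y i * x)) = b * x"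
      by (simp add: left_diff_distrib sum_distrib_right scale_mult_left)
    ultimately show ?thesis by simp
  qed
  then show ?thesis using x that by (auto simp: annihilator_def)
qed

section \<open>Simple modules of dimension at least two\<close>

definition point :: "'a set \<Rightarrow> bool" where
  "point M \<longleftrightarrow> maximal_ideal M \<and> (\<exists>b\<in>B. \<forall>c. b - c \<odot> 1 \<notin> M)"

text \<open>Let c be the commutator of \<open>p\<close> and \<open>q\<close>. The ideal
  \<open>M\<close> is chosen to contain t - m for some t = x c y and a scalar m different from 0, so
  t is not in \<open>M\<close>. If the quotient had dimension 1, \<open>M\<close> would be two-sided
  with a commutative quotient; it would contain c and therefore t.\<close>

lemma point_exists:
  assumes x: "x \<in> B" "x \<noteq> 0"
  obtains M b where "point M" "b \<in> B" "x * b \<notin> M"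
proof -
  define c where "c = p * q - q * p"
  have c: "c \<noteq> 0" "c \<in> B" using pq by (auto simp: c_def intro!: subspace_diff[OF B(1)] B)
  \<comment> \<open>\<open>no_inverse\<close> asks for a nonscalar element; if x c is a scalar, then
    x c p is not.\<close>
  have "\<exists>y\<in>B. x * c * y \<notin> scalars"
  proof (cases "x * c \<in> scalars")
    case True
    then obtain l where l: "x * c = l \<odot> 1" by (auto simp: scalars_def)
    then have l0: "l \<noteq> 0" using x c by auto
    have "l \<odot> p \<notin> scalars"
    proof
      assume "l \<odot> p \<in> scalars"
      then obtain r where "l \<odot> p = r \<odot> 1" by (auto simp: scalars_def)
      then have "inverse l \<odot> (l \<odot> p) = (inverse l * r) \<odot> 1" by simp
      then have "p = (inverse l * r) \<odot> 1" using l0 by simp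
      then show False using p_notin_scalars by (auto simp: scalars_def)
    qed
    then show ?thesis using l B(4) by (intro bexI[of _ p]) (auto simp: scale_mult_left)
  next
    case False
    then show ?thesis using B(2) by (intro bexI[of _ 1]) auto
  qed
  then obtain y where y: "y \<in> B" "x * c * y \<notin> scalars" by blast
  define t where "t = x * c * y"
  have tB: "t \<in> B" unfolding t_def by (intro B(3) x c y)
  have ts: "t \<notin> scalars" using y(2) by (simp add: t_def)
  let ?T = "insert t T"
  have TB: "?T \<subseteq> B" using tB generated_base by blast
  have gen: "B \<subseteq> generated ?T"
    using subalgebra_generated[of ?T] T(2) generated_base by (intro generated_minimal) auto
  obtain n where "dim (space_power (span ?T) (2 * n)) < (n + 1) ^ 2"
    using subquadratic[OF _ _ TB] T by auto
  then obtain r where r: "r \<noteq> 0" "\<And>m u. poly r m \<noteq> 0 \<Longrightarrow> u \<in> generated ?T \<Longrightarrow> (t - m \<odot> 1) * u \<noteq> 1"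
    using no_inverse[of ?T t n] T ts by auto
  \<comment> \<open>The additional factor X excludes m = 0.\<close>
  have "finite {m. poly ([:0, 1:] * r) m = 0}" using r(1) by (intro poly_roots_finite) auto
  from ex_new_if_finite[OF infinite_UNIV_char_0 this]
  obtain m where m: "m \<noteq> 0" "poly r m \<noteq> 0" by auto
  define g where "g = t - m \<odot> 1"
  have gB: "g \<in> B" unfolding g_def by (intro subspace_diff subspace_scale B tB)
  define J where "J = (\<lambda>u. g * u) ` B"
  have J: "right_ideal J" unfolding right_ideal_def subspace_def
  proof (intro conjI ballI allI)
    show "0 \<in> J" unfolding J_def by (rule image_eqI[of _ _ 0]) (auto intro: subspace_0[OF B(1)])
    show "J \<subseteq> B" unfolding J_def using B(3)[OF gB] by blast
  next
    fix x y assume "x \<in> J" "y \<in> J"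
    then show "x + y \<in> J" unfolding J_def
      by (auto intro!: image_eqI[of _ _ "_ + _"] subspace_add[OF B(1)] simp: distrib_left[symmetric])
  next
    fix c x assume "x \<in> J"
    then show "c \<odot> x \<in> J" unfolding J_def
      by (auto intro!: image_eqI[of _ _ "c \<odot> _"] subspace_scale[OF B(1)] simp: scale_mult_right)
  next
    fix x b assume "x \<in> J" "b \<in> B"
    then show "x * b \<in> J" unfolding J_def by (auto intro!: image_eqI[of _ _ "_ * b"] B(3) simp: mult.assoc)
  qed
  have gJ: "g \<in> J" unfolding J_def using B(2) by (intro image_eqI[of _ _ 1]) auto
  have "g \<noteq> 0" using ts by (auto simp: g_def scalars_def)
  then have J0: "J \<noteq> {0}" using gJ by auto
  have "1 \<notin> J" using r(2)[OF m(2)] gen unfolding J_def g_def by (metis (no_types, lifting) imageE subsetD)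
  then obtain M where M: "maximal_ideal M" "J \<subseteq> M" using maximal_ideal_exists[OF J J0] by blast
  have rM: "right_ideal M" and M1: "1 \<notin> M" using M(1) by (auto simp: maximal_ideal_def)
  note sM = right_idealD(1)[OF rM]
  have tM: "t \<notin> M"
  proof
    assume "t \<in> M"
    then have "t - g \<in> M" using M(2) gJ subspace_diff[OF sM] by blast
    then have "inverse m \<odot> (t - g) \<in> M" by (rule subspace_scale[OF sM])
    then show False using M1 m(1) by (simp add: g_def)
  qed
  have "\<exists>b\<in>B. \<forall>l. b - l \<odot> 1 \<notin> M"
  proof (rule ccontr)
    assume "\<not> ?thesis"
    then have all: "\<exists>l. b - l \<odot> 1 \<in> M" if "b \<in> B" for b using that by blast
    have left: "b * u \<in> M" if b: "b \<in> B" and u: "u \<in> M" for b u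
    proof -
      obtain l where l: "b - l \<odot> 1 \<in> M" using all[OF b] by blast
      have "(b - l \<odot> 1) * u + l \<odot> u \<in> M"
        using u right_idealD(2)[OF rM] by (intro subspace_add[OF sM] subspace_scale[OF sM] right_idealD(3)[OF rM l]) auto
      then show ?thesis by (simp add: left_diff_distrib scale_mult_left)
    qed
    obtain l where l: "p - l \<odot> 1 \<in> M" using all[OF B(4)] by blast
    obtain l' where l': "q - l' \<odot> 1 \<in> M" using all[OF B(5)] by blast
    have "(p - l \<odot> 1) * (q - l' \<odot> 1) - (q - l' \<odot> 1) * (p - l \<odot> 1) \<in> M"
      using l l' right_idealD(2)[OF rM]
      by (intro subspace_diff[OF sM right_idealD(3)[OF rM l] right_idealD(3)[OF rM l']]) auto
    also have "(p - l \<odot> 1) * (q - l' \<odot> 1) - (q - l' \<odot> 1) * (p - l \<odot> 1) = c"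
      by (simp add: c_def algebra_simps scale_mult_left scale_mult_right)
    finally have "x * (c * y) \<in> M" by (intro left x(1) right_idealD(3)[OF rM] y(1))
    then show False using tM by (simp add: t_def mult.assoc)
  qed
  then have "point M" using M(1) by (simp add: point_def)
  moreover have "x * (c * y) \<notin> M" using tM by (simp add: t_def mult.assoc)
  ultimately show ?thesis using that B(3)[OF c(2) y(1)] by blast
qed

definition common_annihilator :: "(nat \<Rightarrow> 'a set) \<Rightarrow> nat \<Rightarrow> 'a set" where
  "common_annihilator M j = {x \<in> B. \<forall>i<j. x \<in> annihilator (M i)}"

lemma annihilator_ideal:
  assumes "right_ideal M" "x \<in> annihilator M" "b \<in> B"
  shows "b * x \<in> annihilator M" "x * b \<in> annihilator M"
  using assms B(3) right_idealD(3)[OF assms(1)]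
  by (auto simp: annihilator_def mult.assoc[symmetric])

text \<open>That each module survives the common annihilator of its predecessors is what makes
  codimensions add up in \<open>codim_lower_bound\<close>. For the next point, take a nonzero
  \<open>x\<close> in the common annihilator and a point where \<open>x\<close> acts nontrivially;
  with a nonzero \<open>y\<close> annihilating the new module, the product x y keeps the common
  annihilator nonzero.\<close>

lemma points_exist:
  "\<exists>M. (\<forall>j<N. point (M j) \<and> \<not> common_annihilator M j \<subseteq> M j) \<and> common_annihilator M N \<noteq> {0}"
proof (induction N)
  case 0
  have "1 \<in> common_annihilator M 0" for M using B(2) by (simp add: common_annihilator_def)
  then show ?case by force
next
  case (Suc N)
  then obtain M where M: "\<forall>j<N. point (M j) \<and> \<not> common_annihilator M j \<subseteq> M j" "common_annihilator M N \<noteq> {0}"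
    by blast
  have rI: "right_ideal (M i)" if "i < N" for i using M(1) that by (auto simp: point_def maximal_ideal_def)
  have "0 \<in> common_annihilator M N"
    using rI subspace_0 right_idealD(1) B(1) by (auto simp: common_annihilator_def annihilator_def)
  then obtain x where x: "x \<in> common_annihilator M N" "x \<noteq> 0" using M(2) by blast
  have xB: "x \<in> B" using x(1) by (simp add: common_annihilator_def)
  obtain M' b where M': "point M'" "b \<in> B" "x * b \<notin> M'" using point_exists[OF xB x(2)] .
  have rM': "right_ideal M'" "M' \<noteq> {0}" using M'(1) by (auto simp: point_def maximal_ideal_def)
  obtain y where y: "y \<in> annihilator M'" "y \<noteq> 0" using annihilator_nonzero[OF rM'] .
  have yB: "y \<in> B" using y(1) by (simp add: annihilator_def)
  let ?M = "M(N := M')"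
  have ca: "common_annihilator ?M j = common_annihilator M j" if "j \<le> N" for j
    using that by (auto simp: common_annihilator_def)
  have "x * b \<in> common_annihilator M N"
    using x(1) M'(2) B(3)[OF xB M'(2)] annihilator_ideal(2)[OF rI] by (auto simp: common_annihilator_def)
  then have "\<forall>j<Suc N. point (?M j) \<and> \<not> common_annihilator ?M j \<subseteq> ?M j"
    using M(1) M'(1,3) ca by (auto simp: less_Suc_eq)
  moreover have "x * y \<in> common_annihilator ?M (Suc N)"
    using x(1) B(3)[OF xB yB] annihilator_ideal(2)[OF rI _ yB] annihilator_ideal(1)[OF rM'(1) y(1) xB]
    by (auto simp: common_annihilator_def less_Suc_eq)
  moreover have "x * y \<noteq> 0" using x(2) y(2) by simp
  ultimately have "(\<forall>j<Suc N. point (?M j) \<and> \<not> common_annihilator ?M j \<subseteq> ?M j) \<and>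
      common_annihilator ?M (Suc N) \<noteq> {0}" by blast
  then show ?case by (rule exI[of _ ?M])
qed

text \<open>Write \<open>a\<close> in coordinates \<open>u\<close> for a basis of
  \<open>P m\<close>. The determinants of its action on the modules are N forms in N + 1 variables,
  hence have a nontrivial common zero. A kernel vector of the singular matrix is the class of
  \<open>b j\<close>.\<close>

lemma singular_element:
  assumes m: "m > 0" and N: "N + 1 = dim (P m)"
    and M: "\<And>j. j < N \<Longrightarrow> maximal_ideal (M j)"
  shows "\<exists>a b. a \<in> P m \<and> a \<noteq> 0 \<and> (\<forall>j<N. b j \<in> B \<and> b j \<notin> M j \<and> b j * a \<in> M j)"
proof (cases "N = 0")
  case True
  have "1 \<in> P m" using P_mono[of 0 m] by (auto intro: span_base)
  then show ?thesis using True by (intro exI[of _ 1]) auto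
next
  case False
  let ?L = "N + 1"
  obtain G where G: "G \<subseteq> P m" "independent G" "P m \<subseteq> span G" "card G = dim (P m)"
    by (rule basis_exists)
  have finG: "finite G" using indep_card_le_dim(1)[OF fin_dim_P G(1,2)] .
  obtain g where g: "bij_betw g {..<?L} G"
    using ex_bij_betw_nat_finite[OF finG] G(4) N by (auto simp: atLeast0LessThan)
  have gP: "g l \<in> P m" if "l < ?L" for l using bij_betwE[OF g] that G(1) by auto
  have gi: "c l = 0" if "(\<Sum>l<?L. c l \<odot> g l) = 0" "l < ?L" for c l
  proof -
    have "(\<Sum>x\<in>G. c (inv_into {..<?L} g x) \<odot> x) = (\<Sum>l<?L. c l \<odot> g l)"
      using bij_betw_inv_into_left[OF g] by (subst sum.reindex_bij_betw[OF g, symmetric]) (auto intro!: sum.cong)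
    then have "c (inv_into {..<?L} g (g l)) = 0"
      using independentD[OF G(2) finG subset_refl, of "\<lambda>x. c (inv_into {..<?L} g x)" "g l"] that bij_betwE[OF g] by auto
    then show ?thesis using bij_betw_inv_into_left[OF g, of l] that(2) by simp
  qed
  \<comment> \<open>A triple of dimension, basis and structure constants of one module, so that all
    three can be chosen at once for every \<open>j\<close>.\<close>
  define R where "R j z = (case z of (s, y, A) \<Rightarrow> basis_mod (M j) s y \<and> 0 < s \<and>
      (\<forall>l<?L. \<forall>k<s. y k * g l - (\<Sum>i<s. A l k i \<odot> y i) \<in> M j))" for j z
  have "\<exists>z. R j z" if j: "j < N" for j
  proof -
    have rM: "right_ideal (M j)" "M j \<noteq> {0}" "1 \<notin> M j" using M[OF j] by (auto simp: maximal_ideal_def)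
    obtain s y where y: "basis_mod (M j) s y" using basis_mod_exists[OF rM(1,2)] .
    have "\<exists>c. y k * g l - (\<Sum>i<s. c i \<odot> y i) \<in> M j" if "l < ?L" "k < s" for l k
    proof -
      have "y k * g l \<in> B" using y that gP P_subset_B by (auto simp: basis_mod_def intro!: B(3))
      then show ?thesis using y by (simp add: basis_mod_def)
    qed
    then obtain A where "\<forall>l<?L. \<forall>k<s. y k * g l - (\<Sum>i<s. A l k i \<odot> y i) \<in> M j" by metis
    moreover have "s \<noteq> 0"
    proof
      assume "s = 0"
      then show False using y rM(3) B(2) by (auto simp: basis_mod_def)
    qed
    ultimately have "R j (s, y, A)" using y by (simp add: R_def)
    then show ?thesis by (rule exI)
  qed
  then obtain z where z: "\<And>j. j < N \<Longrightarrow> R j (z j)" by metis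
  define s y A where "s j = fst (z j)" and "y j = fst (snd (z j))" and "A j = snd (snd (z j))" for j
  have yA: "basis_mod (M j) (s j) (y j)" "0 < s j"
    "l < ?L \<Longrightarrow> k < s j \<Longrightarrow> y j k * g l - (\<Sum>i<s j. A j l k i \<odot> y j i) \<in> M j" if "j < N" for j l k
    using z[OF that] unfolding R_def case_prod_beta s_def[symmetric] y_def[symmetric] A_def[symmetric] by blast+
  define X where "X j u = mat (s j) (s j) (\<lambda>(i, k). \<Sum>l<?L. A j l k i * u l)" for j u
  have "\<exists>u. (\<exists>l<?L. u l \<noteq> 0) \<and> (\<forall>j<N. det (X j u) = 0)"
  proof (rule forms_common_zero)
    show "(\<lambda>u. det (X j u)) \<in> forms ?L (s j)" for j unfolding X_def by (rule det_linear_form)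
  qed (use False yA(2) in auto)
  then obtain u where u: "\<exists>l<?L. u l \<noteq> 0" "\<forall>j<N. det (X j u) = 0" by blast
  define a where "a = (\<Sum>l<?L. u l \<odot> g l)"
  have "a \<in> P m" unfolding a_def using gP by (intro subspace_sum subspace_scale subspace_space_power) auto
  moreover have "a \<noteq> 0" using gi[of u] u(1) unfolding a_def by blast
  moreover have "\<exists>b. b \<in> B \<and> b \<notin> M j \<and> b * a \<in> M j" if j: "j < N" for j
  proof -
    have sM: "subspace (M j)" using M[OF j] right_idealD(1) by (auto simp: maximal_ideal_def)
    have XC: "X j u \<in> carrier_mat (s j) (s j)" by (simp add: X_def)
    obtain v where v: "v \<in> carrier_vec (s j)" "v \<noteq> 0\<^sub>v (s j)" "X j u *\<^sub>v v = 0\<^sub>v (s j)"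
      using u(2) j det_0_iff_vec_prod_zero_field[OF XC] by blast
    have row: "(\<Sum>k<s j. (\<Sum>l<?L. A j l k i * u l) * v $ k) = 0" if i: "i < s j" for i
    proof -
      have "(X j u *\<^sub>v v) $ i = (\<Sum>k<s j. (\<Sum>l<?L. A j l k i * u l) * v $ k)"
        using i v(1) by (simp add: X_def scalar_prod_def atLeast0LessThan)
      then show ?thesis using v(3) i by simp
    qed
    define b where "b = (\<Sum>k<s j. v $ k \<odot> y j k)"
    have yB: "y j k \<in> B" if "k < s j" for k using yA(1)[OF j] that by (auto simp: basis_mod_def)
    have "b \<in> B" unfolding b_def using yB by (intro subspace_sum subspace_scale B(1)) auto
    moreover have "b \<notin> M j"
    proof
      assume "b \<in> M j"
      then have "v $ k = 0" if "k < s j" for k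
        using yA(1)[OF j] that indep_modD[of "M j" "{..<s j}" "y j" "\<lambda>k. v $ k"]
        unfolding b_def basis_mod_def by auto
      then have "v = 0\<^sub>v (s j)" using v(1) by (intro eq_vecI) auto
      then show False using v(2) by simp
    qed
    moreover have "b * a \<in> M j"
    proof -
      \<comment> \<open>The coordinates of b a in the basis \<open>y j\<close> are the entries of
        the vanishing vector \<open>X j u\<close> times \<open>v\<close>, so b a is this sum of
        error terms, all of which lie in \<open>M j\<close>.\<close>
      have "(\<Sum>k<s j. \<Sum>l<?L. (v $ k * u l) \<odot> (y j k * g l - (\<Sum>i<s j. A j l k i \<odot> y j i))) \<in> M j"
        using yA(3)[OF j] by (intro subspace_sum[OF sM] subspace_scale[OF sM]) auto
      also have "(\<Sum>k<s j. \<Sum>l<?L. (v $ k * u l) \<odot> (y j k * g l - (\<Sum>i<s j. A j l k i \<odot> y j i))) =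
          (\<Sum>k<s j. \<Sum>l<?L. (v $ k * u l) \<odot> (y j k * g l)) -
          (\<Sum>k<s j. \<Sum>l<?L. \<Sum>i<s j. (v $ k * u l * A j l k i) \<odot> y j i)"
        by (simp add: scale_right_diff_distrib sum_subtractf scale_sum_right)
      also have "(\<Sum>k<s j. \<Sum>l<?L. \<Sum>i<s j. (v $ k * u l * A j l k i) \<odot> y j i) =
          (\<Sum>k<s j. \<Sum>i<s j. \<Sum>l<?L. (v $ k * u l * A j l k i) \<odot> y j i)"
        by (intro sum.cong refl sum.swap)
      also have "\<dots> = (\<Sum>i<s j. \<Sum>k<s j. \<Sum>l<?L. (v $ k * u l * A j l k i) \<odot> y j i)"
        by (rule sum.swap)
      also have "\<dots> = (\<Sum>i<s j. \<Sum>k<s j. ((\<Sum>l<?L. A j l k i * u l) * v $ k) \<odot> y j i)"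
        by (intro sum.cong refl)
           (simp add: scale_sum_left[symmetric] sum_distrib_left mult_ac del: sum.lessThan_Suc)
      also have "\<dots> = (\<Sum>i<s j. (\<Sum>k<s j. (\<Sum>l<?L. A j l k i * u l) * v $ k) \<odot> y j i)"
        by (simp only: scale_sum_left)
      also have "\<dots> = 0" using row by simp
      also have "(\<Sum>k<s j. \<Sum>l<?L. (v $ k * u l) \<odot> (y j k * g l)) = b * a"
        unfolding a_def b_def sum_product by (simp add: scale_mult_left scale_mult_right mult.commute)
      finally show ?thesis by simp
    qed
    ultimately show ?thesis by blast
  qed
  ultimately show ?thesis by metis
qed

text \<open>Left multiplication by \<open>b j\<close> maps the right ideal for \<open>j\<close> to
  the simple module B modulo \<open>M j\<close>, with the right ideal for j + 1 as kernel. It is not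
  zero: if b_j c is congruent to 1 and z lies in the common annihilator but not in
  \<open>M j\<close>, then c z is sent to the class of z. By simplicity it is onto, so each step
  loses at least 2 dimensions.\<close>

lemma codim_lower_bound:
  assumes M: "\<And>j. j < N \<Longrightarrow> point (M j) \<and> \<not> common_annihilator M j \<subseteq> M j"
    and b: "\<And>j. j < N \<Longrightarrow> b j \<in> B \<and> b j \<notin> M j"
    and j: "j \<le> N"
  shows "\<exists>f. (\<forall>i<2 * j. f i \<in> B) \<and> indep_mod {x \<in> B. \<forall>i<j. b i * x \<in> M i} {..<2 * j} f"
  using j
proof (induction j)
  case 0
  then show ?case by (simp add: indep_mod_def)
next
  case (Suc j)
  let ?K = "\<lambda>j. {x \<in> B. \<forall>i<j. b i * x \<in> M i}"
  have rM: "right_ideal (M i)" if "i < N" for i using M[OF that] by (auto simp: point_def maximal_ideal_def)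
  have jN: "j < N" using Suc.prems by simp
  note sM = right_idealD(1)[OF rM]
  obtain f where f: "\<forall>i<2 * j. f i \<in> B" "indep_mod (?K j) {..<2 * j} f" using Suc by auto
  have sK: "subspace (?K l)" if "l \<le> N" for l
    unfolding subspace_def
  proof (intro conjI ballI allI)
    show "0 \<in> ?K l" using subspace_0[OF B(1)] subspace_0[OF sM] that by auto
  next
    fix x y assume "x \<in> ?K l" "y \<in> ?K l"
    then show "x + y \<in> ?K l" using subspace_add[OF B(1)] subspace_add[OF sM] that by (auto simp: distrib_left)
  next
    fix c x assume "x \<in> ?K l"
    then show "c \<odot> x \<in> ?K l"
      using subspace_scale[OF B(1)] subspace_scale[OF sM] that by (auto simp: scale_mult_right)
  qed
  have K_right: "x * y \<in> ?K j" if "x \<in> ?K j" "y \<in> B" for x y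
    using that B(3) right_idealD(3)[OF rM] jN by (auto simp: mult.assoc[symmetric])
  have maxM: "maximal_ideal (M j)" using M[OF jN] by (simp add: point_def)
  obtain z where z: "z \<in> common_annihilator M j" "z \<notin> M j" using M[OF jN] by blast
  have zB: "z \<in> B" using z(1) by (simp add: common_annihilator_def)
  have ann_K: "c * z \<in> ?K j" if "c \<in> B" for c
    using z(1) that b jN B(3) unfolding common_annihilator_def annihilator_def
    by (auto simp: mult.assoc[symmetric])
  obtain c where c: "c \<in> B" "1 - b j * c \<in> M j" using maxM b[OF jN] by (auto simp: maximal_ideal_def)
  define k where "k = c * z"
  have k: "k \<in> ?K j" unfolding k_def by (rule ann_K[OF c(1)])
  have bk: "b j * k \<notin> M j"
  proof
    assume "b j * k \<in> M j"
    then have "(1 - b j * c) * z + b j * k \<in> M j"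
      by (intro subspace_add[OF sM[OF jN]] right_idealD(3)[OF rM[OF jN] c(2) zB])
    then show False using z(2) by (simp add: k_def algebra_simps)
  qed
  have "b j * k \<in> B" using b[OF jN] k B(3) by auto
  then obtain d where d: "d \<in> B" "1 - b j * k * d \<in> M j" using maxM bk by (auto simp: maximal_ideal_def)
  obtain w where w: "w \<in> B" "\<And>l. w - l \<odot> 1 \<notin> M j" using M[OF jN] by (auto simp: point_def)
  \<comment> \<open>\<open>k0\<close> and \<open>k1\<close> are preimages of the classes of 1 and
    \<open>w\<close>, which are independent because \<open>w\<close> is not a scalar modulo
    \<open>M j\<close>.\<close>
  define k0 where "k0 = k * d"
  define k1 where "k1 = k * d * w"
  have kK: "k0 \<in> ?K j" "k1 \<in> ?K j" unfolding k0_def k1_def using K_right[OF k d(1)] K_right[OF K_right[OF k d(1)] w(1)] .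
  have k0m: "1 - b j * k0 \<in> M j" using d(2) by (simp add: k0_def mult.assoc)
  have k1m: "w - b j * k1 \<in> M j"
    using right_idealD(3)[OF rM[OF jN] d(2) w(1)] by (simp add: k1_def algebra_simps)
  let ?f = "f(2 * j := k0, Suc (2 * j) := k1)"
  have "indep_mod (?K (Suc j)) {..<2 * Suc j} ?f"
    unfolding indep_mod_def
  proof (intro allI impI ballI)
    fix e i assume e: "(\<Sum>i<2 * Suc j. e i \<odot> ?f i) \<in> ?K (Suc j)" and i: "i \<in> {..<2 * Suc j}"
    define \<alpha> \<beta> where "\<alpha> = e (2 * j)" and "\<beta> = e (Suc (2 * j))"
    have eq: "(\<Sum>i<2 * Suc j. e i \<odot> ?f i) = (\<Sum>i<2 * j. e i \<odot> f i) + (\<alpha> \<odot> k0 + \<beta> \<odot> k1)"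
      by (simp add: \<alpha>_def \<beta>_def add.assoc)
    have kk: "\<alpha> \<odot> k0 + \<beta> \<odot> k1 \<in> ?K j"
      using jN by (intro subspace_add[OF sK] subspace_scale[OF sK] kK) auto
    have "(\<Sum>i<2 * j. e i \<odot> f i) + (\<alpha> \<odot> k0 + \<beta> \<odot> k1) - (\<alpha> \<odot> k0 + \<beta> \<odot> k1) \<in> ?K j"
      using e jN unfolding eq by (intro subspace_diff[OF sK] kk) auto
    then have "(\<Sum>i<2 * j. e i \<odot> f i) \<in> ?K j" by simp
    then have e0: "e i = 0" if "i < 2 * j" for i using indep_modD[OF f(2)] that by blast
    then have "\<alpha> \<odot> k0 + \<beta> \<odot> k1 \<in> ?K (Suc j)" using e unfolding eq by simp
    then have "b j * (\<alpha> \<odot> k0 + \<beta> \<odot> k1) \<in> M j" by blast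
    then have "b j * (\<alpha> \<odot> k0 + \<beta> \<odot> k1) + (\<alpha> \<odot> (1 - b j * k0) + \<beta> \<odot> (w - b j * k1)) \<in> M j"
      by (intro subspace_add[OF sM[OF jN]] subspace_scale[OF sM[OF jN]] k0m k1m)
    moreover have "b j * (\<alpha> \<odot> k0 + \<beta> \<odot> k1) + (\<alpha> \<odot> (1 - b j * k0) + \<beta> \<odot> (w - b j * k1)) = \<alpha> \<odot> 1 + \<beta> \<odot> w"
      by (simp add: distrib_left scale_mult_right scale_right_diff_distrib)
    ultimately have ab: "\<alpha> \<odot> 1 + \<beta> \<odot> w \<in> M j" by simp
    have b0: "\<beta> = 0"
    proof (rule ccontr)
      assume "\<beta> \<noteq> 0"
      then have "inverse \<beta> \<odot> (\<alpha> \<odot> 1 + \<beta> \<odot> w) = w - (- \<alpha> / \<beta>) \<odot> 1"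
        by (simp add: scale_right_distrib divide_inverse mult.commute add.commute)
      then show False using subspace_scale[OF sM[OF jN] ab, of "inverse \<beta>"] w(2) by metis
    qed
    have a0: "\<alpha> = 0"
    proof (rule ccontr)
      assume "\<alpha> \<noteq> 0"
      then have "1 \<in> M j" using subspace_scale[OF sM[OF jN] ab, of "inverse \<alpha>"] b0 by simp
      then show False using maxM by (simp add: maximal_ideal_def)
    qed
    show "e i = 0" using i e0 a0 b0 by (auto simp: \<alpha>_def \<beta>_def less_Suc_eq)
  qed
  moreover have "\<forall>i<2 * Suc j. ?f i \<in> B" using f(1) kK by (auto simp: less_Suc_eq)
  ultimately show ?case by blast
qed

section \<open>Growth beyond every linear bound\<close>

lemma dim_P_ge: "n + 1 \<le> dim (P n)"
proof -
  have "poly_free p 1 (\<lambda>_. 1)" using peval_eq_0_iff[OF p_notin_scalars] by (simp add: poly_free_def)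
  from poly_free_dim_le[OF _ _ _ this, of "span T" 0 n] show ?thesis
    using T by (auto intro: fin_dim_span span_base)
qed

text \<open>Since every b_i a lies in \<open>M i\<close>, the whole right ideal of the singular
  element \<open>a\<close> lies in \<open>?K\<close>, and \<open>codim_lower_bound\<close> supplies
  2 N independent elements modulo \<open>?K\<close>.\<close>

lemma growth_step:
  assumes m: "m > 0"
  obtains n0 where "\<And>n. n \<ge> n0 \<Longrightarrow> 2 * (dim (P m) - 1) + dim (P n) \<le> dim (P (n + m))"
proof -
  define N where "N = dim (P m) - 1"
  have N: "N + 1 = dim (P m)" using dim_P_ge[of m] by (simp add: N_def)
  obtain M where M: "\<And>j. j < N \<Longrightarrow> point (M j) \<and> \<not> common_annihilator M j \<subseteq> M j"
    using points_exist[of N] by blast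
  then have maxM: "maximal_ideal (M j)" if "j < N" for j using that by (simp add: point_def)
  obtain a b where a: "a \<in> P m" "a \<noteq> 0" and b: "\<And>j. j < N \<Longrightarrow> b j \<in> B \<and> b j \<notin> M j \<and> b j * a \<in> M j"
    using singular_element[of m N M, OF m N maxM] by blast
  let ?K = "{x \<in> B. \<forall>i<N. b i * x \<in> M i}"
  obtain f where f: "\<forall>i<2 * N. f i \<in> B" "indep_mod ?K {..<2 * N} f"
    using codim_lower_bound[OF M, of N b N] b by blast
  have rM: "right_ideal (M i)" if "i < N" for i using maxM[OF that] by (simp add: maximal_ideal_def)
  note sM = right_idealD(1)[OF rM]
  have "subspace ?K"
    unfolding subspace_def
    using subspace_0[OF B(1)] subspace_0[OF sM] subspace_add[OF B(1)] subspace_add[OF sM]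
      subspace_scale[OF B(1)] subspace_scale[OF sM]
    by (auto simp: distrib_left scale_mult_right)
  moreover have "a * x \<in> ?K" if "x \<in> B" for x
    using that a(1) P_subset_B B(3) b right_idealD(3)[OF rM] by (auto simp: mult.assoc[symmetric])
  ultimately obtain n0 where "\<And>n. n \<ge> n0 \<Longrightarrow> card {..<2 * N} + dim (P n) \<le> dim (P (n + m))"
    using dim_P_step[OF _ a(2,1) _ _ _ f(2)] f(1) by auto
  then have "2 * (dim (P m) - 1) + dim (P n) \<le> dim (P (n + m))" if "n \<ge> n0" for n
    using that by (simp add: N_def)
  then show ?thesis by (rule that)
qed

text \<open>Every \<open>m\<close> steps contribute at least 2 c m - 2, which is at least (7/4) c m
  because c m is at least 8. An initial segment of at most n/7 is discarded, and 7/4 times 6/7 is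
  3/2.\<close>

lemma growth_rate_improves:
  fixes c :: real
  assumes c: "c \<ge> 1" and n0: "\<And>n. n \<ge> n0 \<Longrightarrow> c * real n \<le> real (dim (P n))"
  obtains n1 where "\<And>n. n \<ge> n1 \<Longrightarrow> 3 / 2 * c * real n \<le> real (dim (P n))"
proof -
  define m where "m = max n0 8"
  have m: "m \<ge> n0" "m \<ge> 8" "m > 0" by (auto simp: m_def)
  obtain n2 where n2: "\<And>n. n \<ge> n2 \<Longrightarrow> 2 * (dim (P m) - 1) + dim (P n) \<le> dim (P (n + m))"
    using growth_step[OF m(3)] by blast
  have "7 / 4 * c * real m \<le> real (2 * (dim (P m) - 1))"
  proof -
    have "8 \<le> c * real m" using c m(2) mult_mono[of 1 c 8 "real m"] by simp
    moreover have "real (2 * (dim (P m) - 1)) = 2 * real (dim (P m)) - 2"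
      using dim_P_ge[of m] by (simp add: of_nat_diff)
    ultimately show ?thesis using n0[OF m(1)] by simp
  qed
  then have step: "7 / 4 * c * real m + real (dim (P n)) \<le> real (dim (P (n + m)))" if "n \<ge> n2" for n
    using n2[OF that] by linarith
  have it: "7 / 4 * c * real m * real j \<le> real (dim (P (n + j * m)))" if "n \<ge> n2" for n j
  proof (induction j)
    case (Suc j)
    then show ?case using step[of "n + j * m"] that by (simp add: algebra_simps)
  qed simp
  show ?thesis
  proof (rule that[of "7 * (n2 + m)"])
    fix n assume n: "n \<ge> 7 * (n2 + m)"
    define j where "j = (n - n2) div m"
    define r where "r = (n - n2) mod m"
    have nn: "n = (n2 + r) + j * m" using n by (simp add: j_def r_def)
    have "r < m" using m(3) by (simp add: r_def)
    then have "n \<le> n2 + m + j * m" using nn by linarith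
    then have "real n \<le> real (n2 + m + j * m)" by (rule of_nat_mono)
    then have "real n \<le> real (n2 + m) + real m * real j" by (simp add: mult.commute)
    moreover have "real (7 * (n2 + m)) \<le> real n" using n by (rule of_nat_mono)
    ultimately have "6 / 7 * real n \<le> real m * real j" by simp
    then have "7 / 4 * c * (6 / 7 * real n) \<le> 7 / 4 * c * (real m * real j)"
      using c by (intro mult_left_mono) auto
    also have "\<dots> \<le> real (dim (P n))" using it[of "n2 + r" j, folded nn] by (simp add: mult.assoc)
    finally show "3 / 2 * c * real n \<le> real (dim (P n))" by simp
  qed
qed

theorem contradiction: False
proof -
  have "\<exists>n0. \<forall>n\<ge>n0. (3 / 2) ^ i * real n \<le> real (dim (P n))" for i
  proof (induction i)
    case 0
    have "real n \<le> real (dim (P n))" for n using dim_P_ge[of n] by linarith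
    then show ?case by auto
  next
    case (Suc i)
    then obtain n0 where "\<And>n. n \<ge> n0 \<Longrightarrow> (3 / 2) ^ i * real n \<le> real (dim (P n))" by blast
    then obtain n1 where "\<And>n. n \<ge> n1 \<Longrightarrow> 3 / 2 * (3 / 2) ^ i * real n \<le> real (dim (P n))"
      using growth_rate_improves[of "(3 / 2) ^ i" n0] by auto
    then show ?case by auto
  qed
  moreover obtain C where C: "\<forall>n. dim (P n) \<le> C * (n + 1)" by (rule linear_bound)
  moreover obtain i where i: "real (2 * C) < (3 / 2) ^ i"
    using real_arch_pow[of "3 / 2" "real (2 * C)"] by auto
  ultimately obtain n0 where n0: "\<And>n. n \<ge> n0 \<Longrightarrow> (3 / 2) ^ i * real n \<le> real (dim (P n))" by blast
  define n where "n = max n0 1"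
  have "(3 / 2) ^ i * real n \<le> real (C * (n + 1))" 
    using n0[of n] of_nat_mono[OF C[rule_format, of n], where 'a = real] unfolding n_def by linarith
  also have "\<dots> \<le> real (C * (2 * n))" by (intro of_nat_mono mult_left_mono) (auto simp: n_def)
  also have "\<dots> = real (2 * C) * real n" by simp
  also have "\<dots> < (3 / 2) ^ i * real n" using i by (intro mult_strict_right_mono) (auto simp: n_def)
  finally show False by simp
qed

end

context domain_algebra
begin

theorem subquadratic_commutative:
  assumes A: "subalgebra A" and p: "p \<in> A" and q: "q \<in> A"
    and sq: "\<And>X. finite X \<Longrightarrow> 1 \<in> X \<Longrightarrow> X \<subseteq> A \<Longrightarrow> \<exists>n. dim (space_power (span X) (2 * n)) < (n + 1) ^ 2"
  shows "p * q = q * p"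
proof (rule ccontr)
  assume pq: "p * q \<noteq> q * p"
  have "generated {1, p, q} \<subseteq> A" using A p q by (intro generated_minimal) (auto simp: subalgebra_def)
  then interpret noncommutative_subquadratic scale "{1, p, q}" p q
    using pq sq by unfold_locales auto
  show False by (rule contradiction)
qed

end

section \<open>Locally nilpotent derivations\<close>

text \<open>\<open>x\<close> is a local slice: its derivative \<open>c\<close> is a nonzero element
  of the kernel but not necessarily a unit. Powers of \<open>c\<close> are the first denominators
  that occur.\<close>

locale nilpotent_derivation = domain_algebra scale
  for scale :: "'k::{alg_closed_field, field_char_0} \<Rightarrow> 'a::ring_1_no_zero_divisors \<Rightarrow> 'a"
    (infixr \<open>\<odot>\<close> 75) +
  fixes \<delta> :: "'a \<Rightarrow> 'a" and x c :: 'a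
  assumes fg: finitely_generated and GK: "GKdim < 3"
    and derivation: "derivation \<delta>" and nilpotent: "locally_nilpotent \<delta>"
    and slice: "\<delta> x = c" "\<delta> c = 0" "c \<noteq> 0"
begin

lemma delta_add: "\<delta> (a + b) = \<delta> a + \<delta> b"
  and delta_scale: "\<delta> (k \<odot> a) = k \<odot> \<delta> a"
  and delta_mult: "\<delta> (a * b) = a * \<delta> b + \<delta> a * b"
proof -
  interpret D: Vector_Spaces.linear scale scale \<delta> using derivation by (simp add: derivation_def)
  show "\<delta> (a + b) = \<delta> a + \<delta> b" "\<delta> (k \<odot> a) = k \<odot> \<delta> a" by (rule D.add, rule D.scale)
  show "\<delta> (a * b) = a * \<delta> b + \<delta> a * b" using derivation by (simp add: derivation_def)
qed

lemma delta_0: "\<delta> 0 = 0"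
  using delta_scale[of 0 0] by simp

lemma delta_1: "\<delta> 1 = 0"
  using delta_mult[of 1 1] by simp

lemma delta_diff: "\<delta> (a - b) = \<delta> a - \<delta> b"
  using delta_add[of "a - b" b] by (simp add: algebra_simps)

lemma funpow_delta_0: "(\<delta> ^^ n) 0 = 0"
  by (induction n) (auto simp: delta_0)

lemma funpow_delta_add: "(\<delta> ^^ n) (a + b) = (\<delta> ^^ n) a + (\<delta> ^^ n) b"
  by (induction n) (auto simp: delta_add)

lemma funpow_delta_diff: "(\<delta> ^^ n) (a - b) = (\<delta> ^^ n) a - (\<delta> ^^ n) b"
  by (induction n) (auto simp: delta_diff)

lemma funpow_delta_scale: "(\<delta> ^^ n) (k \<odot> a) = k \<odot> (\<delta> ^^ n) a"
  by (induction n) (auto simp: delta_scale)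

lemma funpow_delta_sum: "(\<delta> ^^ n) (\<Sum>i\<in>A. f i) = (\<Sum>i\<in>A. (\<delta> ^^ n) (f i))"
  by (induction A rule: infinite_finite_induct) (auto simp: funpow_delta_add funpow_delta_0)

lemma funpow_delta_vanish: "(\<delta> ^^ m) a = 0 \<Longrightarrow> m \<le> n \<Longrightarrow> (\<delta> ^^ n) a = 0"
  by (metis funpow_add o_apply le_add_diff_inverse2 funpow_delta_0)

definition kernel :: "'a set" where "kernel = {b. \<delta> b = 0}"

lemma funpow_delta_kernel_mult: "b \<in> kernel \<Longrightarrow> (\<delta> ^^ n) (b * a) = b * (\<delta> ^^ n) a"
  by (induction n) (auto simp: kernel_def delta_mult)

lemma subalgebra_kernel: "subalgebra kernel"
  unfolding subalgebra_def subspace_def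
  by (auto simp: kernel_def delta_0 delta_1 delta_add delta_scale delta_mult)

lemma kernel: "subspace kernel" "1 \<in> kernel" "a \<in> kernel \<Longrightarrow> b \<in> kernel \<Longrightarrow> a * b \<in> kernel"
  "c \<in> kernel"
  using subalgebra_kernel slice by (auto simp: subalgebra_def) (simp add: kernel_def)

lemma power_kernel: "b \<in> kernel \<Longrightarrow> b ^ n \<in> kernel"
  by (rule power_in_subalgebra[OF subalgebra_kernel])

text \<open>The Leibniz expansion stops after two terms because the second derivative of
  \<open>x\<close> vanishes.\<close>

lemma funpow_delta_x_mult:
  "(\<delta> ^^ Suc m) (x * y) = x * (\<delta> ^^ Suc m) y + of_nat (Suc m) \<odot> (c * (\<delta> ^^ m) y)"
proof (induction m)
  case 0
  then show ?case by (simp add: delta_mult slice)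
next
  case (Suc m)
  have "(\<delta> ^^ Suc (Suc m)) (x * y) = \<delta> ((\<delta> ^^ Suc m) (x * y))" by simp
  also have "\<dots> = \<delta> (x * (\<delta> ^^ Suc m) y) + of_nat (Suc m) \<odot> \<delta> (c * (\<delta> ^^ m) y)"
    unfolding Suc.IH by (simp add: delta_add delta_scale)
  also have "\<dots> = x * (\<delta> ^^ Suc (Suc m)) y + (c * (\<delta> ^^ Suc m) y + of_nat (Suc m) \<odot> (c * (\<delta> ^^ Suc m) y))"
    by (simp add: delta_mult slice)
  also have "c * (\<delta> ^^ Suc m) y + of_nat (Suc m) \<odot> (c * (\<delta> ^^ Suc m) y) =
      of_nat (Suc (Suc m)) \<odot> (c * (\<delta> ^^ Suc m) y)"
    by (subst of_nat_Suc, subst scale_left_distrib) simp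
  finally show ?case .
qed

lemma funpow_delta_x_power:
  "(\<delta> ^^ n) (x ^ n) = fact n \<odot> c ^ n \<and> (\<delta> ^^ Suc n) (x ^ n) = 0"
proof (induction n)
  case 0
  then show ?case by (simp add: delta_1)
next
  case (Suc n)
  then have "(\<delta> ^^ Suc n) (x ^ Suc n) = of_nat (Suc n) \<odot> (c * (fact n \<odot> c ^ n))"
    unfolding power_Suc funpow_delta_x_mult by (simp only: mult_zero_right add_0)
  also have "\<dots> = fact (Suc n) \<odot> c ^ Suc n"
    by (simp add: scale_mult_right fact_Suc del: of_nat_Suc)
  finally have 1: "(\<delta> ^^ Suc n) (x ^ Suc n) = fact (Suc n) \<odot> c ^ Suc n" .
  have "c ^ Suc n \<in> kernel" by (rule power_kernel[OF kernel(4)])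
  then have "(\<delta> ^^ Suc (Suc n)) (x ^ Suc n) = 0" using 1 by (simp add: delta_scale kernel_def)
  with 1 show ?case by blast
qed

text \<open>The n-th derivative kills the lower powers and turns b_n x^n into n! b_n c^n, which in a
  domain of characteristic 0 vanishes only with b_n.\<close>

lemma x_powers_independent:
  assumes "\<And>j. j \<le> n \<Longrightarrow> b j \<in> kernel" "(\<Sum>j\<le>n. b j * x ^ j) = 0"
  shows "\<forall>j\<le>n. b j = 0"
  using assms
proof (induction n)
  case 0
  then show ?case by simp
next
  case (Suc n)
  have van: "(\<delta> ^^ Suc n) (x ^ j) = 0" if "j \<le> n" for j
    using funpow_delta_vanish[OF conjunct2[OF funpow_delta_x_power[of j]], of "Suc n"] that by blast
  have "0 = (\<delta> ^^ Suc n) (\<Sum>j\<le>Suc n. b j * x ^ j)" using Suc.prems(2) by (simp only: funpow_delta_0)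
  also have "\<dots> = (\<Sum>j\<le>Suc n. b j * (\<delta> ^^ Suc n) (x ^ j))"
    unfolding funpow_delta_sum using Suc.prems(1) by (intro sum.cong funpow_delta_kernel_mult) auto
  also have "\<dots> = b (Suc n) * (\<delta> ^^ Suc n) (x ^ Suc n)"
    using van by (simp del: funpow.simps power_Suc)
  finally have "fact (Suc n) \<odot> (b (Suc n) * c ^ Suc n) = 0"
    unfolding conjunct1[OF funpow_delta_x_power[of "Suc n"]] scale_mult_right by (rule sym)
  then have "b (Suc n) = 0"
    using slice(3) by (simp only: scale_eq_0_iff mult_eq_0_iff power_eq_0_iff fact_nonzero) blast
  moreover from this have "(\<Sum>j\<le>n. b j * x ^ j) = 0" using Suc.prems(2) by simp
  then have "\<forall>j\<le>n. b j = 0" using Suc.prems(1) by (intro Suc.IH) simp_all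
  ultimately show ?case using le_Suc_eq by blast
qed

text \<open>Products g x^j, with g from a basis of the kernel part, are independent by
  \<open>x_powers_independent\<close>. Adjoining \<open>x\<close> therefore raises the order of
  growth by at least one.\<close>

lemma dim_with_x:
  assumes X: "finite X" "X \<subseteq> kernel" and W: "fin_dim W" "1 \<in> W" "x \<in> W" "span X \<subseteq> W"
  shows "dim (space_power (span X) n) * (m + 1) \<le> dim (space_power W (n + m))"
proof -
  obtain G where G: "G \<subseteq> space_power (span X) n" "independent G" "space_power (span X) n \<subseteq> span G"
    "card G = dim (space_power (span X) n)" by (rule basis_exists)
  have finG: "finite G"
    using indep_card_le_dim(1)[OF fin_dim_space_power[OF fin_dim_span[OF X(1)]] G(1,2)] .
  have "insert 1 X \<subseteq> kernel" using X(2) kernel(2) by blast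
  then have "generated (insert 1 X) \<subseteq> kernel" by (rule generated_minimal[OF _ subalgebra_kernel])
  moreover have "space_power (span X) n \<subseteq> space_power (span (insert 1 X)) n"
    using space_power_subset_power[of "span X" "span (insert 1 X)" 1 n] span_mono[of X "insert 1 X"]
      space_power_base[of _ "span (insert 1 X)"] by fastforce
  ultimately have Gk: "G \<subseteq> kernel" using G(1) generatedI by blast
  have GW: "G \<subseteq> space_power W n"
    using G(1) space_power_subset_power[of "span X" W 1 n] W(4) space_power_base[of _ W] by fastforce
  let ?f = "\<lambda>(j, g). g * x ^ j"
  have "indep_mod {0} ({..m} \<times> G) ?f"
    unfolding indep_mod_def
  proof (intro allI impI)
    fix k assume "(\<Sum>i\<in>{..m} \<times> G. k i \<odot> ?f i) \<in> {0}"
    then have "0 = (\<Sum>i\<in>{..m} \<times> G. k i \<odot> ?f i)" by simp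
    also have "\<dots> = (\<Sum>j\<le>m. \<Sum>g\<in>G. k (j, g) \<odot> (g * x ^ j))"
      by (simp add: sum.cartesian_product split_def)
    also have "\<dots> = (\<Sum>j\<le>m. (\<Sum>g\<in>G. k (j, g) \<odot> g) * x ^ j)"
      by (simp add: sum_distrib_right scale_mult_left)
    finally have s: "(\<Sum>j\<le>m. (\<Sum>g\<in>G. k (j, g) \<odot> g) * x ^ j) = 0" by simp
    have "\<forall>j\<le>m. (\<Sum>g\<in>G. k (j, g) \<odot> g) = 0"
      using Gk by (intro x_powers_independent[OF _ s] subspace_sum subspace_scale kernel) auto
    then show "\<forall>i\<in>{..m} \<times> G. k i = 0"
      using independentD[OF G(2) finG subset_refl] by fastforce
  qed
  moreover have "?f i \<in> space_power W (n + m)" if ij: "i \<in> {..m} \<times> G" for i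
  proof -
    obtain j g where i: "i = (j, g)" "j \<le> m" "g \<in> G" using ij by auto
    have "g * x ^ j \<in> space_power W (n + j)"
      using GW i(3) by (intro space_power_mult power_in_space_power W) auto
    then show ?thesis using space_power_mono[OF W(2), of "n + j" "n + m"] i by auto
  qed
  ultimately have "card ({..m} \<times> G) \<le> dim (space_power W (n + m))"
    using finG by (intro indep_card_le[of _ _ ?f] fin_dim_space_power W subspace_space_power) auto
  then show ?thesis using G(4) by (simp add: card_cartesian_product algebra_simps)
qed

lemma generating_span:
  obtains S where "finite S" "generating_space (span S)"
proof -
  obtain V where V: "generating_space V" using ex_generating_space[OF fg] by blast
  then obtain S where "finite S" "V = span S" by (auto simp: generating_space_def fin_dim_def)
  then show ?thesis using that V by blast
qed

text \<open>Otherwise 2 n factors from \<open>X\<close> and 2 n factors \<open>x\<close> produce at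
  least (n + 1)^2 (2 n + 1) dimensions in the 4 n-th power of a generating space, which is cubic
  growth.\<close>

lemma kernel_subquadratic:
  assumes X: "finite X" "1 \<in> X" "X \<subseteq> kernel"
  shows "\<exists>n. dim (space_power (span X) (2 * n)) < (n + 1) ^ 2"
proof (rule ccontr)
  assume no: "\<not> ?thesis"
  obtain S where S: "finite S" "generating_space (span S)" by (rule generating_span)
  define U where "U = S \<union> X \<union> {x}"
  have U: "finite U" "1 \<in> U" "x \<in> U" "X \<subseteq> U" "S \<subseteq> U" using S X by (auto simp: U_def)
  let ?W = "span U"
  have "subalgebra hull (span S) \<subseteq> subalgebra hull ?W"
    using span_mono[OF U(5)] by (rule hull_mono)
  then have gen: "generating_space ?W"
    using S(2) U by (auto simp: generating_space_def generates_def intro: fin_dim_span span_base)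
  have "growth_exponent ?W < 3" using GK GKdim_eq[OF gen] by simp
  then obtain \<alpha> where \<alpha>: "growth_exponent ?W < ereal \<alpha>" "ereal \<alpha> < 3" using ereal_dense2 by blast
  then have \<alpha>3: "\<alpha> < 3" by simp
  have ev: "eventually (\<lambda>n. ereal (ln (real (dim (space_power ?W n))) / ln (real n)) < ereal \<alpha>) sequentially"
    using \<alpha>(1) unfolding growth_exponent_def by (rule Limsup_lessD)
  have "filterlim (\<lambda>n::nat. 4 * n) at_top sequentially"
    by (intro filterlim_subseq) (auto simp: strict_mono_def)
  from eventually_compose_filterlim[OF ev this]
  have ev4: "eventually (\<lambda>n. ln (real (dim (space_power ?W (4 * n)))) / ln (real (4 * n)) < \<alpha>) sequentially"
    by simp
  \<comment> \<open>The gap between \<alpha> and 3 absorbs the constant that comes from evaluating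
    the growth at 4 n.\<close>
  have "filterlim (\<lambda>n. (3 - \<alpha>) * ln (real n) - \<alpha> * ln 4) at_top sequentially"
    using \<alpha>3 by real_asymp
  then have "eventually (\<lambda>n. (3 - \<alpha>) * ln (real n) - \<alpha> * ln 4 > 0) sequentially"
    unfolding filterlim_at_top_dense by blast
  then have "eventually (\<lambda>n::nat. False) sequentially"
    using ev4 eventually_gt_at_top[of 1]
  proof eventually_elim
    case (elim n)
    have "(n + 1) ^ 2 * (2 * n + 1) \<le> dim (space_power (span X) (2 * n)) * (2 * n + 1)"
      using no by (intro mult_right_mono) (auto simp: not_less)
    also have "\<dots> \<le> dim (space_power ?W (2 * n + 2 * n))"
      using U X by (intro dim_with_x) (auto intro: fin_dim_span span_base span_mono[THEN subsetD])
    finally have "(n + 1) ^ 2 * (2 * n + 1) \<le> dim (space_power ?W (4 * n))" by (simp del: space_power.simps)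
    moreover have "n ^ 2 * n \<le> (n + 1) ^ 2 * (2 * n + 1)" by (intro mult_mono power_mono) auto
    ultimately have "n ^ 3 \<le> dim (space_power ?W (4 * n))" by (simp add: power3_eq_cube power2_eq_square)
    then have "real (n ^ 3) \<le> real (dim (space_power ?W (4 * n)))" by (rule of_nat_mono)
    then have "ln (real (n ^ 3)) \<le> ln (real (dim (space_power ?W (4 * n))))"
      using elim(3) by (intro ln_mono) (auto intro: less_le_trans[rotated])
    also have "\<dots> < \<alpha> * ln (real (4 * n))" using elim by (simp add: divide_less_eq split: if_splits)
    also have "\<dots> = \<alpha> * ln 4 + \<alpha> * ln (real n)" using elim(3) by (simp add: ln_mult distrib_left)
    finally have "3 * ln (real n) < \<alpha> * ln 4 + \<alpha> * ln (real n)" using elim(3) by (simp add: ln_realpow)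
    then show ?case using elim(1) by (simp add: algebra_simps)
  qed
  then show False by simp
qed

section \<open>Expansions in powers of the slice\<close>

lemma kernel_commute: "a \<in> kernel \<Longrightarrow> b \<in> kernel \<Longrightarrow> a * b = b * a"
  by (rule subquadratic_commutative[OF subalgebra_kernel _ _ kernel_subquadratic])

text \<open>Subtracting the leading term lowers the order of nilpotency: with \<beta> the last
  nonvanishing derivative, \<beta> x^(i+1) and (i+1)! c^(i+1) a have the same derivative of order i
  + 1. That \<beta> commutes with \<open>c\<close> uses the commutativity of the kernel.\<close>

lemma kernel_expansion:
  assumes "(\<delta> ^^ Suc i) a = 0"
  shows "\<exists>N b. (\<forall>j\<le>i. b j \<in> kernel) \<and> c ^ N * a = (\<Sum>j\<le>i. b j * x ^ j)"
  using assms
proof (induction i arbitrary: a)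
  case 0
  then show ?case by (intro exI[of _ 0] exI[of _ "\<lambda>_. a"]) (simp add: kernel_def)
next
  case (Suc i)
  define \<beta> where "\<beta> = (\<delta> ^^ Suc i) a"
  have \<beta>: "\<beta> \<in> kernel" using Suc.prems by (simp add: \<beta>_def kernel_def)
  define a' where "a' = fact (Suc i) \<odot> (c ^ Suc i * a) - \<beta> * x ^ Suc i"
  have cp: "c ^ n \<in> kernel" for n by (rule power_kernel[OF kernel(4)])
  have "(\<delta> ^^ Suc i) a' = fact (Suc i) \<odot> (c ^ Suc i * \<beta>) - \<beta> * (fact (Suc i) \<odot> c ^ Suc i)"
    unfolding a'_def funpow_delta_diff funpow_delta_scale funpow_delta_kernel_mult[OF cp]
      funpow_delta_kernel_mult[OF \<beta>] using funpow_delta_x_power[of "Suc i"] by (simp only: \<beta>_def)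
  also have "\<dots> = 0" using kernel_commute[OF cp \<beta>, of "Suc i"] by (simp only: scale_mult_right) simp
  finally obtain N b where b: "\<forall>j\<le>i. b j \<in> kernel" "c ^ N * a' = (\<Sum>j\<le>i. b j * x ^ j)"
    using Suc.IH by blast
  let ?f = "fact (Suc i) :: 'k"
  define b' where "b' j = inverse ?f \<odot> (if j = Suc i then c ^ N * \<beta> else b j)" for j
  have "c ^ N * a' = ?f \<odot> (c ^ (N + Suc i) * a) - c ^ N * \<beta> * x ^ Suc i"
    by (simp only: a'_def right_diff_distrib scale_mult_right power_add mult.assoc)
  then have "?f \<odot> (c ^ (N + Suc i) * a) = (\<Sum>j\<le>i. b j * x ^ j) + c ^ N * \<beta> * x ^ Suc i"
    using b(2) by simp
  then have "c ^ (N + Suc i) * a = inverse ?f \<odot> ((\<Sum>j\<le>i. b j * x ^ j) + c ^ N * \<beta> * x ^ Suc i)"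
    by (metis (no_types, lifting) fact_nonzero left_inverse scale_scale scale_one)
  also have "\<dots> = (\<Sum>j\<le>Suc i. b' j * x ^ j)"
    by (simp add: b'_def scale_mult_left scale_sum_right scale_right_distrib del: fact_Suc power_Suc)
  finally have "c ^ (N + Suc i) * a = (\<Sum>j\<le>Suc i. b' j * x ^ j)" .
  moreover have "\<forall>j\<le>Suc i. b' j \<in> kernel"
    using b(1) \<beta> cp kernel unfolding b'_def by (auto intro!: subspace_scale[OF kernel(1)])
  ultimately show ?case by blast
qed

lemma kernel_expansion_finite:
  assumes "finite S"
  shows "\<exists>N d b. \<forall>s\<in>S. (\<forall>j\<le>d. b s j \<in> kernel) \<and> c ^ N * s = (\<Sum>j\<le>d. b s j * x ^ j)"
proof -
  have "\<exists>i N b. (\<forall>j\<le>i. b j \<in> kernel) \<and> c ^ N * s = (\<Sum>j\<le>i. b j * x ^ j)" for s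
  proof -
    obtain n where "(\<delta> ^^ n) s = 0" using nilpotent by (auto simp: locally_nilpotent_def)
    then have "(\<delta> ^^ Suc n) s = 0" by (simp add: delta_0)
    then show ?thesis using kernel_expansion by blast
  qed
  then obtain i N b where b: "\<And>s. (\<forall>j\<le>i s. b s j \<in> kernel) \<and> c ^ N s * s = (\<Sum>j\<le>i s. b s j * x ^ j)"
    by metis
  define d where "d = Max (insert 0 (i ` S))"
  define M where "M = Max (insert 0 (N ` S))"
  define b' where "b' s j = (if j \<le> i s then c ^ (M - N s) * b s j else 0)" for s j
  have "(\<forall>j\<le>d. b' s j \<in> kernel) \<and> c ^ M * s = (\<Sum>j\<le>d. b' s j * x ^ j)" if s: "s \<in> S" for s
  proof
    show "\<forall>j\<le>d. b' s j \<in> kernel"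
      using b kernel(3)[OF power_kernel[OF kernel(4)]] subspace_0[OF kernel(1)] by (auto simp: b'_def)
    have le: "i s \<le> d" "N s \<le> M" using assms s by (auto simp: d_def M_def intro!: Max_ge)
    have "c ^ M * s = c ^ (M - N s) * (c ^ N s * s)" using le(2) by (simp add: mult.assoc[symmetric] power_add[symmetric])
    also have "\<dots> = (\<Sum>j\<le>i s. b' s j * x ^ j)"
      using b[of s] by (simp add: sum_distrib_left b'_def mult.assoc)
    also have "\<dots> = (\<Sum>j\<le>d. b' s j * x ^ j)"
      using le(1) by (intro sum.mono_neutral_left) (auto simp: b'_def)
    finally show "c ^ M * s = (\<Sum>j\<le>d. b' s j * x ^ j)" .
  qed
  then show ?thesis by blast
qed

text \<open>Here \<open>c\<close> is a nonzero scalar, so the expansions show that the powers of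
  \<open>x\<close> span the algebra and the growth is linear. The quadratic bound is stated to match
  \<open>growth_nontrivial_kernel\<close>.\<close>

lemma growth_trivial_kernel:
  assumes S: "finite S" "1 \<in> span S" and triv: "kernel \<subseteq> scalars"
  shows "\<exists>K. \<forall>n. dim (space_power (span S) n) \<le> K * (n + 1) ^ 2"
proof -
  let ?X = "\<lambda>d. span ((\<lambda>j. x ^ j) ` {..d})"
  obtain N d b where b: "\<forall>s\<in>S. (\<forall>j\<le>d. b s j \<in> kernel) \<and> c ^ N * s = (\<Sum>j\<le>d. b s j * x ^ j)"
    using kernel_expansion_finite[OF S(1)] by blast
  have "c ^ N \<in> scalars" using power_kernel[OF kernel(4)] triv by blast
  then obtain g where g: "c ^ N = g \<odot> 1" by (auto simp: scalars_def)
  have g0: "g \<noteq> 0" using g slice(3) by auto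
  have SX: "s \<in> ?X d" if s: "s \<in> S" for s
  proof -
    have "b s j * x ^ j \<in> ?X d" if "j \<le> d" for j
    proof -
      have "b s j \<in> scalars" using b s that triv by blast
      then obtain h where "b s j = h \<odot> 1" by (auto simp: scalars_def)
      then have "b s j * x ^ j = h \<odot> x ^ j" by (simp add: scale_mult_left)
      then show ?thesis using that by (auto intro: span_scale span_base)
    qed
    then have "(\<Sum>j\<le>d. b s j * x ^ j) \<in> ?X d" by (intro span_sum) auto
    then have "g \<odot> s \<in> ?X d" using b s g by (metis scale_mult_left mult_1)
    from span_scale[OF this, of "inverse g"] show ?thesis using g0 by simp
  qed
  have XX: "a * a' \<in> ?X (m + n)" if "a \<in> ?X m" "a' \<in> ?X n" for a a' m n
  proof -
    have "{y * y' |y y'. y \<in> (\<lambda>j. x ^ j) ` {..m} \<and> y' \<in> (\<lambda>j. x ^ j) ` {..n}} \<subseteq> (\<lambda>j. x ^ j) ` {..m + n}"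
      by (auto simp: power_add[symmetric])
    then show ?thesis using span_mult_span[OF that] span_mono by blast
  qed
  have "space_power (span S) n \<subseteq> ?X (d * n)" for n
  proof (induction n)
    case 0
    then show ?case by simp
  next
    case (Suc n)
    have "span S \<subseteq> ?X d" using SX by (intro span_minimal) auto
    then show ?case using Suc XX[of _ "d * n" _ d] unfolding space_power.simps(2)
      by (intro span_minimal) (auto simp: add.commute)
  qed
  then have "dim (space_power (span S) n) \<le> card ((\<lambda>j. x ^ j) ` {..d * n})" for n
    by (intro dim_le_card) auto
  also have "card ((\<lambda>j. x ^ j) ` {..d * n}) \<le> (d + 1) * (n + 1) ^ 2" for n
  proof -
    have "card ((\<lambda>j. x ^ j) ` {..d * n}) \<le> d * n + 1" using card_image_le[of "{..d * n}" "\<lambda>j. x ^ j"] by simp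
    also have "\<dots> \<le> (d + 1) * (n + 1) ^ 2" by (simp add: power2_eq_square algebra_simps)
    finally show ?thesis .
  qed
  finally show ?thesis by blast
qed

section \<open>The derivation \<open>ad\<close> of the kernel and relations over k[z]\<close>

definition ad :: "'a \<Rightarrow> 'a" where "ad b = x * b - b * x"

text \<open>The derivative of x b - b x is c b - b c, which is zero because the kernel is
  commutative.\<close>

lemma ad_kernel: "b \<in> kernel \<Longrightarrow> ad b \<in> kernel"
  using slice kernel_commute[of c b] kernel(4)
  by (simp add: ad_def kernel_def delta_diff delta_mult)

lemma ad_add: "ad (a + b) = ad a + ad b"
  and ad_scale: "ad (k \<odot> a) = k \<odot> ad a"
  and ad_mult: "ad (a * b) = ad a * b + a * ad b"
  and ad_0: "ad 0 = 0" and ad_1: "ad 1 = 0"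
  by (simp_all add: ad_def algebra_simps scale_right_diff_distrib scale_mult_left scale_mult_right)

lemma ad_sum: "ad (\<Sum>i\<in>A. f i) = (\<Sum>i\<in>A. ad (f i))"
  by (induction A rule: infinite_finite_induct) (auto simp: ad_add ad_0)

lemma ad_power:
  assumes "y \<in> kernel" shows "ad (y ^ Suc n) = of_nat (Suc n) \<odot> (y ^ n * ad y)"
proof (induction n)
  case (Suc n)
  have "ad (y ^ Suc (Suc n)) = ad y * y ^ Suc n + y * ad (y ^ Suc n)" by (simp only: power_Suc ad_mult)
  also have "ad y * y ^ Suc n = y ^ Suc n * ad y"
    by (rule kernel_commute[OF ad_kernel[OF assms] power_kernel[OF assms]])
  also have "y * ad (y ^ Suc n) = of_nat (Suc n) \<odot> (y ^ Suc n * ad y)"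
    unfolding Suc.IH by (simp add: scale_mult_right mult.assoc)
  also have "y ^ Suc n * ad y + of_nat (Suc n) \<odot> (y ^ Suc n * ad y) = of_nat (Suc (Suc n)) \<odot> (y ^ Suc n * ad y)"
    by (subst (2) of_nat_Suc, subst scale_left_distrib) simp
  finally show ?case .
qed simp

lemma ad_peval:
  assumes z: "z \<in> kernel" shows "ad (peval z p) = peval z (pderiv p) * ad z"
proof (induction p)
  case 0
  then show ?case by (simp add: ad_0)
next
  case (pCons a p)
  have "ad (peval z (pCons a p)) = ad z * peval z p + z * (peval z (pderiv p) * ad z)"
    by (simp add: peval_pCons ad_add ad_scale ad_1 ad_mult pCons.IH)
  also have "ad z * peval z p = peval z p * ad z"
    by (rule kernel_commute[OF ad_kernel[OF z] peval_in_subalgebra[OF subalgebra_kernel z]])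
  also have "peval z p * ad z + z * (peval z (pderiv p) * ad z) = peval z (pderiv (pCons a p)) * ad z"
    by (simp add: pderiv_pCons peval_add peval_pCons algebra_simps)
  finally show ?case .
qed

text \<open>Least degree in \<open>y\<close> is what later forces the formal derivative in
  \<open>y\<close>, and for nonzero \<open>y\<close> the constant term, to be nonzero.\<close>

lemma minimal_relation:
  assumes z: "z \<in> kernel" "z \<notin> scalars" and y: "y \<in> kernel"
  obtains n p where "(\<Sum>i\<le>Suc n. peval z (p i) * y ^ i) = 0" "p (Suc n) \<noteq> 0"
    "\<forall>p'. (\<Sum>i\<le>n. peval z (p' i) * y ^ i) = 0 \<longrightarrow> (\<forall>i\<le>n. p' i = 0)"
proof -
  define R where "R n p \<longleftrightarrow> (\<Sum>i\<le>n. peval z (p i) * y ^ i) = 0 \<and> (\<exists>i\<le>n. p i \<noteq> 0)" for n p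
  obtain m where m: "dim (space_power (span {1, z, y}) (2 * m)) < (m + 1) ^ 2"
    using kernel_subquadratic[of "{1, z, y}"] z y kernel by auto
  define L where "L = (LEAST n. \<exists>p. R n p)"
  have "\<exists>n p. R n p" unfolding R_def by (rule poly_relation[OF z(2) m])
  then have "\<exists>p. R L p" unfolding L_def by (rule LeastI_ex)
  then obtain p where p: "R L p" by blast
  have least: "\<not> R k p" if "k < L" for k p
    using not_less_Least[OF that[unfolded L_def]] by blast
  have "L \<noteq> 0"
  proof
    assume "L = 0"
    then show False using p peval_eq_0_iff[OF z(2), of "p 0"] by (simp add: R_def)
  qed
  then obtain n where n: "L = Suc n" using not0_implies_Suc by blast
  have "p (Suc n) \<noteq> 0"
  proof
    assume "p (Suc n) = 0"
    then have "R n p" using p unfolding n R_def by (auto simp: le_Suc_eq)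
    then show False using least n by simp
  qed
  then show ?thesis using p least[of n] unfolding n R_def by (intro that[of p n]) auto
qed

text \<open>The minimal relation reads p_0(z) + h y = 0, and p_0 = 0 would leave the shorter
  relation h = 0. So every nonzero element of the kernel can be inverted at the price of a
  denominator in k[z].\<close>

lemma poly_multiple:
  assumes z: "z \<in> kernel" "z \<notin> scalars" and y: "y \<in> kernel" "y \<noteq> 0"
  obtains h q where "h \<in> generated {1, z, y}" "q \<noteq> 0" "h * y = peval z q"
proof -
  obtain n p where p: "(\<Sum>i\<le>Suc n. peval z (p i) * y ^ i) = 0" "p (Suc n) \<noteq> 0"
    "\<forall>p'. (\<Sum>i\<le>n. peval z (p' i) * y ^ i) = 0 \<longrightarrow> (\<forall>i\<le>n. p' i = 0)"
    using minimal_relation[OF z y(1)] .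
  define h where "h = (\<Sum>i\<le>n. peval z (p (Suc i)) * y ^ i)"
  have "(\<Sum>i\<le>Suc n. peval z (p i) * y ^ i) = peval z (p 0) + h * y"
    unfolding sum.atMost_Suc_shift h_def
    by (simp add: sum_distrib_right mult.assoc power_commutes[symmetric])
  then have "peval z (p 0) + h * y = 0" using p(1) by (simp only:)
  then have hy: "- h * y = peval z (p 0)" by (simp add: add_eq_0_iff)
  have "p 0 \<noteq> 0"
  proof
    assume "p 0 = 0"
    then have "h = 0" using hy y(2) by simp
    then have "p (Suc n) = 0" using p(3)[rule_format, of "\<lambda>i. p (Suc i)" n] by (simp add: h_def)
    then show False using p(2) by simp
  qed
  have alg: "subalgebra (generated {1, z, y})" by (rule subalgebra_generated) simp
  have "h \<in> generated {1, z, y}"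
    unfolding h_def using alg peval_in_subalgebra[OF alg generated_base] power_in_subalgebra[OF alg generated_base]
    by (intro subspace_sum) (auto simp: subalgebra_def)
  then have "- h \<in> generated {1, z, y}" using alg subspace_neg by (auto simp: subalgebra_def)
  then show ?thesis using that hy \<open>p 0 \<noteq> 0\<close> by blast
qed

text \<open>Applying \<open>ad\<close> to the minimal relation gives g + h ad y = 0, where h is the
  formal derivative in \<open>y\<close>; it is nonzero by minimality and characteristic 0.
  \<open>poly_multiple\<close> then exchanges the denominator h for one in k[z].\<close>

lemma ad_multiple:
  assumes z: "z \<in> kernel" "z \<notin> scalars" and y: "y \<in> kernel"
  obtains q where "q \<noteq> 0" "peval z q * ad y \<in> generated {1, z, ad z, y}"
proof -
  obtain n p where p: "(\<Sum>i\<le>Suc n. peval z (p i) * y ^ i) = 0" "p (Suc n) \<noteq> 0"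
    "\<forall>p'. (\<Sum>i\<le>n. peval z (p' i) * y ^ i) = 0 \<longrightarrow> (\<forall>i\<le>n. p' i = 0)"
    using minimal_relation[OF z y(1)] .
  let ?H = "generated {1, z, ad z, y}"
  have alg: "subalgebra ?H" by (rule subalgebra_generated) simp
  have H: "subspace ?H" "\<And>a b. a \<in> ?H \<Longrightarrow> b \<in> ?H \<Longrightarrow> a * b \<in> ?H" "y \<in> ?H" "z \<in> ?H" "ad z \<in> ?H" "1 \<in> ?H"
    using alg generated_base[of _ "{1, z, ad z, y}"] by (auto simp: subalgebra_def)
  have Hk: "?H \<subseteq> kernel"
    using z y ad_kernel kernel by (intro generated_minimal subalgebra_kernel) auto
  define h where "h = (\<Sum>i\<le>n. peval z (Polynomial.smult (of_nat (Suc i)) (p (Suc i))) * y ^ i)"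
  define g where "g = (\<Sum>i\<le>Suc n. peval z (pderiv (p i)) * ad z * y ^ i)"
  have hH: "h \<in> ?H" unfolding h_def
    by (intro subspace_sum H peval_in_subalgebra[OF alg] power_in_subalgebra[OF alg])
  have gH: "g \<in> ?H" unfolding g_def
    by (intro subspace_sum H peval_in_subalgebra[OF alg] power_in_subalgebra[OF alg])
  have "h \<noteq> 0"
  proof
    assume "h = 0"
    then have "\<forall>i\<le>n. Polynomial.smult (of_nat (Suc i)) (p (Suc i)) = 0"
      using p(3)[THEN spec, of "\<lambda>i. Polynomial.smult (of_nat (Suc i)) (p (Suc i))"] unfolding h_def by blast
    then show False using p(2) by (auto simp del: of_nat_Suc)
  qed
  have "0 = ad (\<Sum>i\<le>Suc n. peval z (p i) * y ^ i)" using p(1) by (simp only: ad_0)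
  also have "\<dots> = g + (\<Sum>i\<le>Suc n. peval z (p i) * ad (y ^ i))"
    unfolding ad_sum g_def by (simp only: ad_mult ad_peval[OF z(1)] sum.distrib)
  also have "(\<Sum>i\<le>Suc n. peval z (p i) * ad (y ^ i)) = (\<Sum>i\<le>n. peval z (p (Suc i)) * ad (y ^ Suc i))"
    unfolding sum.atMost_Suc_shift by (simp add: ad_1 del: power_Suc)
  also have "\<dots> = h * ad y"
    unfolding h_def sum_distrib_right
    by (intro sum.cong refl) (simp only: ad_power[OF y] peval_smult scale_mult_left scale_mult_right mult.assoc)
  finally have "g + h * ad y = 0" by (rule sym)
  then have hy: "h * ad y = - g" by (simp only: add_eq_0_iff)
  obtain k q where k: "k \<in> generated {1, z, h}" "q \<noteq> 0" "k * h = peval z q"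
    using poly_multiple[OF z _ \<open>h \<noteq> 0\<close>] hH Hk by blast
  have "generated {1, z, h} \<subseteq> ?H" using H hH by (intro generated_minimal alg) auto
  then have "k * (h * ad y) \<in> ?H" using k(1) hy gH H subspace_neg[OF H(1)] by auto
  then have "peval z q * ad y \<in> ?H" using k(3) by (simp add: mult.assoc[symmetric])
  then show ?thesis using that k(2) by blast
qed

end

section \<open>The quadratic upper bound\<close>

context nilpotent_derivation
begin

definition skew_span :: "'a \<Rightarrow> nat \<Rightarrow> (nat \<Rightarrow> 'a) \<Rightarrow> nat \<Rightarrow> nat \<Rightarrow> 'a set" where
  "skew_span z r e m d = {\<Sum>j\<le>m. f j * x ^ j | f. \<forall>j\<le>m. f j \<in> poly_span z r e d}"

lemma skew_spanI:
  "(\<And>j. j \<le> m \<Longrightarrow> f j \<in> poly_span z r e d) \<Longrightarrow> (\<Sum>j\<le>m. f j * x ^ j) \<in> skew_span z r e m d"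
  unfolding skew_span_def by blast

lemma skew_spanE:
  assumes "y \<in> skew_span z r e m d"
  obtains f where "y = (\<Sum>j\<le>m. f j * x ^ j)" "\<forall>j\<le>m. f j \<in> poly_span z r e d"
  using assms unfolding skew_span_def by blast

lemma subspace_skew_span: "subspace (skew_span z r e m d)"
  unfolding subspace_def
proof (intro conjI ballI allI)
  show "0 \<in> skew_span z r e m d"
    using skew_spanI[of m "\<lambda>_. 0" z r e d] subspace_0[OF subspace_poly_span] by simp
next
  fix a b assume a: "a \<in> skew_span z r e m d" and b: "b \<in> skew_span z r e m d"
  obtain f where f: "a = (\<Sum>j\<le>m. f j * x ^ j)" "\<forall>j\<le>m. f j \<in> poly_span z r e d" using a by (rule skew_spanE)
  obtain g where g: "b = (\<Sum>j\<le>m. g j * x ^ j)" "\<forall>j\<le>m. g j \<in> poly_span z r e d" using b by (rule skew_spanE)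
  have "a + b = (\<Sum>j\<le>m. (f j + g j) * x ^ j)" by (simp add: f g distrib_right sum.distrib)
  also have "\<dots> \<in> skew_span z r e m d"
    using f g subspace_add[OF subspace_poly_span] by (intro skew_spanI) auto
  finally show "a + b \<in> skew_span z r e m d" .
next
  fix k a assume a: "a \<in> skew_span z r e m d"
  obtain f where f: "a = (\<Sum>j\<le>m. f j * x ^ j)" "\<forall>j\<le>m. f j \<in> poly_span z r e d" using a by (rule skew_spanE)
  have "k \<odot> a = (\<Sum>j\<le>m. (k \<odot> f j) * x ^ j)" by (simp add: f scale_mult_left scale_sum_right)
  also have "\<dots> \<in> skew_span z r e m d"
    using f subspace_scale[OF subspace_poly_span] by (intro skew_spanI) auto
  finally show "k \<odot> a \<in> skew_span z r e m d" .
qed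

lemma skew_span_mono:
  assumes "m \<le> m'" "d \<le> d'" shows "skew_span z r e m d \<subseteq> skew_span z r e m' d'"
proof
  fix a assume "a \<in> skew_span z r e m d"
  then obtain f where f: "a = (\<Sum>j\<le>m. f j * x ^ j)" "\<forall>j\<le>m. f j \<in> poly_span z r e d"
    by (rule skew_spanE)
  have "a = (\<Sum>j\<le>m'. (if j \<le> m then f j else 0) * x ^ j)"
    unfolding f(1) using assms(1) by (intro sum.mono_neutral_cong_left) auto
  also have "\<dots> \<in> skew_span z r e m' d'"
    using f(2) subspace_0[OF subspace_poly_span]
    by (intro skew_spanI) (auto intro: poly_span_mono[OF assms(2), THEN subsetD])
  finally show "a \<in> skew_span z r e m' d'" .
qed

lemma skew_span_left_mult:
  assumes "a \<in> skew_span z r e m d" "\<And>f. f \<in> poly_span z r e d \<Longrightarrow> b * f \<in> poly_span z r e d'"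
  shows "b * a \<in> skew_span z r e m d'"
proof -
  obtain f where f: "a = (\<Sum>j\<le>m. f j * x ^ j)" "\<forall>j\<le>m. f j \<in> poly_span z r e d"
    using assms(1) by (rule skew_spanE)
  have "b * a = (\<Sum>j\<le>m. (b * f j) * x ^ j)" by (simp add: f sum_distrib_left mult.assoc)
  also have "\<dots> \<in> skew_span z r e m d'" using f(2) assms(2) by (intro skew_spanI) auto
  finally show ?thesis .
qed

lemma dim_skew_span:
  "fin_dim (skew_span z r e m d)" "dim (skew_span z r e m d) \<le> (m + 1) * (r * (d + 1))"
proof -
  let ?I = "{..m} \<times> {..<r} \<times> {..d}"
  let ?h = "\<lambda>(j, i, l). z ^ l * e i * x ^ j"
  have sub: "skew_span z r e m d \<subseteq> span (?h ` ?I)"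
  proof
    fix a assume "a \<in> skew_span z r e m d"
    then obtain f where f: "a = (\<Sum>j\<le>m. f j * x ^ j)" "\<forall>j\<le>m. f j \<in> poly_span z r e d"
      by (rule skew_spanE)
    have "f j * x ^ j \<in> span (?h ` ?I)" if j: "j \<le> m" for j
    proof -
      have "f j \<in> span ((\<lambda>(i, l). z ^ l * e i) ` ({..<r} \<times> {..d}))"
        using f(2) j poly_span_subset_span by blast
      then show ?thesis
      proof (induction rule: span_induct_alt)
        case base
        then show ?case by (simp add: span_zero)
      next
        case (step k y w)
        then obtain i l where il: "i < r" "l \<le> d" "y = z ^ l * e i" by auto
        have "y * x ^ j \<in> ?h ` ?I" using il j by (intro image_eqI[of _ _ "(j, i, l)"]) auto
        then show ?case using step(2) by (simp add: distrib_right scale_mult_left span_add span_scale span_base)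
      qed
    qed
    then show "a \<in> span (?h ` ?I)" unfolding f(1) by (intro span_sum) auto
  qed
  show "fin_dim (skew_span z r e m d)"
    by (rule fin_dim_subspace[OF fin_dim_span sub subspace_skew_span]) simp
  have "dim (skew_span z r e m d) \<le> card (?h ` ?I)" by (rule dim_le_card[OF sub]) simp
  also have "\<dots> \<le> card ?I" by (rule card_image_le) simp
  finally show "dim (skew_span z r e m d) \<le> (m + 1) * (r * (d + 1))"
    by (simp add: card_cartesian_product)
qed

text \<open>Moving \<open>x\<close> past the m-th power of Q = q(z) produces m Q^(m - 1) ad Q. One
  of the two extra factors Q restores the m-th power in this term, the other clears the denominator
  of ad z. A factor \<open>x\<close> thus costs two denominators.\<close>

lemma x_peval_power:
  assumes z: "z \<in> kernel"
  shows "peval z q ^ (m + 2) * (x * a) = peval z q * (peval z q * (x * (peval z q ^ m * a)))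
    - of_nat m \<odot> (peval z (pderiv q) * (peval z q * (ad z * (peval z q ^ m * a))))"
proof -
  define Q where "Q = peval z q"
  define D where "D = peval z (pderiv q)"
  have k: "Q \<in> kernel" "D \<in> kernel" "ad z \<in> kernel"
    using peval_in_subalgebra[OF subalgebra_kernel z] ad_kernel[OF z] by (auto simp: Q_def D_def)
  have adQ: "ad Q = D * ad z" unfolding Q_def D_def by (rule ad_peval[OF z])
  have Qx: "Q ^ m * x = x * Q ^ m - ad (Q ^ m)" for m by (simp add: ad_def)
  have QQ: "Q * (Q * ad (Q ^ m)) = of_nat m \<odot> (D * (Q * (ad z * Q ^ m)))"
  proof (cases m)
    case 0
    then show ?thesis by (simp add: ad_1)
  next
    case (Suc l)
    have "Q * (Q * (Q ^ l * (D * ad z))) = D * (Q * (ad z * Q ^ Suc l))"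
    proof -
      have 1: "Q * Q ^ l * D = D * (Q * Q ^ l)"
        by (intro kernel_commute kernel power_kernel k)
      have 2: "Q * Q ^ l * ad z = ad z * (Q * Q ^ l)"
        by (intro kernel_commute kernel power_kernel k)
      have 3: "Q * D = D * Q" by (rule kernel_commute[OF k(1,2)])
      have "Q * (Q * (Q ^ l * (D * ad z))) = Q * (Q * Q ^ l * D) * ad z" by (simp only: mult.assoc)
      also have "\<dots> = (Q * D) * (Q * Q ^ l * ad z)" unfolding 1 by (simp only: mult.assoc)
      also have "\<dots> = D * (Q * (ad z * Q ^ Suc l))" unfolding 2 3 by (simp only: mult.assoc power_Suc)
      finally show ?thesis .
    qed
    then show ?thesis unfolding Suc ad_power[OF k(1)] adQ by (simp only: scale_mult_right)
  qed
  have "Q ^ (m + 2) * (x * a) = Q * (Q * (Q ^ m * x * a))" by (simp add: mult.assoc)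
  also have "\<dots> = Q * (Q * (x * (Q ^ m * a))) - Q * (Q * ad (Q ^ m)) * a"
    unfolding Qx by (simp add: algebra_simps)
  also have "Q * (Q * ad (Q ^ m)) * a = of_nat m \<odot> (D * (Q * (ad z * (Q ^ m * a))))"
    unfolding QQ by (simp only: scale_mult_left mult.assoc)
  finally show ?thesis unfolding Q_def D_def .
qed

text \<open>\<open>Y m\<close> consists of the elements of degree at most \<open>m\<close> in \<open>x\<close> whose coefficients have
  denominator \<open>q ^ m\<close> and numerators of degree \<open>O(m)\<close>; multiplication by a generator of the algebra
  raises \<open>m\<close> by a bounded amount.\<close>

lemma growth_nontrivial_kernel:
  assumes S: "finite S" "1 \<in> span S" and z: "z \<in> kernel" "z \<notin> scalars"
  shows "\<exists>K. \<forall>n. dim (space_power (span S) n) \<le> K * (n + 1) ^ 2"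
proof -
  obtain N d b where b: "\<forall>s\<in>S. (\<forall>j\<le>d. b s j \<in> kernel) \<and> c ^ N * s = (\<Sum>j\<le>d. b s j * x ^ j)"
    using kernel_expansion_finite[OF S(1)] by blast
  \<comment> \<open>Multiplication by c'^N turns the denominator c^N of the expansions into the
    polynomial \<open>q1\<close> in z.\<close>
  obtain c' qc where c': "c' \<in> generated {1, z, c}" "qc \<noteq> 0" "c' * c = peval z qc"
    using poly_multiple[OF z kernel(4) slice(3)] .
  have "generated {1, z, c} \<subseteq> kernel" using z kernel by (intro generated_minimal subalgebra_kernel) auto
  then have c'k: "c' \<in> kernel" using c'(1) by blast
  define q1 where "q1 = qc ^ N"
  define \<beta> where "\<beta> s j = c' ^ N * b s j" for s j
  have \<beta>k: "\<beta> s j \<in> kernel" if "s \<in> S" "j \<le> d" for s j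
    unfolding \<beta>_def using b that by (intro kernel power_kernel c'k) auto
  have \<beta>: "peval z q1 * s = (\<Sum>j\<le>d. \<beta> s j * x ^ j)" if "s \<in> S" for s
  proof -
    have "(c' * c) ^ N = c' ^ N * c ^ N"
    proof (induction N)
      case (Suc N)
      have "c' * c * (c' ^ N * c ^ N) = c' * (c * c' ^ N) * c ^ N" by (simp only: mult.assoc)
      also have "c * c' ^ N = c' ^ N * c" by (intro kernel_commute kernel(4) power_kernel c'k)
      finally show ?case using Suc.IH by (simp add: mult.assoc)
    qed simp
    then have "peval z q1 = c' ^ N * c ^ N" by (simp add: q1_def peval_power c'(3))
    then have "peval z q1 * s = c' ^ N * (c ^ N * s)" by (simp add: mult.assoc)
    then show ?thesis using b that by (simp add: sum_distrib_left \<beta>_def mult.assoc)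
  qed
  \<comment> \<open>Beside the coefficients of the generators, \<open>ad z\<close> is included
    because it arises when \<open>x\<close> passes a polynomial in z.\<close>
  define G where "G = {1, z, ad z} \<union> (\<lambda>(s, j). \<beta> s j) ` (S \<times> {..d})"
  have G: "finite G" "1 \<in> G" "z \<in> G" "ad z \<in> G" "\<And>s j. s \<in> S \<Longrightarrow> j \<le> d \<Longrightarrow> \<beta> s j \<in> G" "G \<subseteq> kernel"
    using S(1) z(1) kernel(2) ad_kernel[OF z(1)] \<beta>k by (auto simp: G_def)
  note algG = subalgebra_generated[OF G(2)]
  obtain n0 where "dim (space_power (span G) (2 * n0)) < (n0 + 1) ^ 2"
    using kernel_subquadratic[OF G(1,2,6)] by blast
  then obtain r e q0 C0 where e: "0 < r" "e 0 = 1" "poly_free z r e" "\<forall>i<r. e i \<in> generated G" and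
    q0: "q0 \<noteq> 0" "\<forall>n. \<forall>a\<in>space_power (span G) n. peval z (q0 ^ n) * a \<in> poly_span z r e (C0 * n)"
    using poly_basis[OF G(1,2,3) z(2)] by metis
  have GK: "generated G \<subseteq> kernel" by (rule generated_minimal[OF G(6) subalgebra_kernel])
  have dep: "poly_dep z r e a" if a: "a \<in> generated G" for a
  proof -
    obtain n where "a \<in> space_power (span G) n" using a by (auto simp: generated_def)
    moreover have "q0 ^ n \<noteq> 0" using q0(1) by simp
    ultimately show ?thesis using q0(2) unfolding poly_dep_def by blast
  qed
  \<comment> \<open>\<open>ad (e i)\<close> need not lie in the algebra generated by
    \<open>G\<close>, but by \<open>ad_multiple\<close> a nonzero polynomial multiple of it
    does.\<close>
  have dep_ad: "poly_dep z r e (ad (e i))" if i: "i < r" for i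
  proof -
    have eG: "e i \<in> generated G" using e(4) i by blast
    obtain q where q: "q \<noteq> 0" "peval z q * ad (e i) \<in> generated {1, z, ad z, e i}"
      using ad_multiple[OF z, of "e i"] eG GK by blast
    have "generated {1, z, ad z, e i} \<subseteq> generated G"
      using G generated_base eG by (intro generated_minimal algG) auto
    then obtain q' d where q': "q' \<noteq> 0" "peval z q' * (peval z q * ad (e i)) \<in> poly_span z r e d"
      using dep q(2) unfolding poly_dep_def by blast
    then have "peval z (q' * q) * ad (e i) \<in> poly_span z r e d" by (simp add: peval_mult mult.assoc)
    moreover have "q' * q \<noteq> 0" using q q' by simp
    ultimately show ?thesis unfolding poly_dep_def by blast
  qed
  define F where "F = (\<lambda>i. ad (e i)) ` {..<r} \<union> (\<lambda>(i, g). e i * g) ` ({..<r} \<times> G)"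
  have "\<exists>q C. q \<noteq> 0 \<and> (\<forall>f\<in>F. peval z q * f \<in> poly_span z r e C)"
  proof (rule poly_dep_common[where f = "\<lambda>f. f"])
    show "finite F" using G(1) by (simp add: F_def)
    fix f assume "f \<in> F"
    then show "poly_dep z r e f"
      unfolding F_def using dep_ad dep e(4) algG generated_base by (auto simp: subalgebra_def)
  qed
  then obtain q2 C2 where q2: "q2 \<noteq> 0" "\<forall>f\<in>F. peval z q2 * f \<in> poly_span z r e C2" by blast
  \<comment> \<open>\<open>q1\<close> clears the expansions of the generators, \<open>q2\<close> the
    products of the basis \<open>e\<close> with \<open>G\<close> and the values of \<open>ad\<close>
    on it. \<open>C\<close> bounds the rise in degree at each single step below.\<close>
  define q where "q = q1 * q2"
  define C where "C = degree q1 + degree q2 + C2"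
  define Q where "Q = peval z q"
  have q_0: "q \<noteq> 0" using c'(2) q2(1) by (simp add: q_def q1_def)
  have degq: "degree q \<le> C" using degree_mult_le[of q1 q2] by (simp add: q_def C_def)
  have Q_0: "Q \<noteq> 0" using peval_eq_0_iff[OF z(2)] q_0 by (simp add: Q_def)
  have Q12: "Q = peval z q2 * peval z q1" by (simp add: Q_def q_def peval_mult peval_commute)
  let ?E = "poly_span z r e"
  have QF: "Q * f \<in> ?E C" if "f \<in> F" for f
  proof -
    have "peval z q1 * (peval z q2 * f) \<in> ?E (degree q1 + C2)" using q2(2) that by (intro poly_span_mult) auto
    then show ?thesis using poly_span_mono[of "degree q1 + C2" C]
      by (auto simp: Q_def q_def peval_mult mult.assoc C_def)
  qed
  have pmult: "peval z p * f \<in> ?E (D + C)" if "f \<in> ?E D" "degree p \<le> C" for p f D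
    using poly_span_mult[OF that(1), of p] poly_span_mono[of "degree p + D" "D + C"] that(2) by auto
  have Eker: "?E D \<subseteq> kernel" for D
  proof
    fix f assume "f \<in> ?E D"
    then obtain p where "f = (\<Sum>i<r. peval z (p i) * e i)" by (rule poly_spanE)
    then show "f \<in> kernel"
      using e(4) GK by (auto intro!: subspace_sum kernel peval_in_subalgebra[OF subalgebra_kernel z(1)])
  qed
  have Qg: "Q * (g * f) \<in> ?E (D + C)" if g: "g \<in> G" and f: "f \<in> ?E D" for g f D
  proof -
    have "Q * (f * g) \<in> ?E (D + C)"
      unfolding Q_def using QF g by (intro poly_span_right_mult[OF f]) (auto simp: F_def Q_def)
    moreover have "f * g = g * f" using f g Eker G(6) by (intro kernel_commute) auto
    ultimately show ?thesis by simp
  qed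
  have Qad: "Q * ad f \<in> ?E (D + C)" if f: "f \<in> ?E D" for f D
  proof -
    obtain p where p: "f = (\<Sum>i<r. peval z (p i) * e i)" "\<And>i. i < r \<Longrightarrow> degree (p i) \<le> D"
      using f by (rule poly_spanE) blast
    have "peval z (pderiv (p i)) * (Q * (ad z * e i)) + peval z (p i) * (Q * ad (e i)) \<in> ?E (D + C)"
      if i: "i < r" for i
    proof (rule subspace_add[OF subspace_poly_span])
      have "Q * (ad z * e i) \<in> ?E (0 + C)" by (intro Qg G(4) poly_span_base i)
      then have "peval z (pderiv (p i)) * (Q * (ad z * e i)) \<in> ?E (degree (pderiv (p i)) + C)"
        using poly_span_mult by auto
      moreover have "degree (pderiv (p i)) + C \<le> D + C"
        using p(2)[OF i] degree_pderiv[of "p i"] by linarith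
      ultimately show "peval z (pderiv (p i)) * (Q * (ad z * e i)) \<in> ?E (D + C)"
        using poly_span_mono by blast
      have "Q * ad (e i) \<in> ?E C" using i by (intro QF) (auto simp: F_def)
      then have "peval z (p i) * (Q * ad (e i)) \<in> ?E (degree (p i) + C)" by (rule poly_span_mult)
      then show "peval z (p i) * (Q * ad (e i)) \<in> ?E (D + C)"
        using poly_span_mono[of "degree (p i) + C" "D + C"] p(2)[OF i] by auto
    qed
    then have "(\<Sum>i<r. peval z (pderiv (p i)) * (Q * (ad z * e i)) + peval z (p i) * (Q * ad (e i))) \<in> ?E (D + C)"
      by (intro subspace_sum subspace_poly_span) auto
    also have "(\<Sum>i<r. peval z (pderiv (p i)) * (Q * (ad z * e i)) + peval z (p i) * (Q * ad (e i))) = Q * ad f"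
    proof -
      have comm: "peval z p * (Q * g) = Q * (peval z p * g)" for p g
        unfolding Q_def mult.assoc[symmetric] peval_commute[of z p q] ..
      show ?thesis unfolding comm p(1) ad_sum ad_mult ad_peval[OF z(1)]
        by (simp add: sum_distrib_left distrib_left mult.assoc)
    qed
    finally show ?thesis .
  qed
  let ?F = "skew_span z r e"
  define Y where "Y m = {a. Q ^ m * a \<in> ?F m (C * m)}" for m
  have Y_sub: "subspace (Y m)" for m
    unfolding subspace_def Y_def
    using subspace_0[OF subspace_skew_span] subspace_add[OF subspace_skew_span] subspace_scale[OF subspace_skew_span]
    by (auto simp: distrib_left scale_mult_right)
  have skew_Q: "peval z p * a \<in> ?F m (D + C)" if "a \<in> ?F m D" "degree p \<le> C" for p a m D
    by (rule skew_span_left_mult[OF that(1)]) (rule pmult[OF _ that(2)])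
  have Y_Suc: "Y m \<subseteq> Y (Suc m)" for m
  proof
    fix a assume "a \<in> Y m"
    then have "Q * (Q ^ m * a) \<in> ?F m (C * m + C)" unfolding Y_def Q_def using degq by (intro skew_Q) auto
    then show "a \<in> Y (Suc m)" unfolding Y_def using skew_span_mono[of m "Suc m" "C * m + C" "C * Suc m" z r e]
      by (auto simp: mult.assoc)
  qed
  have Y_mono: "m \<le> n \<Longrightarrow> Y m \<subseteq> Y n" for m n
    using Y_Suc by (rule lift_Suc_mono_le)
  have Y_G: "g * a \<in> Y (Suc m)" if g: "g \<in> G" and a: "a \<in> Y m" for g a m
  proof -
    have "Q ^ m \<in> kernel" unfolding Q_def by (intro power_kernel peval_in_subalgebra[OF subalgebra_kernel z(1)])
    then have gQ: "Q ^ m * g = g * Q ^ m" using g G(6) by (intro kernel_commute) auto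
    have "Q ^ Suc m * (g * a) = Q * ((Q ^ m * g) * a)" by (simp only: mult.assoc power_Suc)
    also have "\<dots> = (Q * g) * (Q ^ m * a)" unfolding gQ by (simp only: mult.assoc)
    also have "\<dots> \<in> ?F m (C * m + C)"
    proof (rule skew_span_left_mult)
      show "Q ^ m * a \<in> ?F m (C * m)" using a by (simp add: Y_def)
    qed (simp add: mult.assoc Qg g)
    finally show ?thesis unfolding Y_def using skew_span_mono[of m "Suc m" "C * m + C" "C * Suc m" z r e] by auto
  qed
  have Y_x: "x * a \<in> Y (m + 2)" if a: "a \<in> Y m" for a m
  proof -
    define y where "y = Q ^ m * a"
    have y: "y \<in> ?F m (C * m)" using a by (simp add: Y_def y_def)
    obtain f where f: "y = (\<Sum>j\<le>m. f j * x ^ j)" "\<forall>j\<le>m. f j \<in> ?E (C * m)" using y by (rule skew_spanE)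
    have "Q * (x * y) = (\<Sum>j\<le>m. Q * (x * (f j * x ^ j)))"
      by (simp add: f(1) sum_distrib_left)
    \<comment> \<open>From x f = f x + ad f: either the power of \<open>x\<close> rises by one or
      the coefficient is differentiated.\<close>
    also have "\<dots> = (\<Sum>j\<le>m. (Q * f j) * x ^ Suc j) + (\<Sum>j\<le>m. (Q * ad (f j)) * x ^ j)"
      unfolding sum.distrib[symmetric]
      by (intro sum.cong refl) (simp add: ad_def algebra_simps)
    also have "(\<Sum>j\<le>m. (Q * f j) * x ^ Suc j) =
        (\<Sum>j\<le>Suc m. (if j = 0 then 0 else Q * f (j - 1)) * x ^ j)"
      by (subst sum.atMost_Suc_shift) simp
    also have "\<dots> + (\<Sum>j\<le>m. (Q * ad (f j)) * x ^ j) \<in> ?F (Suc m) (C * m + C)"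
    proof (rule subspace_add[OF subspace_skew_span])
      show "(\<Sum>j\<le>Suc m. (if j = 0 then 0 else Q * f (j - 1)) * x ^ j) \<in> ?F (Suc m) (C * m + C)"
        using f(2) pmult[OF _ degq] subspace_0[OF subspace_poly_span] unfolding Q_def
        by (intro skew_spanI) auto
      have "(\<Sum>j\<le>m. (Q * ad (f j)) * x ^ j) \<in> ?F m (C * m + C)"
        using f(2) Qad by (intro skew_spanI) auto
      then show "(\<Sum>j\<le>m. (Q * ad (f j)) * x ^ j) \<in> ?F (Suc m) (C * m + C)"
        using skew_span_mono[of m "Suc m" "C * m + C" "C * m + C" z r e] by auto
    qed
    finally have Qxy: "Q * (x * y) \<in> ?F (Suc m) (C * m + C)" .
    have "Q * (Q * (x * y)) \<in> ?F (Suc m) (C * m + C + C)"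
      unfolding Q_def by (rule skew_Q[OF Qxy[unfolded Q_def] degq])
    then have 1: "Q * (Q * (x * y)) \<in> ?F (m + 2) (C * (m + 2))"
      using skew_span_mono[of "Suc m" "m + 2" "C * m + C + C" "C * (m + 2)" z r e] by auto
    have "(Q * ad z) * y \<in> ?F m (C * m + C)"
      using Qg[OF G(4)] by (intro skew_span_left_mult[OF y]) (auto simp: mult.assoc)
    then have "peval z (pderiv q) * ((Q * ad z) * y) \<in> ?F m (C * m + C + C)"
      using degq degree_pderiv[of q] by (intro skew_Q) simp_all
    then have 2: "peval z (pderiv q) * (Q * (ad z * y)) \<in> ?F (m + 2) (C * (m + 2))"
      using skew_span_mono[of m "m + 2" "C * m + C + C" "C * (m + 2)" z r e] by (auto simp: mult.assoc)
    have "Q ^ (m + 2) * (x * a) = Q * (Q * (x * y)) - of_nat m \<odot> (peval z (pderiv q) * (Q * (ad z * y)))"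
      unfolding Q_def y_def by (rule x_peval_power[OF z(1)])
    also have "\<dots> \<in> ?F (m + 2) (C * (m + 2))"
      by (intro subspace_diff[OF subspace_skew_span] subspace_scale[OF subspace_skew_span] 1 2)
    finally show ?thesis by (simp only: Y_def mem_Collect_eq)
  qed
  have Y_xpow: "x ^ j * a \<in> Y (m + 2 * j)" if "a \<in> Y m" for j a m
  proof (induction j)
    case (Suc j)
    then show ?case using Y_x[OF Suc.IH] by (simp add: mult.assoc)
  qed (use that in simp)
  have Y_q1: "a \<in> Y (Suc m)" if a: "peval z q1 * a \<in> Y m" for a m
  proof -
    have "Q ^ Suc m * a = peval z q2 * (Q ^ m * (peval z q1 * a))"
    proof -
      have "Q ^ m * peval z q1 = peval z q1 * Q ^ m"
        unfolding Q_def peval_power[symmetric] by (rule peval_commute)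
      then show ?thesis by (simp only: power_Suc Q12 mult.assoc[symmetric])
    qed
    also have "\<dots> \<in> ?F m (C * m + C)" using a by (intro skew_Q) (auto simp: Y_def C_def)
    finally show ?thesis unfolding Y_def using skew_span_mono[of m "Suc m" "C * m + C" "C * Suc m" z r e] by auto
  qed
  \<comment> \<open>At most \<open>d\<close> factors \<open>x\<close> at a cost of 2 each, then 1
    for the coefficient and 1 for the denominator \<open>q1\<close>.\<close>
  define M where "M = 2 * d + 2"
  have Y_S: "s * a \<in> Y (m + M)" if s: "s \<in> S" and a: "a \<in> Y m" for s a m
  proof -
    have "\<beta> s j * (x ^ j * a) \<in> Y (Suc (m + 2 * d))" if "j \<le> d" for j
      using Y_xpow[OF a, of j] Y_mono[of "m + 2 * j" "m + 2 * d"] that by (intro Y_G G(5) s) auto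
    then have "(\<Sum>j\<le>d. \<beta> s j * (x ^ j * a)) \<in> Y (Suc (m + 2 * d))" by (intro subspace_sum Y_sub) auto
    also have "(\<Sum>j\<le>d. \<beta> s j * (x ^ j * a)) = peval z q1 * (s * a)"
      unfolding mult.assoc[symmetric] \<beta>[OF s] by (simp add: sum_distrib_right)
    finally show ?thesis using Y_q1 by (simp add: M_def)
  qed
  have Y_V: "v * a \<in> Y (m + M)" if v: "v \<in> span S" and a: "a \<in> Y m" for v a m
    using v
  proof (induction rule: span_induct_alt)
    case base
    then show ?case using subspace_0[OF Y_sub] by simp
  next
    case (step k s y)
    then show ?case using Y_S[OF _ a] subspace_add[OF Y_sub] subspace_scale[OF Y_sub]
      by (simp add: distrib_right scale_mult_left)
  qed
  \<comment> \<open>The word acts by left multiplication, its last letter first, so the induction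
    has to allow an arbitrary \<open>a\<close> at an arbitrary level \<open>m\<close>; it is then
    applied to 1 in \<open>Y 0\<close>.\<close>
  have Y_power: "v * a \<in> Y (m + M * n)" if "v \<in> space_power (span S) n" "a \<in> Y m" for v a m n
    using that
  proof (induction n arbitrary: v a m)
    case 0
    then show ?case using subspace_scale[OF Y_sub] by (auto simp: span_singleton scale_mult_left)
  next
    case (Suc n)
    have "v \<in> span {u * w |u w. u \<in> space_power (span S) n \<and> w \<in> span S}" using Suc.prems by simp
    then show ?case
    proof (induction rule: span_induct_alt)
      case base
      then show ?case using subspace_0[OF Y_sub] by simp
    next
      case (step k s y)
      then obtain u w where uw: "u \<in> space_power (span S) n" "w \<in> span S" "s = u * w" by auto
      have "u * (w * a) \<in> Y (m + M + M * n)" by (intro Suc.IH uw Y_V Suc.prems)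
      then have "s * a \<in> Y (m + M * Suc n)" by (simp add: uw(3) mult.assoc algebra_simps)
      then show ?case using step(2) subspace_add[OF Y_sub] subspace_scale[OF Y_sub]
        by (simp only: distrib_right scale_mult_left)
    qed
  qed
  have "1 \<in> Y 0" using poly_span_base[OF e(1), of e z 0] skew_spanI[of 0 "\<lambda>_. 1" z r e 0] e(2)
    by (simp add: Y_def)
  then have VY: "space_power (span S) n \<subseteq> Y (M * n)" for n using Y_power[of _ n 1 0] by auto
  have "dim (space_power (span S) n) \<le> ((M + 1) * (r * (C * M + 1))) * (n + 1) ^ 2" for n
  proof -
    have "dim (space_power (span S) n) \<le> dim (?F (M * n) (C * (M * n)))"
      using VY[of n] Q_0
      by (intro dim_le_of_mult[where g = "Q ^ (M * n)"] fin_dim_space_power fin_dim_span S(1)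
          dim_skew_span(1) subspace_skew_span) (auto simp: Y_def)
    also have "\<dots> \<le> (M * n + 1) * (r * (C * (M * n) + 1))" by (rule dim_skew_span(2))
    also have "\<dots> \<le> ((M + 1) * (n + 1)) * (r * ((C * M + 1) * (n + 1)))"
      by (intro mult_mono mult_left_mono) (auto simp: algebra_simps)
    also have "\<dots> = ((M + 1) * (r * (C * M + 1))) * (n + 1) ^ 2" by (simp only: power2_eq_square mult_ac)
    finally show ?thesis .
  qed
  then show ?thesis by blast
qed

theorem GKdim_le_2: "GKdim \<le> 2"
proof -
  obtain S where S: "finite S" "generating_space (span S)" by (rule generating_span)
  have S1: "1 \<in> span S" using S(2) by (simp add: generating_space_def)
  obtain K where K: "\<And>n. dim (space_power (span S) n) \<le> K * (n + 1) ^ 2"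
    using growth_trivial_kernel[OF S(1) S1] growth_nontrivial_kernel[OF S(1) S1] by blast
  let ?f = "\<lambda>n. ln (real (dim (space_power (span S) n)))"
  have pos: "dim (space_power (span S) n) \<ge> 1" for n
    by (intro dim_space_power_pos fin_dim_span S S1)
  have K1: "K \<ge> 1" using K[of 0] pos[of 0] by simp
  have "eventually (\<lambda>n. ereal (?f n / ln (real n)) \<le> ereal ((ln (real K) + 2 * ln (real n + 1)) / ln (real n))) sequentially"
    using eventually_gt_at_top[of 1]
  proof eventually_elim
    case (elim n)
    have "?f n \<le> ln (real (K * (n + 1) ^ 2))"
      using pos[of n] K[of n] by (intro ln_mono) (auto simp del: of_nat_mult of_nat_power intro: order_less_le_trans)
    also have "\<dots> = ln (real K) + 2 * ln (real n + 1)"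
      using K1 by (simp add: ln_mult ln_realpow)
    finally show ?case using elim by (simp add: divide_right_mono)
  qed
  then have "growth_exponent (span S) \<le> limsup (\<lambda>n. ereal ((ln (real K) + 2 * ln (real n + 1)) / ln (real n)))"
    unfolding growth_exponent_def by (rule Limsup_mono)
  also have "(\<lambda>n. (ln (real K) + 2 * ln (real n + 1)) / ln (real n)) \<longlonglongrightarrow> 2" by real_asymp
  then have "limsup (\<lambda>n. ereal ((ln (real K) + 2 * ln (real n + 1)) / ln (real n))) = ereal 2"
    by (intro lim_imp_Limsup) auto
  finally show ?thesis using GKdim_eq[OF S(2)] by simp
qed

end

text \<open>Take the last but one nonzero iterate of \<delta> on an element that \<delta> does not
  kill; such an element has at least two nonzero iterates, counting itself.\<close>

lemma (in k_algebra) ex_slice: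
  assumes "derivation \<delta>" "locally_nilpotent \<delta>" "\<delta> \<noteq> (\<lambda>_. 0)"
  obtains x where "\<delta> x \<noteq> 0" "\<delta> (\<delta> x) = 0"
proof -
  interpret D: Vector_Spaces.linear scale scale \<delta> using assms(1) by (simp add: derivation_def)
  obtain a where a: "\<delta> a \<noteq> 0" using assms(3) by auto
  define n where "n = (LEAST n. (\<delta> ^^ n) a = 0)"
  have "\<exists>n. (\<delta> ^^ n) a = 0" using assms(2) by (simp add: locally_nilpotent_def)
  then have n: "(\<delta> ^^ n) a = 0" unfolding n_def by (rule LeastI_ex)
  have min: "(\<delta> ^^ m) a \<noteq> 0" if "m < n" for m using not_less_Least that unfolding n_def by blast
  have "n \<noteq> 0" using n a D.zero by (metis funpow_0)
  moreover have "n \<noteq> 1" using n a by auto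
  ultimately obtain m where m: "n = Suc (Suc m)" by (metis One_nat_def not0_implies_Suc)
  show ?thesis using that[of "(\<delta> ^^ m) a"] min[of "Suc m"] n m by simp
qed

theorem theorem1p2:
  fixes scale :: "'k::{alg_closed_field, field_char_0} \<Rightarrow> 'a::ring_1_no_zero_divisors \<Rightarrow> 'a"
    and \<delta> :: "'a \<Rightarrow> 'a"
  assumes "k_algebra scale"
    and "k_algebra.finitely_generated scale"
    and "2 \<le> k_algebra.GKdim scale" and "k_algebra.GKdim scale < 3"
    and "k_algebra.derivation scale \<delta>"
    and "locally_nilpotent \<delta>"
    and "\<delta> \<noteq> (\<lambda>_. 0)"
  shows "k_algebra.GKdim scale = 2"
proof -
  interpret k_algebra scale by (rule assms(1))
  obtain x where x: "\<delta> x \<noteq> 0" "\<delta> (\<delta> x) = 0" using ex_slice[OF assms(5-7)] .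
  interpret nilpotent_derivation scale \<delta> x "\<delta> x"
    using assms x by unfold_locales auto
  show ?thesis using GKdim_le_2 assms(3) by (rule antisym)
qed

end
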